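(* Let $(M,c_M,D^M)$ and $(N,c_N,D^N)$ be even-dimensional oriented Weyl spaces with associated nonintegrable almost twistorial structures $\tau'_M=(Q_M,M,\pi_M,\mathcal{J}'_M)$ and $\tau'_N=(Q_N,N,\pi_N,\mathcal{J}'_N)$. Let $\varphi:M\hookrightarrow N$ be an injective immersion, and let $\pi:Q\to M$ be the bundle of positive maximal isotropic spaces on the normal bundle $\bigl((TM)^{\perp},c_N|_{(TM)^{\perp}}\bigr)$. Let $p$ be a section of $Q_M$ which is isotropic with respect to $c_N$, let $q$ be a section of $Q$, and let $\Phi:p(M)\to Q_N$ be given by $\Phi\circ p=p\oplus q$. Let $J^p$ be the almost Hermitian structure on $(M,c_M)$ whose $(-\mathrm{i})$-eigenbundle is $p$ and let $\mathcal{J}^p$ be the almost complex structure on $Q$ described in the context. Then the following assertions are equivalent: (i) $\varphi:(M,\tau'_M)\to(N,\tau'_N)$ is twistorial, with respect to $\Phi$. (ii) $\varphi$ is $(1,1)$-geodesic with respect to $J^p$, and $p:(M,J^p)\to(Q_M,\mathcal{J}'_M)$ and $q:(M,J^p)\to(Q,\mathcal{J}^p)$ are holomorphic.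
   Context: Manifolds are smooth and connected. A Weyl space $(M,c,D)$ is a manifold with a conformal structure $c$ (conformal class of Riemannian metrics) and a torsion-free connection $D$ on $TM$ preserving $c$. Conformal structures are extended complex-bilinearly; a complex subspace is isotropic if the conformal structure vanishes on it. On an oriented even-rank real vector bundle with conformal structure, the positive maximal isotropic spaces are the $(-\mathrm{i})$-eigenspaces of the positive orthogonal complex structures on the fibres; they form a bundle whose fibres are complex submanifolds of Grassmannians, so the vertical bundle $\ker\mathrm{d}\pi$ has a decomposition $(\ker\mathrm{d}\pi)^{\mathbb{C}}=(\ker\mathrm{d}\pi)^{1,0}\oplus(\ker\mathrm{d}\pi)^{0,1}$. Nonintegrable almost twistorial structure associated to an oriented even-dimensional Weyl space $(M,c,D)$: the quadruple $(Q_M,M,\pi_M,\mathcal{J}'_M)$, where $\pi_M:Q_M\to M$ is the bundle of positive maximal isotropic spaces on $(M,c)$ and $\mathcal{J}'_M$ is the almost complex structure on $Q_M$ whose $(-\mathrm{i})$-eigenbundle is $\mathscr{G}_0\oplus(\ker\mathrm{d}\pi_M)^{1,0}$, with $\mathscr{G}_0\subseteq\mathscr{H}^{\mathbb{C}}$ characterised by $\mathrm{d}\pi_M((\mathscr{G}_0)_u)=u$ for $u\in Q_M$, where $\mathscr{H}\subseteq TQ_M$ is the connection induced by $D$. Similarly for $N$. $M$ is identified with its image; $(TM)^{\perp}\subseteq TN|_M$ is the $c_N$-orthogonal complement, oriented so that $TN|_M=TM\oplus(TM)^{\perp}$ is orientation preserving. $\Pi:TN|_M\to(TM)^{\perp}$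 is the orthogonal projection; $\Pi\circ D^N$ is a connection on $(TM)^{\perp}$ and induces a connection on $Q$. $\mathcal{J}^p$ is the almost complex structure on $Q$ whose eigenbundle corresponding to $+\mathrm{i}$ is the direct sum of the horizontal lift (with respect to this connection) of $\overline{p}\subseteq T^{\mathbb{C}}M$ and of $(\ker\mathrm{d}\pi)^{0,1}$. A map between almost complex manifolds is holomorphic if its differential maps the $(-\mathrm{i})$-eigenbundle into the $(-\mathrm{i})$-eigenbundle. Given a section $p$ of $Q_M$ and a map $\Phi:p(M)\to Q_N$ with $\pi_N\circ\Phi=\varphi\circ\pi_M|_{p(M)}$, the map $\varphi:(M,\tau'_M)\to(N,\tau'_N)$ is twistorial with respect to $\Phi$ if the tangent bundle of $p(M)$ is preserved by $\mathcal{J}'_M$ and $\Phi:(p(M),\mathcal{J}'_M|_{p(M)})\to(Q_N,\mathcal{J}'_N)$ is holomorphic. $\varphi$ is $(1,1)$-geodesic with respect to $J^p$ if $(D\,\mathrm{d}\varphi)(\overline{X},Y)=0$ for all $x\in M$, $X,Y\in p_x$, where $D\,\mathrm{d}\varphi$ is the second fundamental form of $\varphi$ with respect to $D^M$ and $D^N$, $(D\,\mathrm{d}\varphi)(X,Y)=D^N_X(\mathrm{d}\varphi(Y))-\mathrm{d}\varphi(D^M_XY)$, extended complex-bilinearly. *)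

theory Defs
  imports "HOL-Analysis.Analysis"
begin

section \<open>Complexification of real vector spaces\<close>

text \<open>The pair \<open>(a, b)\<close> stands for \<open>a + i b\<close>; the complexification of a real
  subspace \<open>V\<close> is \<open>V \<times> V\<close>.\<close>

type_synonym 'v cx = "'v \<times> 'v"

definition cI :: "'v::real_vector cx \<Rightarrow> 'v cx" where
  "cI z = (- snd z, fst z)"

definition cconj :: "'v::real_vector cx \<Rightarrow> 'v cx" where
  "cconj z = (fst z, - snd z)"

definition cmap :: "('v \<Rightarrow> 'w) \<Rightarrow> 'v cx \<Rightarrow> 'w cx" where
  "cmap f z = (f (fst z), f (snd z))"

text \<open>Complex-bilinear extension of a real bilinear map.\<close>

definition cbil :: "('u \<Rightarrow> 'v \<Rightarrow> 'w::real_vector) \<Rightarrow> 'u cx \<Rightarrow> 'v cx \<Rightarrow> 'w cx" where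
  "cbil \<beta> z w = (\<beta> (fst z) (fst w) - \<beta> (snd z) (snd w), \<beta> (fst z) (snd w) + \<beta> (snd z) (fst w))"

definition eig_minus_i :: "'v::real_vector set \<Rightarrow> ('v \<Rightarrow> 'v) \<Rightarrow> 'v cx set" where
  "eig_minus_i V J = {z \<in> V \<times> V. cmap J z = - cI z}"

definition eig_plus_i :: "'v::real_vector set \<Rightarrow> ('v \<Rightarrow> 'v) \<Rightarrow> 'v cx set" where
  "eig_plus_i V J = {z \<in> V \<times> V. cmap J z = cI z}"

definition complex_structure :: "'v::real_vector set \<Rightarrow> ('v \<Rightarrow> 'v) \<Rightarrow> bool" where
  "complex_structure V J \<longleftrightarrow> linear J \<and> J ` V \<subseteq> V \<and> (\<forall>v\<in>V. J (J v) = - v)"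

text \<open>The complex structure on \<open>V\<close> with prescribed eigenspace for \<open>-i\<close>, respectively \<open>+i\<close>
  (it is unique on \<open>V\<close>; its values off \<open>V\<close> are irrelevant).\<close>

definition acs_minus :: "'v::real_vector set \<Rightarrow> 'v cx set \<Rightarrow> 'v \<Rightarrow> 'v" where
  "acs_minus V E = (SOME J. complex_structure V J \<and> eig_minus_i V J = E)"

definition acs_plus :: "'v::real_vector set \<Rightarrow> 'v cx set \<Rightarrow> 'v \<Rightarrow> 'v" where
  "acs_plus V E = (SOME J. complex_structure V J \<and> eig_plus_i V J = E)"

definition ssum :: "'v::plus set \<Rightarrow> 'v set \<Rightarrow> 'v set" where
  "ssum E F = {a + b |a b. a \<in> E \<and> b \<in> F}"

section \<open>Smooth manifolds\<close>

primrec Ck_on :: "nat \<Rightarrow> ('a::real_normed_vector \<Rightarrow> 'b::real_normed_vector) \<Rightarrow> 'a set \<Rightarrow> bool" where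
  "Ck_on 0 f S = continuous_on S f"
| "Ck_on (Suc k) f S = (\<exists>f'. (\<forall>x\<in>S. (f has_derivative f' x) (at x)) \<and> (\<forall>v. Ck_on k (\<lambda>x. f' x v) S))"

text \<open>Used for open sets \<open>S\<close> only.\<close>

definition smooth_on :: "('a::real_normed_vector \<Rightarrow> 'b::real_normed_vector) \<Rightarrow> 'a set \<Rightarrow> bool" where
  "smooth_on f S \<longleftrightarrow> (\<forall>k. Ck_on k f S)"

type_synonym ('x, 'm) chart = "'x set \<times> ('x \<Rightarrow> real^'m)"
type_synonym ('x, 'm) atlas = "('x, 'm) chart set"

definition chart_inv :: "('x, 'm) chart \<Rightarrow> real^'m \<Rightarrow> 'x" where
  "chart_inv C = inv_into (fst C) (snd C)"

text \<open>Jacobian matrix at \<open>z\<close> of the change of coordinates from \<open>C\<close> to \<open>C'\<close>.\<close>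

definition jac :: "('x, 'm::finite) chart \<Rightarrow> ('x, 'm) chart \<Rightarrow> 'x \<Rightarrow> real^'m^'m" where
  "jac C C' z = matrix (frechet_derivative (snd C' \<circ> chart_inv C) (at (snd C z)))"

locale oriented_manifold =
  fixes A :: "('x::{t2_space,second_countable_topology}, 'm::finite) atlas"
  assumes connected_space: "connected (UNIV :: 'x set)"
    and charts_cover: "(\<Union>C\<in>A. fst C) = UNIV"
    and charts_homeomorphic: "C \<in> A \<Longrightarrow> open (fst C) \<and> open (snd C ` fst C) \<and>
          homeomorphism (fst C) (snd C ` fst C) (snd C) (chart_inv C)"
    and transitions_smooth: "\<lbrakk>C \<in> A; C' \<in> A\<rbrakk> \<Longrightarrow>
          smooth_on (snd C' \<circ> chart_inv C) (snd C ` (fst C \<inter> fst C'))"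
    and transitions_oriented: "\<lbrakk>C \<in> A; C' \<in> A; z \<in> fst C \<inter> fst C'\<rbrakk> \<Longrightarrow> det (jac C C' z) > 0"

text \<open>Each point has a preferred chart, and the tangent space at \<open>x\<close> is \<open>real^'m\<close>: a tangent
  vector being given by its components in the preferred chart at \<open>x\<close>. The matrices \<open>to_at A x z\<close>
  and \<open>from_at A x z\<close> convert, at the point \<open>z\<close>, between components in the preferred chart
  at \<open>z\<close> and components in the preferred chart at \<open>x\<close>.\<close>

definition chart_at :: "('x, 'm) atlas \<Rightarrow> 'x \<Rightarrow> ('x, 'm) chart" where
  "chart_at A x = (SOME C. C \<in> A \<and> x \<in> fst C)"

definition to_at :: "('x, 'm::finite) atlas \<Rightarrow> 'x \<Rightarrow> 'x \<Rightarrow> real^'m^'m" where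
  "to_at A x z = jac (chart_at A z) (chart_at A x) z"

definition from_at :: "('x, 'm::finite) atlas \<Rightarrow> 'x \<Rightarrow> 'x \<Rightarrow> real^'m^'m" where
  "from_at A x z = jac (chart_at A x) (chart_at A z) z"

definition smooth_fn :: "('x, 'm::finite) atlas \<Rightarrow> 'x set \<Rightarrow> ('x \<Rightarrow> 'b::real_normed_vector) \<Rightarrow> bool" where
  "smooth_fn A U f \<longleftrightarrow> (\<forall>C\<in>A. smooth_on (f \<circ> chart_inv C) (snd C ` (fst C \<inter> U)))"

definition fn_deriv :: "('x, 'm::finite) atlas \<Rightarrow> ('x \<Rightarrow> 'b::real_normed_vector) \<Rightarrow> 'x \<Rightarrow> real^'m \<Rightarrow> 'b" where
  "fn_deriv A f x v =
    frechet_derivative (f \<circ> chart_inv (chart_at A x)) (at (snd (chart_at A x) x)) v"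

definition smooth_map ::
  "('x::topological_space, 'm::finite) atlas \<Rightarrow> ('y::topological_space, 'n::finite) atlas \<Rightarrow> ('x \<Rightarrow> 'y) \<Rightarrow> bool" where
  "smooth_map A B f \<longleftrightarrow> continuous_on UNIV f \<and> (\<forall>C\<in>B. smooth_fn A (f -` fst C) (snd C \<circ> f))"

definition mfd_deriv ::
  "('x, 'm::finite) atlas \<Rightarrow> ('y, 'n::finite) atlas \<Rightarrow> ('x \<Rightarrow> 'y) \<Rightarrow> 'x \<Rightarrow> real^'m \<Rightarrow> real^'n" where
  "mfd_deriv A B f x v = fn_deriv A (snd (chart_at B (f x)) \<circ> f) x v"

definition injective_immersion ::
  "('x::topological_space, 'm::finite) atlas \<Rightarrow> ('y::topological_space, 'n::finite) atlas \<Rightarrow> ('x \<Rightarrow> 'y) \<Rightarrow> bool" where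
  "injective_immersion A B f \<longleftrightarrow> smooth_map A B f \<and> inj f \<and> (\<forall>x. inj (mfd_deriv A B f x))"

subsection \<open>Vector fields and connections\<close>

definition smooth_field :: "('x, 'm::finite) atlas \<Rightarrow> 'x set \<Rightarrow> ('x \<Rightarrow> real^'m) \<Rightarrow> bool" where
  "smooth_field A U Y \<longleftrightarrow>
    (\<forall>x. smooth_fn A (U \<inter> fst (chart_at A x)) (\<lambda>z. to_at A x z *v Y z))"

text \<open>The vector field with constant components \<open>w\<close> in the preferred chart at \<open>x\<close>.\<close>

definition const_field :: "('x, 'm::finite) atlas \<Rightarrow> 'x \<Rightarrow> real^'m \<Rightarrow> 'x \<Rightarrow> real^'m" where
  "const_field A x w z = from_at A x z *v w"

definition lie_bracket ::
  "('x, 'm::finite) atlas \<Rightarrow> ('x \<Rightarrow> real^'m) \<Rightarrow> ('x \<Rightarrow> real^'m) \<Rightarrow> 'x \<Rightarrow> real^'m" where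
  "lie_bracket A X Y x =
     fn_deriv A (\<lambda>z. to_at A x z *v Y z) x (X x) - fn_deriv A (\<lambda>z. to_at A x z *v X z) x (Y x)"

text \<open>\<open>D x v Y\<close> is the covariant derivative at \<open>x\<close>, in the direction of the tangent
  vector \<open>v\<close>, of a vector field \<open>Y\<close> which is smooth near \<open>x\<close>.\<close>

type_synonym ('x, 'm) covd = "'x \<Rightarrow> real^'m \<Rightarrow> ('x \<Rightarrow> real^'m) \<Rightarrow> real^'m"

locale affine_connection =
  fixes A :: "('x::topological_space, 'm::finite) atlas" and D :: "('x, 'm) covd"
  assumes linear_direction: "\<lbrakk>open U; x \<in> U; smooth_field A U Y\<rbrakk> \<Longrightarrow> linear (\<lambda>v. D x v Y)"
    and additive: "\<lbrakk>open U; x \<in> U; smooth_field A U Y; smooth_field A U Z\<rbrakk> \<Longrightarrow>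
          D x v (\<lambda>z. Y z + Z z) = D x v Y + D x v Z"
    and leibniz: "\<lbrakk>open U; x \<in> U; smooth_fn A U h; smooth_field A U Y\<rbrakk> \<Longrightarrow>
          D x v (\<lambda>z. h z *\<^sub>R Y z) = fn_deriv A h x v *\<^sub>R Y x + h x *\<^sub>R D x v Y"
    and local: "\<lbrakk>open U; x \<in> U; smooth_field A U Y; \<And>z. z \<in> U \<Longrightarrow> Y z = Z z\<rbrakk> \<Longrightarrow> D x v Y = D x v Z"
    and smooth: "\<lbrakk>open U; smooth_field A U X; smooth_field A U Y\<rbrakk> \<Longrightarrow>
          smooth_field A U (\<lambda>x. D x (X x) Y)"

definition torsion_free :: "('x::topological_space, 'm::finite) atlas \<Rightarrow> ('x, 'm) covd \<Rightarrow> bool" where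
  "torsion_free A D \<longleftrightarrow> (\<forall>U X Y. open U \<and> smooth_field A U X \<and> smooth_field A U Y \<longrightarrow>
     (\<forall>x\<in>U. D x (X x) Y - D x (Y x) X = lie_bracket A X Y x))"

definition christoffel :: "('x, 'm::finite) atlas \<Rightarrow> ('x, 'm) covd \<Rightarrow> 'x \<Rightarrow> real^'m \<Rightarrow> real^'m \<Rightarrow> real^'m" where
  "christoffel A D x v w = D x v (const_field A x w)"

text \<open>The pull-back connection on \<open>f\<^sup>*TN\<close>, in coordinates: derivative at \<open>x\<close> in the direction
  \<open>v\<close> of a vector field \<open>Z\<close> along \<open>f\<close>.\<close>

definition cov_along ::
  "('x, 'm::finite) atlas \<Rightarrow> ('y, 'n::finite) atlas \<Rightarrow> ('x \<Rightarrow> 'y) \<Rightarrow> ('y, 'n) covd \<Rightarrow>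
   'x \<Rightarrow> real^'m \<Rightarrow> ('x \<Rightarrow> real^'n) \<Rightarrow> real^'n" where
  "cov_along A B f D x v Z =
     fn_deriv A (\<lambda>z. to_at B (f x) (f z) *v Z z) x v
     + christoffel B D (f x) (mfd_deriv A B f x v) (Z x)"

text \<open>\<open>D\<^sup>N\<^sub>v (df Y) - df (D\<^sup>M\<^sub>v Y)\<close> depends on \<open>Y\<close> only through its value \<open>w\<close> at \<open>x\<close>; we extend
  \<open>w\<close> by a coordinate field.\<close>

definition second_fundamental_form ::
  "('x, 'm::finite) atlas \<Rightarrow> ('x, 'm) covd \<Rightarrow> ('y, 'n::finite) atlas \<Rightarrow> ('y, 'n) covd \<Rightarrow> ('x \<Rightarrow> 'y) \<Rightarrow>
   'x \<Rightarrow> real^'m \<Rightarrow> real^'m \<Rightarrow> real^'n" where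
  "second_fundamental_form A DM B DN f x v w =
     (let Y = const_field A x w in
        cov_along A B f DN x v (\<lambda>z. mfd_deriv A B f z (Y z)) - mfd_deriv A B f x (DM x v Y))"

subsection \<open>Weyl spaces\<close>

type_synonym ('x, 'm) metric = "'x \<Rightarrow> real^'m \<Rightarrow> real^'m \<Rightarrow> real"

definition riemannian_metric :: "('x::topological_space, 'm::finite) atlas \<Rightarrow> ('x, 'm) metric \<Rightarrow> bool" where
  "riemannian_metric A g \<longleftrightarrow>
     (\<forall>x. bilinear (g x) \<and> (\<forall>v w. g x v w = g x w v) \<and> (\<forall>v. v \<noteq> 0 \<longrightarrow> g x v v > 0)) \<and>
     (\<forall>U X Y. open U \<and> smooth_field A U X \<and> smooth_field A U Y \<longrightarrow>
        smooth_fn A U (\<lambda>x. g x (X x) (Y x)))"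

definition conformal_structure :: "('x::topological_space, 'm::finite) atlas \<Rightarrow> ('x, 'm) metric set \<Rightarrow> bool" where
  "conformal_structure A c \<longleftrightarrow> (\<exists>g. riemannian_metric A g \<and>
     c = {(\<lambda>x v w. l x * g x v w) |l :: 'x \<Rightarrow> real. smooth_fn A UNIV l \<and> (\<forall>x. l x > 0)})"

definition preserves_conformal ::
  "('x::topological_space, 'm::finite) atlas \<Rightarrow> ('x, 'm) metric set \<Rightarrow> ('x, 'm) covd \<Rightarrow> bool" where
  "preserves_conformal A c D \<longleftrightarrow> (\<forall>g\<in>c. \<exists>\<theta> :: 'x \<Rightarrow> real^'m \<Rightarrow> real.
     \<forall>U Y Z. open U \<and> smooth_field A U Y \<and> smooth_field A U Z \<longrightarrow>
       (\<forall>x\<in>U. \<forall>v. fn_deriv A (\<lambda>z. g z (Y z) (Z z)) x v - g x (D x v Y) (Z x) - g x (Y x) (D x v Z)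
          = \<theta> x v * g x (Y x) (Z x)))"

locale oriented_weyl_space = oriented_manifold A + affine_connection A D
  for A :: "('x::{t2_space,second_countable_topology}, 'm::finite) atlas"
    and c :: "('x, 'm) metric set" and D :: "('x, 'm) covd" +
  assumes conformal: "conformal_structure A c"
    and weyl_torsion_free: "torsion_free A D"
    and weyl_preserves: "preserves_conformal A c D"

text \<open>The orientation of \<open>real^'m\<close>: a list of vectors is a positive basis if the determinant
  with these columns (the index type being enumerated increasingly) is positive. As the atlas is
  oriented, this orients every tangent space consistently.\<close>

definition positive_basis :: "(real^'m::{finite,linorder}) list \<Rightarrow> bool" where
  "positive_basis vs \<longleftrightarrow>
     length vs = CARD('m) \<and> det (\<chi> i j. (vs ! card {k. k < j}) $ i) > 0"

section \<open>Bundles of positive maximal isotropic spaces\<close>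

text \<open>Complex subspaces of complexified tangent spaces; points of a bundle of such subspaces; and
  tangent vectors of such a bundle.\<close>

type_synonym 'm csubspace = "(real^'m) cx set"
type_synonym ('x, 'n) bpoint = "'x \<times> (real^'n) cx set"
type_synonym ('m, 'n) btangent = "(real^'m) \<times> (real^'n^'n)"

text \<open>The data of an oriented vector bundle \<open>W = T\<^sup>\<bottom> \<subseteq> f\<^sup>*TN\<close> over \<open>M\<close>, where \<open>f : M \<rightarrow> N\<close> is
  the footpoint map, \<open>T \<subseteq> f\<^sup>*TN\<close> is a subbundle (field \<open>bcompl\<close>), and \<open>W\<close> carries the connection
  \<open>\<Pi> \<circ> D\<close>; its orientation is given by the positive bases of its fibres. The tangent bundle of
  \<open>M\<close> is the case \<open>f = id\<close>, \<open>T = 0\<close> (then \<open>\<Pi> = id\<close>); the normal bundle is the case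
  \<open>f = \<phi>\<close>, \<open>T = TM\<close>.\<close>

record ('x, 'm, 'y, 'n) obundle =
  bbase :: "('x, 'm) atlas"
  bambient :: "('y, 'n) atlas"
  bfoot :: "'x \<Rightarrow> 'y"
  bconf :: "('y, 'n) metric set"
  bconn :: "('y, 'n) covd"
  bcompl :: "'x \<Rightarrow> (real^'n) set"
  borient :: "'x \<Rightarrow> (real^'n) list set"

definition tangent_obundle ::
  "('x, 'm::{finite,linorder}) atlas \<Rightarrow> ('x, 'm) metric set \<Rightarrow> ('x, 'm) covd \<Rightarrow> ('x, 'm, 'x, 'm) obundle" where
  "tangent_obundle A c D =
     \<lparr> bbase = A, bambient = A, bfoot = id, bconf = c, bconn = D, bcompl = (\<lambda>x. {0}),
       borient = (\<lambda>x. {vs. positive_basis vs}) \<rparr>"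

definition normal_obundle ::
  "('x, 'm::{finite,linorder}) atlas \<Rightarrow> ('y, 'n::{finite,linorder}) atlas \<Rightarrow> ('x \<Rightarrow> 'y) \<Rightarrow>
   ('y, 'n) metric set \<Rightarrow> ('y, 'n) covd \<Rightarrow> ('x, 'm, 'y, 'n) obundle" where
  "normal_obundle A B \<phi> c D =
     \<lparr> bbase = A, bambient = B, bfoot = \<phi>, bconf = c, bconn = D,
       bcompl = (\<lambda>x. range (mfd_deriv A B \<phi> x)),
       borient = (\<lambda>x. {ws. \<exists>vs. positive_basis vs \<and>
                             positive_basis (map (mfd_deriv A B \<phi> x) vs @ ws)}) \<rparr>"

definition fibre :: "('x, 'm, 'y, 'n::finite) obundle \<Rightarrow> 'x \<Rightarrow> (real^'n) set" where
  "fibre E x = {v. \<forall>g\<in>bconf E. \<forall>w\<in>bcompl E x. g (bfoot E x) v w = 0}"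

definition proj :: "('x, 'm, 'y, 'n::finite) obundle \<Rightarrow> 'x \<Rightarrow> real^'n \<Rightarrow> real^'n" where
  "proj E x v = (THE w. w \<in> fibre E x \<and> v - w \<in> bcompl E x)"

definition positive_orthogonal_acs ::
  "('x, 'm, 'y, 'n::finite) obundle \<Rightarrow> 'x \<Rightarrow> (real^'n \<Rightarrow> real^'n) \<Rightarrow> bool" where
  "positive_orthogonal_acs E x J \<longleftrightarrow>
     complex_structure (fibre E x) J \<and>
     (\<forall>g\<in>bconf E. \<forall>v\<in>fibre E x. \<forall>w\<in>fibre E x. g (bfoot E x) (J v) (J w) = g (bfoot E x) v w) \<and>
     (\<exists>es. set es \<subseteq> fibre E x \<and> concat (map (\<lambda>e. [e, J e]) es) \<in> borient E x)"

definition isotropic_bundle :: "('x, 'm, 'y, 'n::finite) obundle \<Rightarrow> ('x, 'n) bpoint set" where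
  "isotropic_bundle E =
     {(x, eig_minus_i (fibre E x) J) |x J. positive_orthogonal_acs E x J}"

subsection \<open>The smooth structure of the bundle\<close>

text \<open>A positive maximal isotropic space \<open>u\<close> at \<open>x\<close> is identified with the complex structure on
  the fibre having \<open>u\<close> as \<open>(-i)\<close>-eigenspace, extended by \<open>0\<close> on the complement. This embeds the
  bundle as a submanifold of the vector bundle \<open>f\<^sup>*End(TN)\<close>, from which it gets its smooth
  structure.\<close>

definition acs_matrix :: "('x, 'm, 'y, 'n::finite) obundle \<Rightarrow> ('x, 'n) bpoint \<Rightarrow> real^'n^'n" where
  "acs_matrix E s = (THE K. (\<forall>v\<in>bcompl E (fst s). K *v v = 0) \<and>
      eig_minus_i (fibre E (fst s)) (\<lambda>v. K *v v) = snd s)"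

text \<open>The matrix of \<open>acs_matrix E s\<close> in the preferred chart at the footpoint of \<open>x\<close>.\<close>

definition acs_coord ::
  "('x, 'm, 'y, 'n::finite) obundle \<Rightarrow> 'x \<Rightarrow> ('x, 'n) bpoint \<Rightarrow> real^'n^'n" where
  "acs_coord E x s =
     to_at (bambient E) (bfoot E x) (bfoot E (fst s)) ** acs_matrix E s
       ** from_at (bambient E) (bfoot E x) (bfoot E (fst s))"

definition smooth_section ::
  "('x, 'm::finite, 'y, 'n::finite) obundle \<Rightarrow> ('x \<Rightarrow> 'n csubspace) \<Rightarrow> bool" where
  "smooth_section E u \<longleftrightarrow> (\<forall>x. (x, u x) \<in> isotropic_bundle E) \<and>
     (\<forall>x. smooth_fn (bbase E) (bfoot E -` fst (chart_at (bambient E) (bfoot E x)))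
            (\<lambda>z. acs_coord E x (z, u z)))"

text \<open>Velocity at time \<open>0\<close> of a curve in the manifold, respectively in the bundle. A tangent vector
  of the bundle is a pair \<open>(X, P)\<close>: \<open>X\<close> is its image under the differential of the bundle
  projection, and \<open>P\<close> is the derivative of the components of the complex structure.\<close>

definition mfd_velocity ::
  "('x::t2_space, 'm::finite) atlas \<Rightarrow> (real \<Rightarrow> 'x) \<Rightarrow> real^'m \<Rightarrow> bool" where
  "mfd_velocity A \<gamma> X \<longleftrightarrow> isCont \<gamma> 0 \<and>
     ((\<lambda>t. snd (chart_at A (\<gamma> 0)) (\<gamma> t)) has_vector_derivative X) (at 0)"

definition bundle_velocity ::
  "('x::t2_space, 'm::finite, 'y, 'n::finite) obundle \<Rightarrow> (real \<Rightarrow> ('x, 'n) bpoint) \<Rightarrow>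
   ('m, 'n) btangent \<Rightarrow> bool" where
  "bundle_velocity E \<gamma> v \<longleftrightarrow> mfd_velocity (bbase E) (fst \<circ> \<gamma>) (fst v) \<and>
     ((\<lambda>t. acs_coord E (fst (\<gamma> 0)) (\<gamma> t)) has_vector_derivative snd v) (at 0)"

text \<open>The tangent space at \<open>s\<close> of a submanifold \<open>S\<close>: all velocities of curves lying in \<open>S\<close>.\<close>

definition tangent_space :: "((real \<Rightarrow> 's) \<Rightarrow> 'v \<Rightarrow> bool) \<Rightarrow> 's set \<Rightarrow> 's \<Rightarrow> 'v set" where
  "tangent_space vel S s = {v. \<exists>\<gamma>. (\<forall>t. \<gamma> t \<in> S) \<and> \<gamma> 0 = s \<and> vel \<gamma> v}"

definition differential ::
  "((real \<Rightarrow> 's) \<Rightarrow> 'v \<Rightarrow> bool) \<Rightarrow> 's set \<Rightarrow> ((real \<Rightarrow> 'r) \<Rightarrow> 'w \<Rightarrow> bool) \<Rightarrow> ('s \<Rightarrow> 'r) \<Rightarrow> 's \<Rightarrow> 'v \<Rightarrow> 'w" where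
  "differential vel S vel' f s v =
     (THE w. \<exists>\<gamma>. (\<forall>t. \<gamma> t \<in> S) \<and> \<gamma> 0 = s \<and> vel \<gamma> v \<and> vel' (f \<circ> \<gamma>) w)"

text \<open>\<open>f : (S, J) \<rightarrow> (R, J')\<close> is holomorphic.\<close>

definition holomorphic_map ::
  "((real \<Rightarrow> 's) \<Rightarrow> 'v::real_vector \<Rightarrow> bool) \<Rightarrow> 's set \<Rightarrow> ('s \<Rightarrow> 'v \<Rightarrow> 'v) \<Rightarrow>
   ((real \<Rightarrow> 'r) \<Rightarrow> 'w::real_vector \<Rightarrow> bool) \<Rightarrow> 'r set \<Rightarrow> ('r \<Rightarrow> 'w \<Rightarrow> 'w) \<Rightarrow> ('s \<Rightarrow> 'r) \<Rightarrow> bool" where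
  "holomorphic_map vel S J vel' R J' f \<longleftrightarrow>
     (\<forall>s\<in>S. f s \<in> R \<and>
        cmap (differential vel S vel' f s) ` eig_minus_i (tangent_space vel S s) (J s)
          \<subseteq> eig_minus_i (tangent_space vel' R (f s)) (J' (f s)))"

abbreviation bundle_tangent ::
  "('x::t2_space, 'm::finite, 'y, 'n::finite) obundle \<Rightarrow> ('x, 'n) bpoint \<Rightarrow> ('m, 'n) btangent set" where
  "bundle_tangent E \<equiv> tangent_space (bundle_velocity E) (isotropic_bundle E)"

subsection \<open>Vertical and horizontal spaces\<close>

definition vertical ::
  "('x::t2_space, 'm::finite, 'y, 'n::finite) obundle \<Rightarrow> ('x, 'n) bpoint \<Rightarrow> ('m, 'n) btangent set" where
  "vertical E s = {v \<in> bundle_tangent E s. fst v = 0}"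

text \<open>The tangent space at \<open>u\<close> of the complex Grassmannian of \<open>W\<^sup>\<complex>\<close> is \<open>Hom(u, W\<^sup>\<complex>/u)\<close>: the
  velocity of a curve of subspaces \<open>u(t)\<close> with \<open>u(0) = u\<close> sends \<open>z\<close> to the class of \<open>\<zeta>'(0)\<close>, where
  \<open>\<zeta>(t) \<in> u(t)\<close> and \<open>\<zeta>(0) = z\<close>. In the following definition \<open>w\<close> represents the value at \<open>z\<close> of
  the homomorphism corresponding to the vertical vector \<open>a\<close>.\<close>

definition grassmann_hom ::
  "('x::t2_space, 'm::finite, 'y, 'n::finite) obundle \<Rightarrow> ('x, 'n) bpoint \<Rightarrow>
   ('m, 'n) btangent \<Rightarrow> (real^'n) cx \<Rightarrow> (real^'n) cx \<Rightarrow> bool" where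
  "grassmann_hom E s a z w \<longleftrightarrow>
     (\<exists>\<gamma> \<zeta>. (\<forall>t. \<gamma> t \<in> isotropic_bundle E \<and> fst (\<gamma> t) = fst s) \<and> \<gamma> 0 = s \<and>
        bundle_velocity E \<gamma> a \<and>
        (\<forall>t. \<zeta> t \<in> snd (\<gamma> t)) \<and> \<zeta> 0 = z \<and> (\<zeta> has_vector_derivative w) (at 0))"

text \<open>The complex structure of the fibres as complex submanifolds of Grassmannians.\<close>

definition fibre_acs ::
  "('x::t2_space, 'm::finite, 'y, 'n::finite) obundle \<Rightarrow> ('x, 'n) bpoint \<Rightarrow>
   ('m, 'n) btangent \<Rightarrow> ('m, 'n) btangent" where
  "fibre_acs E s a = (THE b. b \<in> vertical E s \<and>
     (\<forall>z\<in>snd s. \<forall>w. grassmann_hom E s a z w \<longrightarrow> grassmann_hom E s b z (cI w)))"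

definition vertical10 ::
  "('x::t2_space, 'm::finite, 'y, 'n::finite) obundle \<Rightarrow> ('x, 'n) bpoint \<Rightarrow> ('m, 'n) btangent cx set" where
  "vertical10 E s = eig_plus_i (vertical E s) (fibre_acs E s)"

definition vertical01 ::
  "('x::t2_space, 'm::finite, 'y, 'n::finite) obundle \<Rightarrow> ('x, 'n) bpoint \<Rightarrow> ('m, 'n) btangent cx set" where
  "vertical01 E s = eig_minus_i (vertical E s) (fibre_acs E s)"

text \<open>The connection induced by \<open>\<Pi> \<circ> D\<close>: the velocity \<open>(X, P)\<close> of a curve of complex structures
  \<open>K\<close> is horizontal iff \<open>K\<close> is parallel in \<open>End W\<close>, that is,
  \<open>\<Pi> (D\<^sub>X (K Z)) - K (\<Pi> (D\<^sub>X Z)) = \<Pi> ((P + \<Gamma>\<^sub>X K - K \<Gamma>\<^sub>X) Z) = 0\<close> for sections \<open>Z\<close> of \<open>W\<close>.\<close>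

definition horizontal ::
  "('x::t2_space, 'm::finite, 'y, 'n::finite) obundle \<Rightarrow> ('x, 'n) bpoint \<Rightarrow> ('m, 'n) btangent set" where
  "horizontal E s = {v \<in> bundle_tangent E s.
     let x = fst s;
         G = matrix (christoffel (bambient E) (bconn E) (bfoot E x)
                       (mfd_deriv (bbase E) (bambient E) (bfoot E) x (fst v)));
         K = acs_matrix E s
     in \<forall>w\<in>fibre E x. proj E x ((snd v + G ** K - K ** G) *v w) = 0}"

text \<open>Horizontal lift of a complex subspace of the complexified tangent space of the base.\<close>

definition horizontal_lift ::
  "('x::t2_space, 'm::finite, 'y, 'n::finite) obundle \<Rightarrow> ('x, 'n) bpoint \<Rightarrow> 'm csubspace \<Rightarrow>
   ('m, 'n) btangent cx set" where
  "horizontal_lift E s U = {z \<in> horizontal E s \<times> horizontal E s. cmap fst z \<in> U}"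

section \<open>Almost twistorial structures and twistorial maps\<close>

text \<open>\<open>J_nonint\<close> is \<open>\<J>'\<close> on the bundle of a Weyl space, \<open>J_base p\<close> is the almost Hermitian structure
  \<open>J\<^sup>p\<close> on the base, and \<open>J_section E p\<close> is \<open>\<J>\<^sup>p\<close> on the bundle of \<open>E\<close>.\<close>

definition J_nonint ::
  "('x::t2_space, 'm::{finite,linorder}) atlas \<Rightarrow> ('x, 'm) metric set \<Rightarrow> ('x, 'm) covd \<Rightarrow>
   ('x, 'm) bpoint \<Rightarrow> ('m, 'm) btangent \<Rightarrow> ('m, 'm) btangent" where
  "J_nonint A c D s =
     (let E = tangent_obundle A c D in
        acs_minus (bundle_tangent E s) (ssum (horizontal_lift E s (snd s)) (vertical10 E s)))"

definition J_base :: "('x \<Rightarrow> 'm csubspace) \<Rightarrow> 'x \<Rightarrow> real^'m::finite \<Rightarrow> real^'m" where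
  "J_base p x = acs_minus UNIV (p x)"

definition J_section ::
  "('x::t2_space, 'm::finite, 'y, 'n::finite) obundle \<Rightarrow> ('x \<Rightarrow> 'm csubspace) \<Rightarrow>
   ('x, 'n) bpoint \<Rightarrow> ('m, 'n) btangent \<Rightarrow> ('m, 'n) btangent" where
  "J_section E p s =
     acs_plus (bundle_tangent E s)
       (ssum (horizontal_lift E s (cconj ` p (fst s))) (vertical01 E s))"

definition section_image :: "('x \<Rightarrow> 'u) \<Rightarrow> ('x \<times> 'u) set" where
  "section_image p = range (\<lambda>x. (x, p x))"

definition twistorial ::
  "('x::t2_space, 'm::{finite,linorder}) atlas \<Rightarrow> ('x, 'm) metric set \<Rightarrow> ('x, 'm) covd \<Rightarrow>
   ('y::t2_space, 'n::{finite,linorder}) atlas \<Rightarrow> ('y, 'n) metric set \<Rightarrow> ('y, 'n) covd \<Rightarrow>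
   ('x \<Rightarrow> 'y) \<Rightarrow> ('x \<Rightarrow> 'm csubspace) \<Rightarrow>
   (('x, 'm) bpoint \<Rightarrow> ('y, 'n) bpoint) \<Rightarrow> bool" where
  "twistorial A cM DM B cN DN \<phi> p \<Phi> \<longleftrightarrow>
     (let EM = tangent_obundle A cM DM; EN = tangent_obundle B cN DN; S = section_image p in
        (\<forall>s\<in>S. fst (\<Phi> s) = \<phi> (fst s)) \<and>
        (\<forall>s\<in>S. J_nonint A cM DM s ` tangent_space (bundle_velocity EM) S s
                  \<subseteq> tangent_space (bundle_velocity EM) S s) \<and>
        holomorphic_map (bundle_velocity EM) S (J_nonint A cM DM)
          (bundle_velocity EN) (isotropic_bundle EN) (J_nonint B cN DN) \<Phi>)"

definition one_one_geodesic ::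
  "('x, 'm::finite) atlas \<Rightarrow> ('x, 'm) covd \<Rightarrow> ('y, 'n::finite) atlas \<Rightarrow> ('y, 'n) covd \<Rightarrow>
   ('x \<Rightarrow> 'y) \<Rightarrow> ('x \<Rightarrow> 'm csubspace) \<Rightarrow> bool" where
  "one_one_geodesic A DM B DN \<phi> p \<longleftrightarrow>
     (\<forall>x. \<forall>X\<in>p x. \<forall>Y\<in>p x. cbil (second_fundamental_form A DM B DN \<phi> x) (cconj X) Y = 0)"

definition isotropic_along ::
  "('x, 'm::finite) atlas \<Rightarrow> ('y, 'n::finite) atlas \<Rightarrow> ('y, 'n) metric set \<Rightarrow>
   ('x \<Rightarrow> 'y) \<Rightarrow> ('x \<Rightarrow> 'm csubspace) \<Rightarrow> bool" where
  "isotropic_along A B c \<phi> p \<longleftrightarrow> (\<forall>g\<in>c. \<forall>x. \<forall>z\<in>p x. \<forall>w\<in>p x.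
     cbil (g (\<phi> x)) (cmap (mfd_deriv A B \<phi> x) z) (cmap (mfd_deriv A B \<phi> x) w) = 0)"

end

(* The position of an almost complex structure on one of the bundles is described by the matrix K of
   the corresponding complex structure on the fibre, extended by 0. In charts, the pairs (X, P) tangent
   to the bundle are those for which P differs from a horizontal part, linear in X, by a matrix which
   is skew and anticommutes with K; this uses the polar decomposition to produce curves. All
   the almost complex structures are then given by an explicit formula, and a section is holomorphic
   iff its covariant derivative A satisfies A(J X) = - K A(X).

   Let J, K and V denote p, p + q as complex structures and the covariant derivative of K along
   the immersion, whose differential is L and whose second fundamental form is b. Differentiating
   K L = L J gives V(X) L = b(X, J .) - K b(X, .) + L A(X), and the normal component of V is the
   covariant derivative of q. Being twistorial amounts to V(J X) = - K V(X), once p is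
   holomorphic. For C(X, Y) = b(X, Y) + b(J X, J Y) this yields C(X, Y) = - K C(X, J Y), and the
   symmetry of b forces C = 0. Conversely, if C = 0 and q is holomorphic, then V(J X) + K V(X) is
   skew, kills the tangent space and has no normal component, so it vanishes. *)

theory Submission
  imports Defs
begin

section \<open>Matrix calculus and complex structures of a moving Euclidean space\<close>

text \<open>The obstacle is that tangent vectors of the bundles are velocities of actual curves in
  them. Each claim that a vector is tangent therefore calls for a curve of positively oriented
  orthogonal complex structures over a moving base point, while the metric and the projection onto
  the fibre vary too. A straight segment leaves this set; the orthogonal factor of the polar
  decomposition returns to it, and keeps the velocity because the correcting square root is
  stationary to first order. The tangent bundles of \<open>M\<close> and \<open>N\<close> and the
  normal bundle are instances of one locale, so this is done once. Differentiability of the normal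
  projection is read off from \<open>q\<close>. The sign in A(J X) = - K A(X) has its origin in the
  vertical (1,0) vectors lying in the \<open>-i\<close>-eigenbundle: the fibres enter with the
  opposite of their complex structure. For the same reason C becomes complex linear in one argument
  and antilinear in the other, which a symmetric map can satisfy only by vanishing.\<close>

lemma matrix_add_rdistrib: "(A + A') ** B = A ** B + A' ** (B :: real^'b^'c)"
  by (vector matrix_matrix_mult_def sum.distrib [symmetric] field_simps)

lemma scaleR_matrix_assoc: "(r *\<^sub>R A) ** B = r *\<^sub>R (A ** (B :: real^'b^'c))"
  and matrix_scaleR_assoc: "A ** (r *\<^sub>R B) = r *\<^sub>R (A ** (B :: real^'b^'c))"
  by (simp_all add: matrix_matrix_mult_def vec_eq_iff sum_distrib_left mult_ac)

lemma bounded_bilinear_matrix_mult: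
  "bounded_bilinear ((**) :: real^'b^'a \<Rightarrow> real^'c^'b \<Rightarrow> real^'c^'a)"
  unfolding bilinear_conv_bounded_bilinear [symmetric] bilinear_def
  by (auto intro!: linearI simp: matrix_add_ldistrib matrix_add_rdistrib scaleR_matrix_assoc matrix_scaleR_assoc)

lemma bounded_bilinear_matrix_vector_mult:
  "bounded_bilinear ((*v) :: real^'b^'a \<Rightarrow> real^'b \<Rightarrow> real^'a)"
  unfolding bilinear_conv_bounded_bilinear [symmetric] bilinear_def
  by (auto intro!: linearI simp: matrix_vector_mult_add_rdistrib matrix_vector_right_distrib
      matrix_vector_mult_scaleR scaleR_matrix_vector_assoc)

lemma bounded_linear_transpose: "bounded_linear (transpose :: real^'b^'a \<Rightarrow> real^'a^'b)"
  unfolding linear_conv_bounded_linear [symmetric]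
  by (auto intro!: linearI simp: transpose_def vec_eq_iff)

lemmas matrix_mult_has_vector_derivative =
  bounded_bilinear.has_vector_derivative [OF bounded_bilinear_matrix_mult]
lemmas matrix_mult_has_derivative =
  bounded_bilinear.FDERIV [OF bounded_bilinear_matrix_mult]
lemmas tendsto_matrix_mult [tendsto_intros] =
  bounded_bilinear.tendsto [OF bounded_bilinear_matrix_mult]
lemmas tendsto_matrix_vector_mult [tendsto_intros] =
  bounded_bilinear.tendsto [OF bounded_bilinear_matrix_vector_mult]
lemmas tendsto_transpose [tendsto_intros] =
  bounded_linear.tendsto [OF bounded_linear_transpose]

lemma tendsto_det [tendsto_intros]:
  fixes M :: "'z \<Rightarrow> real^'n^'n"
  assumes "(M \<longlongrightarrow> L) F"
  shows "((\<lambda>t. det (M t)) \<longlongrightarrow> det L) F"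
  unfolding det_def by (intro tendsto_intros assms)

lemma matrix_neg_lmult: "(- A) ** B = - (A ** (B :: real^'b^'c))"
  and matrix_neg_rmult: "A ** (- B) = - (A ** (B :: real^'b^'c))"
  and matrix_diff_lmult: "(A - A') ** B = A ** B - A' ** (B :: real^'b^'c)"
  and matrix_diff_rmult: "A ** (B - B') = A ** B - A ** (B' :: real^'b^'c)"
  by (simp_all add: bounded_bilinear.minus_left [OF bounded_bilinear_matrix_mult]
      bounded_bilinear.minus_right [OF bounded_bilinear_matrix_mult]
      bounded_bilinear.diff_left [OF bounded_bilinear_matrix_mult]
      bounded_bilinear.diff_right [OF bounded_bilinear_matrix_mult])

lemma matrix_neg_vmult: "(- A) *v v = - (A *v (v :: real^'c))"
  by (rule bounded_bilinear.minus_left [OF bounded_bilinear_matrix_vector_mult])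

lemmas matrix_ring_simps = matrix_neg_lmult matrix_neg_rmult matrix_diff_lmult matrix_diff_rmult
  matrix_add_ldistrib matrix_add_rdistrib scaleR_matrix_assoc matrix_scaleR_assoc

lemma transpose_add: "transpose (A + B) = transpose A + transpose (B :: real^'b^'c)"
  and transpose_diff: "transpose (A - B) = transpose A - transpose (B :: real^'b^'c)"
  and transpose_minus: "transpose (- B) = - transpose (B :: real^'b^'c)"
  and transpose_scale: "transpose (r *\<^sub>R B) = r *\<^sub>R transpose (B :: real^'b^'c)"
  by (auto simp: transpose_def vec_eq_iff)

lemmas transpose_simps = transpose_add transpose_diff transpose_minus transpose_scale
  matrix_transpose_mul transpose_mat

section \<open>Inverses, quotients and square roots of matrix functions\<close>

lemma matrix_inv:
  assumes "invertible (A :: real^'n^'n)"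
  shows "A ** matrix_inv A = mat 1" "matrix_inv A ** A = mat 1"
  using someI_ex [OF assms [unfolded invertible_def]] by (simp_all add: matrix_inv_def)

lemma eventually_invertible:
  fixes M :: "'z \<Rightarrow> real^'n^'n"
  assumes "(M \<longlongrightarrow> L) F" "invertible L"
  shows "\<forall>\<^sub>F t in F. invertible (M t)"
  using tendsto_imp_eventually_ne [OF tendsto_det [OF assms(1)]] assms(2)
  by (simp add: invertible_det_nz)

text \<open>Boundedness of \<open>k\<close> is part of the claim. Writing
  \<open>k = N - k ** (M - mat 1)\<close> and pushing the norm of \<open>M - mat 1\<close> below
  \<open>1 / (2 * C)\<close>, with \<open>C\<close> the constant of the matrix product, bounds
  \<open>k\<close> by twice \<open>N\<close>; the last term then tends to 0.\<close>

lemma tendsto_right_divide_mat_1: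
  fixes M :: "'z \<Rightarrow> real^'n^'n"
  assumes M: "(M \<longlongrightarrow> mat 1) F" and N: "(N \<longlongrightarrow> N0) F" and k: "\<forall>\<^sub>F z in F. k z ** M z = N z"
  shows "(k \<longlongrightarrow> (N0 :: real^'n^'k)) F"
proof -
  obtain C where C: "C > 0" "\<And>(a :: real^'n^'k) (b :: real^'n^'n). norm (a ** b) \<le> norm a * norm b * C"
    using bounded_bilinear.pos_bounded [OF bounded_bilinear_matrix_mult] by blast
  have M0: "((\<lambda>z. M z - mat 1) \<longlongrightarrow> 0) F"
    using tendsto_diff [OF M tendsto_const [of "mat 1"]] by simp
  have kz: "\<forall>\<^sub>F z in F. k z = N z - k z ** (M z - mat 1)"
    using k by eventually_elim (simp add: matrix_ring_simps)
  have small: "\<forall>\<^sub>F z in F. norm (M z - mat 1) < 1 / (2 * C)"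
    using tendstoD [OF M0, of "1 / (2 * C)"] C by (simp add: dist_norm)
  have Nb: "\<forall>\<^sub>F z in F. norm (N z) < norm N0 + 1"
    using tendsto_norm [OF N] by (rule order_tendstoD) simp
  have "\<forall>\<^sub>F z in F. norm (k z) \<le> 2 * (norm N0 + 1)"
    using kz small Nb
  proof eventually_elim
    case (elim z)
    have *: "norm (k z) \<le> norm (N z) + norm (k z ** (M z - mat 1))"
      by (subst elim(1)) (rule norm_triangle_ineq4)
    have "norm (k z ** (M z - mat 1)) \<le> norm (k z) * norm (M z - mat 1) * C"
      by (rule C)
    also have "\<dots> \<le> norm (k z) * (1 / (2 * C)) * C"
      using elim C by (intro mult_right_mono mult_left_mono) auto
    also have "\<dots> = norm (k z) / 2" using C by simp
    finally have "norm (k z) \<le> norm (N z) + norm (k z) / 2" using * by (rule order_trans [OF _ add_left_mono, rotated])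
    then have "norm (k z) \<le> 2 * norm (N z)" by simp
    also have "\<dots> \<le> 2 * (norm N0 + 1)" using elim(3) by simp
    finally show ?case .
  qed
  then have bd: "Bfun k F"
    by (rule BfunI)
  have "((\<lambda>z. k z ** (M z - mat 1)) \<longlongrightarrow> 0) F"
    using bounded_bilinear.Bfun_prod_Zfun [OF bounded_bilinear_matrix_mult bd] M0
    by (simp add: tendsto_Zfun_iff)
  then have "((\<lambda>z. N z - k z ** (M z - mat 1)) \<longlongrightarrow> N0 - 0) F"
    by (intro tendsto_diff N)
  then show ?thesis
    using kz by (simp add: tendsto_cong [OF kz])
qed

text \<open>A quotient rule that never forms an inverse. In \<open>k = N - k ** (M - mat 1)\<close>
  the product is differentiable at \<open>x\<close> although \<open>k\<close> is so far only known
  to be continuous there, because the second factor vanishes at \<open>x\<close>.\<close>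

lemma has_derivative_right_divide_mat_1:
  fixes M :: "'z::real_normed_vector \<Rightarrow> real^'n^'n" and k :: "'z \<Rightarrow> real^'n^'k"
  assumes M: "(M has_derivative M') (at x)" "M x = mat 1" and N: "(N has_derivative N') (at x)"
    and k: "\<forall>\<^sub>F z in nhds x. k z ** M z = N z"
  shows "(k has_derivative (\<lambda>h. N' h - k x ** M' h)) (at x)"
proof -
  have kx: "k x = N x"
    using eventually_nhds_x_imp_x [OF k] M(2) by simp
  have Mc: "(M \<longlongrightarrow> mat 1) (at x)"
    using has_derivative_continuous [OF M(1)] M(2) by (simp add: continuous_within)
  have Nc: "(N \<longlongrightarrow> N x) (at x)"
    using has_derivative_continuous [OF N] by (simp add: continuous_within)
  have k': "\<forall>\<^sub>F z in at x. k z ** M z = N z"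
    using k by (simp add: eventually_nhds_conv_at)
  have kc: "(k \<longlongrightarrow> k x) (at x)"
    using tendsto_right_divide_mat_1 [OF Mc Nc k'] kx by simp
  \<comment> \<open>The relative error of the linear approximation of \<open>M\<close> at
    \<open>x\<close>. The difference quotient of the product splits into \<open>k\<close> times this
    error and the increment of \<open>k\<close> times a bounded quotient.\<close>
  let ?e = "\<lambda>z. (M z - mat 1 - M' (z - x)) /\<^sub>R norm (z - x)"
  have e: "(?e \<longlongrightarrow> 0) (at x)"
    using M unfolding has_derivative_within by (simp add: inverse_eq_divide diff_diff_eq)
  have bl: "bounded_linear M'" using M(1) by (rule has_derivative_bounded_linear)
  then obtain c where c: "\<And>h. norm (M' h) \<le> norm h * c"
    using bounded_linear.bounded by blast
  have bd: "Bfun (\<lambda>z. M' (z - x) /\<^sub>R norm (z - x)) (at x)"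
  proof (rule BfunI)
    show "\<forall>\<^sub>F z in at x. norm (M' (z - x) /\<^sub>R norm (z - x)) \<le> c"
      unfolding eventually_at_filter
    proof (rule always_eventually, intro allI impI)
      fix z assume "z \<noteq> x"
      then show "norm (M' (z - x) /\<^sub>R norm (z - x)) \<le> c"
        using c [of "z - x"] by (simp add: field_simps)
    qed
  qed
  have z1: "((\<lambda>z. k z ** ?e z) \<longlongrightarrow> k x ** 0) (at x)"
    by (intro tendsto_intros kc e)
  have z2: "((\<lambda>z. (k z - k x) ** (M' (z - x) /\<^sub>R norm (z - x))) \<longlongrightarrow> 0) (at x)"
  proof -
    have "((\<lambda>z. k z - k x) \<longlongrightarrow> 0) (at x)"
      using kc by (simp add: LIM_zero)
    then show ?thesis
      using bounded_bilinear.Zfun_prod_Bfun [OF bounded_bilinear_matrix_mult _ bd]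
      by (simp add: tendsto_Zfun_iff)
  qed
  have "((\<lambda>z. k z ** ?e z + (k z - k x) ** (M' (z - x) /\<^sub>R norm (z - x))) \<longlongrightarrow> 0) (at x)"
    using tendsto_add [OF z1 z2] by simp
  then have "((\<lambda>z. (k z ** (M z - mat 1) - k x ** (M x - mat 1) - k x ** M' (z - x)) /\<^sub>R norm (z - x)) \<longlongrightarrow> 0) (at x)"
    by (simp add: M(2) matrix_ring_simps algebra_simps)
  then have d: "((\<lambda>z. k z ** (M z - mat 1)) has_derivative (\<lambda>h. k x ** M' h)) (at x)"
    unfolding has_derivative_within
    by (intro conjI bounded_linear_compose [OF bounded_bilinear.bounded_linear_right [OF bounded_bilinear_matrix_mult] bl])
      (simp add: inverse_eq_divide diff_diff_eq)
  have "((\<lambda>z. N z - k z ** (M z - mat 1)) has_derivative (\<lambda>h. N' h - k x ** M' h)) (at x)"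
    by (intro has_derivative_diff N d)
  moreover have "\<forall>\<^sub>F z in at x. N z - k z ** (M z - mat 1) = k z"
    using k' by eventually_elim (simp add: matrix_ring_simps)
  ultimately show ?thesis
    by (rule has_derivative_transform_eventually) (simp_all add: kx M(2))
qed

text \<open>Multiplying \<open>k ** M = N\<close> on the right by \<open>R\<close> normalises the
  divisor to \<open>mat 1\<close> at \<open>x\<close>.\<close>

lemma has_derivative_right_divide:
  fixes M :: "'z::real_normed_vector \<Rightarrow> real^'n^'n" and k :: "'z \<Rightarrow> real^'n^'k"
  assumes M: "(M has_derivative M') (at x)" "M x ** R = mat 1" and N: "(N has_derivative N') (at x)"
    and k: "\<forall>\<^sub>F z in nhds x. k z ** M z = N z"
  shows "(k has_derivative (\<lambda>h. (N' h - k x ** M' h) ** R)) (at x)"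
proof -
  note bl = bounded_bilinear.bounded_linear_left [OF bounded_bilinear_matrix_mult]
  have "((\<lambda>z. M z ** R) has_derivative (\<lambda>h. M' h ** R)) (at x)"
    "((\<lambda>z. N z ** R) has_derivative (\<lambda>h. N' h ** R)) (at x)"
    using bounded_linear.has_derivative [OF bl M(1)] bounded_linear.has_derivative [OF bl N] by auto
  moreover have "\<forall>\<^sub>F z in nhds x. k z ** (M z ** R) = N z ** R"
    using k by eventually_elim (simp add: matrix_mul_assoc)
  ultimately have "(k has_derivative (\<lambda>h. N' h ** R - k x ** (M' h ** R))) (at x)"
    using has_derivative_right_divide_mat_1 [of "\<lambda>z. M z ** R"] M(2) by blast
  then show ?thesis
    by (simp add: matrix_ring_simps matrix_mul_assoc)
qed

lemma has_vector_derivative_right_divide: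
  fixes M :: "real \<Rightarrow> real^'n^'n" and k :: "real \<Rightarrow> real^'n^'k"
  assumes "(M has_vector_derivative M') (at x)" "M x ** R = mat 1" "(N has_vector_derivative N') (at x)"
    and "\<forall>\<^sub>F z in nhds x. k z ** M z = N z"
  shows "(k has_vector_derivative (N' - k x ** M') ** R) (at x)"
  using has_derivative_right_divide [OF assms(1)[unfolded has_vector_derivative_def] assms(2)
      assms(3)[unfolded has_vector_derivative_def] assms(4)]
  unfolding has_vector_derivative_def
  by (simp add: matrix_ring_simps scaleR_diff_right)

text \<open>Inverse function theorem for squaring at \<open>mat 1\<close>, where the derivative is
  \<open>2 h\<close>. The root is one of arbitrary matrices, so symmetry and commutation properties
  of \<open>r B\<close> have to be recovered from those of \<open>B\<close>.\<close>

lemma matrix_square_root: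
  obtains r :: "real^'n^'n \<Rightarrow> real^'n^'n" where "r (mat 1) = mat 1"
    "(r has_derivative (\<lambda>h. (1/2) *\<^sub>R h)) (at (mat 1))"
    "\<forall>\<^sub>F B in nhds (mat 1). r B ** r B = B"
proof -
  let ?f = "\<lambda>X :: real^'n^'n. X ** X"
  define d where "d X = Blinfun (\<lambda>h. X ** h + h ** X)" for X :: "real^'n^'n"
  have bl: "bounded_linear (\<lambda>h :: real^'n^'n. X ** h + h ** X)" for X
    by (intro bounded_linear_add
        bounded_bilinear.bounded_linear_left [OF bounded_bilinear_matrix_mult]
        bounded_bilinear.bounded_linear_right [OF bounded_bilinear_matrix_mult])
  have app: "blinfun_apply (d X) = (\<lambda>h. X ** h + h ** X)" for X
    unfolding d_def using bl by (rule bounded_linear_Blinfun_apply)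
  have lin: "linear d"
    by (rule linearI; rule blinfun_eqI; simp only: app blinfun.add_left blinfun.scaleR_left)
      (simp_all add: matrix_ring_simps scaleR_add_right)
  have cont: "continuous_on UNIV d"
    using lin by (intro linear_continuous_on) (simp add: linear_conv_bounded_linear)
  have der: "(?f has_derivative blinfun_apply (d X)) (at X)" for X
    unfolding app using matrix_mult_has_derivative [OF has_derivative_ident has_derivative_ident, of X] by simp
  have inv: "((1/2) *\<^sub>R id_blinfun) o\<^sub>L d (mat 1) = id_blinfun"
    by (rule blinfun_eqI, simp only: blinfun_apply_blinfun_compose blinfun.scaleR_left app)
      (simp only: matrix_mul_lid matrix_mul_rid scaleR_half_double blinfun_apply_id_blinfun id_apply)
  show thesis
  proof (rule inverse_function_theorem [OF open_UNIV der cont UNIV_I inv])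
  fix U V g g'
  assume *: "open U" "mat 1 \<in> U" "open V" "mat 1 ** (mat 1 :: real^'n^'n) \<in> V" "homeomorphism U V ?f g"
    and g': "\<And>y. y \<in> V \<Longrightarrow> (g has_derivative (g' y)) (at y)"
    "\<And>y. y \<in> V \<Longrightarrow> g' y = inv (blinfun_apply (d (g y)))"
  have gI: "g (mat 1) = mat 1"
    using homeomorphism_apply1 [OF *(5) *(2)] by simp
  have "mat 1 \<in> V" using *(4) by simp
  then have "g' (mat 1) = inv (blinfun_apply (d (mat 1)))"
    using g'(2) [OF \<open>mat 1 \<in> V\<close>] by (simp only: gI)
  also have "\<dots> = inv (\<lambda>h. 2 *\<^sub>R h)"
    unfolding app by (simp only: matrix_mul_lid matrix_mul_rid scaleR_2)
  also have "\<dots> = (\<lambda>h. (1/2) *\<^sub>R h)"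
    by (rule inv_equality) (simp_all only: scaleR_scaleR, simp_all)
  finally have dg: "(g has_derivative (\<lambda>h. (1/2) *\<^sub>R h)) (at (mat 1))"
    using g'(1) [OF \<open>mat 1 \<in> V\<close>] by (simp only:)
  have "\<forall>\<^sub>F B in nhds (mat 1). B \<in> V"
    using *(3,4) by (intro eventually_nhds_in_open) auto
  then have "\<forall>\<^sub>F B in nhds (mat 1). g B ** g B = B"
  proof eventually_elim
    case (elim B)
    then show ?case
      by (rule homeomorphism_apply2 [OF *(5)])
  qed
  then show thesis
    by (rule that [OF gI dg])
  qed
qed

section \<open>Orthogonal complex structures of a moving Euclidean space\<close>

definition skew_adjoint :: "real^'n^'n \<Rightarrow> real^'n^'n \<Rightarrow> bool" where
  "skew_adjoint G A \<longleftrightarrow> transpose A ** G = - (G ** A)"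

definition self_adjoint :: "real^'n^'n \<Rightarrow> real^'n^'n \<Rightarrow> bool" where
  "self_adjoint G A \<longleftrightarrow> transpose A ** G = G ** A"

text \<open>\<open>K\<close> is an orthogonal complex structure on the image of the \<open>G\<close>-orthogonal projection \<open>\<pi>\<close>,
  extended by \<open>0\<close>.\<close>

definition orth_acs :: "real^'n^'n \<Rightarrow> real^'n^'n \<Rightarrow> real^'n^'n \<Rightarrow> bool" where
  "orth_acs G \<pi> K \<longleftrightarrow> K ** \<pi> = K \<and> \<pi> ** K = K \<and> K ** K = - \<pi> \<and> skew_adjoint G K"

text \<open>The linearisation of the four equations of \<open>orth_acs\<close>, when the metric, the
  projection and \<open>K\<close> move with the velocities \<open>G'\<close>, \<open>\<pi>'\<close>
  and \<open>P\<close>.\<close>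

definition orth_acs_deriv ::
  "real^'n^'n \<Rightarrow> real^'n^'n \<Rightarrow> real^'n^'n \<Rightarrow> real^'n^'n \<Rightarrow> real^'n^'n \<Rightarrow> real^'n^'n \<Rightarrow> bool" where
  "orth_acs_deriv G G' \<pi> \<pi>' K P \<longleftrightarrow>
     K ** \<pi>' + P ** \<pi> = P \<and> \<pi> ** P + \<pi>' ** K = P \<and> K ** P + P ** K = - \<pi>' \<and>
     transpose K ** G' + transpose P ** G = - (G ** P + G' ** K)"

lemma orth_acs_curve_deriv:
  assumes G: "(G has_vector_derivative G') (at 0)" and \<pi>: "(\<pi> has_vector_derivative \<pi>') (at 0)"
    and k: "(k has_vector_derivative P) (at (0::real))"
    and ev: "\<forall>\<^sub>F t in nhds 0. orth_acs (G t) (\<pi> t) (k t)"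
  shows "orth_acs_deriv (G 0) G' (\<pi> 0) \<pi>' (k 0) P"
proof -
  have eqD: "X' = Y'" if "(X has_vector_derivative X') (at 0)" "(Y has_vector_derivative Y') (at 0)"
    "\<forall>\<^sub>F t in nhds 0. X t = Y t" for X Y :: "real \<Rightarrow> real^'n^'n" and X' Y'
  proof -
    have "X 0 = Y 0" using eventually_nhds_x_imp_x [OF that(3)] .
    moreover have "\<forall>\<^sub>F t in at 0. X t = Y t" using that(3) by (simp add: eventually_nhds_conv_at)
    ultimately have "(Y has_vector_derivative X') (at 0)"
      using has_derivative_transform_eventually [OF that(1)[unfolded has_vector_derivative_def]]
      unfolding has_vector_derivative_def by blast
    then show ?thesis using that(2) vector_derivative_at by metis
  qed
  note mm = matrix_mult_has_vector_derivative
  note tr = bounded_linear.has_vector_derivative [OF bounded_linear_transpose]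
  note ev = ev [unfolded orth_acs_def skew_adjoint_def]
  show ?thesis
    unfolding orth_acs_deriv_def
    using eqD [OF mm [OF k \<pi>] k] eqD [OF mm [OF \<pi> k] k]
      eqD [OF mm [OF k k] has_vector_derivative_minus [OF \<pi>]]
      eqD [OF mm [OF tr [OF k] G] has_vector_derivative_minus [OF mm [OF G k]]]
      eventually_mono [OF ev] by simp
qed

text \<open>At \<open>\<sigma> = \<tau> = mat 1\<close> the operator is \<open>2 X\<close>, and a
  small perturbation keeps it injective. Applied to commutators with a square root near
  \<open>mat 1\<close>, this lets properties of the square pass to the root.\<close>

lemma eventually_sylvester_injective:
  fixes \<sigma> \<tau> :: "'z \<Rightarrow> real^'n^'n"
  assumes "(\<sigma> \<longlongrightarrow> mat 1) F" "(\<tau> \<longlongrightarrow> mat 1) F"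
  shows "\<forall>\<^sub>F t in F. \<forall>X. X ** \<sigma> t + \<tau> t ** X = 0 \<longrightarrow> X = 0"
proof -
  obtain C where C: "C > 0" "\<And>(a :: real^'n^'n) (b :: real^'n^'n). norm (a ** b) \<le> norm a * norm b * C"
    using bounded_bilinear.pos_bounded [OF bounded_bilinear_matrix_mult] by blast
  have "\<forall>\<^sub>F t in F. dist (\<sigma> t) (mat 1) < 1 / (2 * C)" "\<forall>\<^sub>F t in F. dist (\<tau> t) (mat 1) < 1 / (2 * C)"
    using C by (intro tendstoD assms; simp)+
  then show ?thesis
  proof eventually_elim
    case (elim t)
    show ?case
    proof (intro allI impI, rule ccontr)
      fix X assume X: "X ** \<sigma> t + \<tau> t ** X = 0" and "X \<noteq> 0"
      then have pos: "norm X > 0" by simp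
      have "2 *\<^sub>R X = - (X ** (\<sigma> t - mat 1)) - (\<tau> t - mat 1) ** X"
        unfolding scaleR_2 matrix_diff_lmult matrix_diff_rmult matrix_mul_lid matrix_mul_rid
        using X by (simp add: eq_neg_iff_add_eq_0 algebra_simps)
      then have "2 * norm X = norm (- (X ** (\<sigma> t - mat 1)) - (\<tau> t - mat 1) ** X)"
        by (metis norm_scaleR abs_numeral)
      also have "\<dots> \<le> norm (X ** (\<sigma> t - mat 1)) + norm ((\<tau> t - mat 1) ** X)"
        by (metis norm_triangle_ineq4 norm_minus_cancel)
      also have "\<dots> \<le> norm X * norm (\<sigma> t - mat 1) * C + norm (\<tau> t - mat 1) * norm X * C"
        by (intro add_mono C(2))
      also have "\<dots> < norm X * (1 / (2 * C)) * C + (1 / (2 * C)) * norm X * C"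
        using elim C(1) pos unfolding dist_norm
        by (intro add_strict_mono mult_strict_right_mono mult_strict_left_mono) auto
      also have "\<dots> = norm X" using C(1) by simp
      finally show False using pos by simp
    qed
  qed
qed

text \<open>Polar decomposition projects the line \<open>K + t P\<close> to the complex structures of the moving
  Euclidean space; this does not affect the velocity if that satisfies the linearised equations.\<close>

lemma orth_acs_curve_exists:
  fixes G \<pi> :: "real \<Rightarrow> real^'n^'n"
  assumes G: "(G has_vector_derivative G') (at 0)" and \<pi>: "(\<pi> has_vector_derivative \<pi>') (at 0)"
    and ev: "\<forall>\<^sub>F t in nhds 0. transpose (G t) = G t \<and> self_adjoint (G t) (\<pi> t) \<and> \<pi> t ** \<pi> t = \<pi> t"
    and inv: "invertible (G 0)"
    and K: "orth_acs (G 0) (\<pi> 0) K" and P: "orth_acs_deriv (G 0) G' (\<pi> 0) \<pi>' K P"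
  obtains k where "k 0 = K" "(k has_vector_derivative P) (at 0)"
    "\<forall>\<^sub>F t in nhds 0. orth_acs (G t) (\<pi> t) (k t)"
proof -
  note mm = matrix_mult_has_vector_derivative
  note tr = bounded_linear.has_vector_derivative [OF bounded_linear_transpose]
  have lim: "(X \<longlongrightarrow> X 0) (nhds 0)" if "(X has_vector_derivative X') (at 0)"
    for X :: "real \<Rightarrow> real^'n^'n" and X'
    using has_vector_derivative_continuous [OF that] by (simp add: continuous_at tendsto_nhds_iff)
  let ?Gi = "matrix_inv (G 0)"
  have Gi: "G 0 ** ?Gi = mat 1" "?Gi ** G 0 = mat 1"
    using inv by (simp_all add: matrix_inv)
  note K' = K [unfolded orth_acs_def skew_adjoint_def]
  note P' = P [unfolded orth_acs_deriv_def]
  define L where "L t = K + t *\<^sub>R P" for t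
  have L: "(L has_vector_derivative P) (at 0)"
    unfolding L_def by (auto intro!: derivative_eq_intros)
  have L0: "L 0 = K" by (simp add: L_def)
  \<comment> \<open>As \<open>G t\<close> is symmetric near 0, \<open>transpose (N t)\<close> is the
    \<open>G t\<close>-adjoint of \<open>L t\<close>, and \<open>M t\<close> below is the
    skew-adjoint part of \<open>L t\<close>. The linearised skewness ensures that the value
    \<open>K\<close> and the velocity \<open>P\<close> survive.\<close>
  define N where "N t = (G t ** L t) ** matrix_inv (G t)" for t
  have evinv: "\<forall>\<^sub>F t in nhds 0. invertible (G t)"
    using eventually_invertible [OF lim [OF G] inv] .
  have NG: "\<forall>\<^sub>F t in nhds 0. N t ** G t = G t ** L t"
    using evinv by eventually_elim (simp add: N_def matrix_mul_assoc [symmetric] matrix_inv)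
  have GK: "G 0 ** K = - (transpose K ** G 0)" using K' by simp
  have N0: "N 0 = - transpose K"
    by (simp add: N_def L0 GK matrix_neg_lmult matrix_mul_assoc [symmetric] Gi)
  have "(N has_vector_derivative (G 0 ** P + G' ** L 0 - N 0 ** G') ** ?Gi) (at 0)"
    by (rule has_vector_derivative_right_divide [OF G Gi(1) mm [OF G L] NG])
  also have "G 0 ** P + G' ** L 0 - N 0 ** G' = - (transpose P ** G 0)"
    unfolding N0 L0 matrix_neg_lmult using P' by (simp add: eq_neg_iff_add_eq_0 algebra_simps)
  also have "- (transpose P ** G 0) ** ?Gi = - transpose P"
    by (simp add: matrix_neg_lmult matrix_mul_assoc [symmetric] Gi)
  finally have N: "(N has_vector_derivative - transpose P) (at 0)" .
  define M where "M t = (1/2) *\<^sub>R (L t - transpose (N t))" for t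
  have "(M has_vector_derivative (1/2) *\<^sub>R (P - transpose (- transpose P))) (at 0)"
    unfolding M_def
    by (intro bounded_linear.has_vector_derivative [OF bounded_linear_scaleR_right]
        has_vector_derivative_diff L tr [OF N])
  then have M: "(M has_vector_derivative P) (at 0)"
    by (simp only: transpose_minus transpose_transpose diff_minus_eq_add scaleR_half_double)
  have M0: "M 0 = K"
    by (simp only: M_def L0 N0 transpose_minus transpose_transpose diff_minus_eq_add scaleR_half_double)
  define A where "A t = \<pi> t ** M t ** \<pi> t" for t
  have A0: "A 0 = K" using K' by (simp add: A_def M0)
  have "(A has_vector_derivative (\<pi> 0 ** M 0) ** \<pi>' + (\<pi> 0 ** P + \<pi>' ** M 0) ** \<pi> 0) (at 0)"
    unfolding A_def by (intro mm \<pi> M)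
  then have A: "(A has_vector_derivative P) (at 0)"
    unfolding M0 using P' K' by simp
  \<comment> \<open>On the image of \<open>\<pi> t\<close> this is \<open>- A t ** A t\<close>, the
    square of the positive factor of the skew matrix \<open>A t\<close>; on the complement it is the
    identity. The equation for \<open>K ** P + P ** K\<close> says that its derivative vanishes, so
    its root \<open>\<sigma>\<close> is stationary and dividing by it does not change the
    velocity.\<close>
  define B where "B t = mat 1 - \<pi> t - A t ** A t" for t
  have B0: "B 0 = mat 1" using K' by (simp add: B_def A0)
  have "(B has_vector_derivative 0 - \<pi>' - (A 0 ** P + P ** A 0)) (at 0)"
    unfolding B_def by (intro has_vector_derivative_diff has_vector_derivative_const mm \<pi> A)
  then have B: "(B has_vector_derivative 0) (at 0)"
    unfolding A0 using P' by simp
  obtain r :: "real^'n^'n \<Rightarrow> real^'n^'n" where r: "r (mat 1) = mat 1"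
    "(r has_derivative (\<lambda>h. (1/2) *\<^sub>R h)) (at (mat 1))"
    "\<forall>\<^sub>F B in nhds (mat 1). r B ** r B = B"
    by (rule matrix_square_root)
  define \<sigma> where "\<sigma> t = r (B t)" for t
  have \<sigma>0: "\<sigma> 0 = mat 1" by (simp add: \<sigma>_def B0 r)
  have \<sigma>: "(\<sigma> has_vector_derivative 0) (at 0)"
    using diff_chain_at [OF B [unfolded has_vector_derivative_def], of r "\<lambda>h. (1/2) *\<^sub>R h"] r(2)
    unfolding has_vector_derivative_def \<sigma>_def by (simp add: B0 o_def)
  have \<sigma>2: "\<forall>\<^sub>F t in nhds 0. \<sigma> t ** \<sigma> t = B t"
    using eventually_compose_filterlim [OF r(3) lim [OF B, unfolded B0]] by (simp add: \<sigma>_def)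
  have \<sigma>lim: "(\<sigma> \<longlongrightarrow> mat 1) (nhds 0)" using lim [OF \<sigma>] by (simp add: \<sigma>0)
  have \<sigma>inv: "\<forall>\<^sub>F t in nhds 0. invertible (\<sigma> t)"
    by (rule eventually_invertible [OF \<sigma>lim]) (simp add: invertible_det_nz)
  have syl: "\<forall>\<^sub>F t in nhds 0. \<forall>X. X ** \<sigma> t + \<sigma> t ** X = 0 \<longrightarrow> X = 0"
    by (rule eventually_sylvester_injective [OF \<sigma>lim \<sigma>lim])
  have "((\<lambda>t. transpose (\<sigma> t)) \<longlongrightarrow> mat 1) (nhds 0)"
    using tendsto_transpose [OF \<sigma>lim] by (simp add: transpose_mat)
  then have syl': "\<forall>\<^sub>F t in nhds 0. \<forall>X. X ** \<sigma> t + transpose (\<sigma> t) ** X = 0 \<longrightarrow> X = 0"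
    by (rule eventually_sylvester_injective [OF \<sigma>lim])
  define k where "k t = A t ** matrix_inv (\<sigma> t)" for t
  have k\<sigma>: "\<forall>\<^sub>F t in nhds 0. k t ** \<sigma> t = A t"
    using \<sigma>inv by eventually_elim (simp add: k_def matrix_mul_assoc [symmetric] matrix_inv)
  have k0: "k 0 = K" using eventually_nhds_x_imp_x [OF k\<sigma>] by (simp add: \<sigma>0 A0)
  have "(k has_vector_derivative (P - k 0 ** 0) ** mat 1) (at 0)"
    by (rule has_vector_derivative_right_divide [OF \<sigma> _ A k\<sigma>]) (simp add: \<sigma>0)
  then have k: "(k has_vector_derivative P) (at 0)" by simp
  have "\<forall>\<^sub>F t in nhds 0. orth_acs (G t) (\<pi> t) (k t)"
    using ev NG \<sigma>2 \<sigma>inv syl syl' k\<sigma>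
  proof eventually_elim
    case (elim t)
    define g p a s m where "g = G t" and "p = \<pi> t" and "a = A t" and "s = \<sigma> t" and "m = M t"
    have g: "transpose g = g" and pg: "transpose p ** g = g ** p" and pp: "p ** p = p"
      using elim(1) by (simp_all add: g_def p_def self_adjoint_def)
    have mg: "transpose m ** g = - (g ** m)"
    proof -
      have "g ** transpose (N t) = transpose (L t) ** g"
        using arg_cong [OF elim(2), of transpose] g by (simp add: matrix_transpose_mul g_def)
      then show ?thesis
        using elim(2) unfolding m_def M_def g_def
        by (simp add: transpose_simps matrix_ring_simps algebra_simps)
    qed
    have a: "a = p ** m ** p" by (simp add: a_def A_def p_def m_def)
    have ap: "a ** p = a" "p ** a = a"
      by (simp_all add: a matrix_mul_assoc pp) (simp add: a matrix_mul_assoc [symmetric] pp)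
    have ag: "transpose a ** g = - (g ** a)"
    proof -
      have "transpose a ** g = transpose p ** (transpose m ** (transpose p ** g))"
        by (simp add: a matrix_transpose_mul matrix_mul_assoc)
      also have "\<dots> = transpose p ** ((transpose m ** g) ** p)"
        unfolding pg by (simp add: matrix_mul_assoc)
      also have "\<dots> = - ((transpose p ** g) ** m ** p)"
        unfolding mg by (simp add: matrix_ring_simps matrix_mul_assoc)
      also have "\<dots> = - (g ** a)"
        unfolding pg a by (simp add: matrix_mul_assoc)
      finally show ?thesis .
    qed
    have ss: "s ** s = mat 1 - p - a ** a"
      using elim(3) by (simp add: s_def B_def p_def a_def)
    \<comment> \<open>The commutator \<open>X = x ** s - s ** x\<close> satisfies
      \<open>X ** s + s ** X = x ** (s ** s) - (s ** s) ** x\<close>, so it vanishes by the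
      Sylvester injectivity.\<close>
    have comm: "x ** s = s ** x" if "x ** (s ** s) = (s ** s) ** x" for x
    proof -
      have "(x ** s - s ** x) ** s + s ** (x ** s - s ** x) = 0"
        using that by (simp add: matrix_ring_simps matrix_mul_assoc)
      from elim(5) [folded s_def, rule_format, OF this] show ?thesis by simp
    qed
    have as: "a ** s = s ** a"
      by (rule comm) (simp add: ss matrix_diff_lmult matrix_diff_rmult ap matrix_mul_assoc)
    have aap: "a ** a ** p = a ** a" "p ** (a ** a) = a ** a"
      using ap by (metis matrix_mul_assoc)+
    have ps: "p ** s = s ** p"
      by (rule comm) (simp only: ss matrix_diff_lmult matrix_diff_rmult pp ap aap matrix_mul_lid matrix_mul_rid)
    have "transpose (s ** s) ** g = g ** (s ** s)"
    proof -
      have "transpose (a ** a) ** g = g ** (a ** a)"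
      proof -
        have "transpose (a ** a) ** g = transpose a ** (transpose a ** g)"
          by (simp add: matrix_transpose_mul matrix_mul_assoc)
        also have "\<dots> = - (transpose a ** (g ** a))"
          by (simp only: ag matrix_neg_rmult)
        also have "\<dots> = - ((transpose a ** g) ** a)"
          by (simp only: matrix_mul_assoc)
        also have "\<dots> = g ** (a ** a)"
          unfolding ag by (simp add: matrix_ring_simps matrix_mul_assoc)
        finally show ?thesis .
      qed
      then show ?thesis
        unfolding ss by (simp add: transpose_simps matrix_ring_simps pg)
    qed
    \<comment> \<open>The same argument for \<open>transpose s ** g - g ** s\<close>: the root is
      self-adjoint because its square is.\<close>
    then have "(transpose s ** g - g ** s) ** s + transpose s ** (transpose s ** g - g ** s) = 0"
      by (simp add: matrix_ring_simps matrix_mul_assoc matrix_transpose_mul)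
    from elim(6) [folded s_def, rule_format, OF this] have sg: "transpose s ** g = g ** s"
      by simp
    let ?i = "matrix_inv s"
    have si: "s ** ?i = mat 1" "?i ** s = mat 1"
      using elim(4) by (simp_all add: s_def matrix_inv)
    have icomm: "x ** ?i = ?i ** x" if "x ** s = s ** x" for x
      by (metis that si matrix_mul_assoc matrix_mul_lid matrix_mul_rid)
    have ig: "transpose ?i ** g = g ** ?i"
    proof -
      have "transpose ?i ** g = transpose ?i ** (g ** s) ** ?i"
        by (simp add: matrix_mul_assoc [symmetric] si)
      also have "\<dots> = (transpose ?i ** transpose s) ** g ** ?i"
        by (simp add: sg [symmetric] matrix_mul_assoc)
      also have "transpose ?i ** transpose s = mat 1"
        using arg_cong [OF si(1), of transpose] by (simp add: matrix_transpose_mul transpose_mat)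
      finally show ?thesis by simp
    qed
    have k: "k t = a ** ?i" by (simp add: k_def a_def s_def)
    have "k t ** p = k t"
      using icomm [OF ps] ap unfolding k by (metis matrix_mul_assoc)
    moreover have "p ** k t = k t"
      unfolding k by (simp add: matrix_mul_assoc ap)
    moreover have "k t ** k t = - p"
    proof -
      have "k t ** k t = (a ** a) ** (?i ** ?i)"
        unfolding k using icomm [OF as] by (metis matrix_mul_assoc)
      also have "a ** a = - (p ** (s ** s))"
        unfolding ss by (simp add: matrix_diff_rmult pp aap)
      also have "- (p ** (s ** s)) ** (?i ** ?i) = - p"
        unfolding matrix_neg_lmult by (metis si(1) matrix_mul_assoc matrix_mul_rid)
      finally show ?thesis .
    qed
    moreover have "transpose (k t) ** g = - (g ** k t)"
    proof -
      have "transpose (k t) ** g = transpose ?i ** (transpose a ** g)"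
        by (simp add: k matrix_transpose_mul matrix_mul_assoc)
      also have "\<dots> = - ((transpose ?i ** g) ** a)"
        by (simp only: ag matrix_neg_rmult matrix_mul_assoc)
      also have "\<dots> = - (g ** (?i ** a))"
        unfolding ig by (simp add: matrix_mul_assoc)
      finally show ?thesis unfolding k icomm [OF as] .
    qed
    ultimately show ?case
      by (simp add: orth_acs_def skew_adjoint_def p_def g_def)
  qed
  then show thesis using that [OF k0 k] by blast
qed

section \<open>Vertical vectors and horizontal parts\<close>

lemma matrix_vector_mult_minus: "A *v (- v) = - (A *v (v :: real^'c))"
  by (rule bounded_bilinear.minus_right [OF bounded_bilinear_matrix_vector_mult])

lemma skew_adjoint_add: "skew_adjoint G A \<Longrightarrow> skew_adjoint G B \<Longrightarrow> skew_adjoint G (A + B)"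
  and skew_adjoint_diff: "skew_adjoint G A \<Longrightarrow> skew_adjoint G B \<Longrightarrow> skew_adjoint G (A - B)"
  and skew_adjoint_minus: "skew_adjoint G A \<Longrightarrow> skew_adjoint G (- A)"
  by (simp_all add: skew_adjoint_def transpose_simps matrix_ring_simps)

lemma transpose_mult_adjoint:
  fixes G :: "real^'n^'n"
  assumes "transpose A ** G = G ** A'" "transpose B ** G = G ** B'"
  shows "transpose (A ** B) ** G = G ** (B' ** A')"
proof -
  have "transpose (A ** B) ** G = transpose B ** G ** A'"
    by (simp only: matrix_transpose_mul matrix_mul_assoc [symmetric] assms(1))
  then show ?thesis
    by (simp only: assms(2) matrix_mul_assoc)
qed

lemma skew_adjoint_alt: "skew_adjoint G A \<longleftrightarrow> transpose A ** G = G ** (- A)"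
  by (simp add: skew_adjoint_def matrix_neg_rmult)

lemma skew_adjoint_anticommutator:
  assumes "skew_adjoint G A" "self_adjoint G B"
  shows "skew_adjoint G (A ** B + B ** A)"
proof -
  note A = assms(1) [unfolded skew_adjoint_alt] and B = assms(2) [unfolded self_adjoint_def]
  show ?thesis
    unfolding skew_adjoint_def transpose_add matrix_add_rdistrib
      transpose_mult_adjoint [OF A B] transpose_mult_adjoint [OF B A]
    by (simp add: matrix_ring_simps)
qed

lemma skew_adjoint_mult_anticommuting:
  assumes "skew_adjoint G A" "skew_adjoint G B" "A ** B = - (B ** A)"
  shows "skew_adjoint G (A ** B)"
proof -
  note A = assms(1) [unfolded skew_adjoint_alt] and B = assms(2) [unfolded skew_adjoint_alt]
  show ?thesis
    unfolding skew_adjoint_def transpose_mult_adjoint [OF A B]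
    by (simp add: matrix_neg_lmult matrix_neg_rmult assms(3))
qed

text \<open>The tangent space at \<open>K\<close> of the orthogonal complex structures on a fixed
  Euclidean space, the image of \<open>\<pi>\<close>: the solutions of \<open>orth_acs_deriv\<close>
  when the metric and the projection do not move.\<close>

definition vert_space :: "real^'n^'n \<Rightarrow> real^'n^'n \<Rightarrow> real^'n^'n \<Rightarrow> (real^'n^'n) set" where
  "vert_space G \<pi> K = {A. \<pi> ** A = A \<and> A ** \<pi> = A \<and> K ** A = - (A ** K) \<and> skew_adjoint G A}"

text \<open>The fibre component of the horizontal lift of a vector with connection matrix \<open>\<Gamma>\<close>, along
  which the projection \<open>\<pi>\<close> has derivative \<open>\<pi>'\<close>.\<close>

definition hor_part :: "real^'n^'n \<Rightarrow> real^'n^'n \<Rightarrow> real^'n^'n \<Rightarrow> real^'n^'n \<Rightarrow> real^'n^'n" where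
  "hor_part \<pi> K \<Gamma> \<pi>' = K ** \<Gamma> - \<Gamma> ** K +
     (K ** (\<pi>' + \<Gamma> ** \<pi> - \<pi> ** \<Gamma>) + (\<pi>' + \<Gamma> ** \<pi> - \<pi> ** \<Gamma>) ** K)"

lemma vert_space_minus: "A \<in> vert_space G \<pi> K \<Longrightarrow> - A \<in> vert_space G \<pi> K"
  by (simp add: vert_space_def matrix_ring_simps skew_adjoint_minus)

text \<open>Together with \<open>vert_space_mult_mult\<close> this makes left multiplication by
  \<open>K\<close> a complex structure on vertical vectors; \<open>fibre_acs_graph\<close>
  identifies it with that of the fibres.\<close>

lemma vert_space_mult:
  assumes "orth_acs G \<pi> K" "A \<in> vert_space G \<pi> K"
  shows "K ** A \<in> vert_space G \<pi> K"
proof -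
  have "skew_adjoint G (K ** A)"
    using assms by (intro skew_adjoint_mult_anticommuting) (auto simp: orth_acs_def vert_space_def)
  moreover have "K ** (K ** A) = - (K ** A ** K)"
  proof -
    have "K ** A ** K = K ** (A ** K)" by (simp add: matrix_mul_assoc)
    also have "A ** K = - (K ** A)" using assms(2) by (simp add: vert_space_def)
    finally show ?thesis by (simp add: matrix_neg_rmult)
  qed
  ultimately show ?thesis
    using assms unfolding vert_space_def orth_acs_def mem_Collect_eq by (metis matrix_mul_assoc)
qed

text \<open>With \<open>\<Gamma>\<close> as connection matrix, \<open>S\<close> and \<open>V\<close>
  are the covariant derivatives of \<open>\<pi>\<close> and of \<open>K\<close>. \<open>S\<close>
  interchanges the image and the kernel of \<open>\<pi>\<close>, and \<open>K ** S + S ** K\<close>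
  is a particular solution of the inhomogeneous linear equations for \<open>V\<close>; the
  difference solves the homogeneous ones. The multiple \<open>\<theta>\<close> of the metric cancels
  because \<open>K\<close> is skew and \<open>\<pi>\<close> self-adjoint. The particular solution
  has no component within the image of \<open>\<pi>\<close>, whence the second claim.\<close>

lemma orth_acs_deriv_iff:
  assumes K: "orth_acs G \<pi> K" and \<pi>: "\<pi> ** \<pi> = \<pi>" "self_adjoint G \<pi>"
    and \<pi>': "\<pi> ** \<pi>' + \<pi>' ** \<pi> = \<pi>'" "transpose \<pi> ** G' + transpose \<pi>' ** G = G ** \<pi>' + G' ** \<pi>"
    and G': "G' = transpose \<Gamma> ** G + G ** \<Gamma> + \<theta> *\<^sub>R G"
  shows "orth_acs_deriv G G' \<pi> \<pi>' K P \<longleftrightarrow> P - hor_part \<pi> K \<Gamma> \<pi>' \<in> vert_space G \<pi> K"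
    and "\<pi> ** (P + \<Gamma> ** K - K ** \<Gamma>) ** \<pi> = \<pi> ** (P - hor_part \<pi> K \<Gamma> \<pi>') ** \<pi>"
proof -
  define S where "S = \<pi>' + \<Gamma> ** \<pi> - \<pi> ** \<Gamma>"
  define V where "V = P + \<Gamma> ** K - K ** \<Gamma>"
  define A where "A = V - (K ** S + S ** K)"
  have A: "P - hor_part \<pi> K \<Gamma> \<pi>' = A"
    by (simp add: hor_part_def A_def V_def S_def)
  note K' = K [unfolded orth_acs_def]
  have Kp: "X ** K ** \<pi> = X ** K" "X ** \<pi> ** K = X ** K" "X ** K ** K = - (X ** \<pi>)"
    "X ** \<pi> ** \<pi> = X ** \<pi>" for X
    using K' \<pi> by (simp_all add: matrix_mul_assoc [symmetric] matrix_neg_rmult)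
  have S: "\<pi> ** S + S ** \<pi> = S"
  proof -
    have "\<pi> ** S + S ** \<pi> = (\<pi> ** \<pi>' + \<pi>' ** \<pi>) + \<Gamma> ** \<pi> - \<pi> ** \<Gamma>"
      unfolding S_def using \<pi>(1) by (simp add: matrix_ring_simps matrix_mul_assoc Kp)
    then show ?thesis using \<pi>'(1) by (simp add: S_def)
  qed
  have S0: "\<pi> ** S ** \<pi> = 0"
  proof -
    have "\<pi> ** (\<pi> ** S + S ** \<pi>) = \<pi> ** S" by (simp only: S)
    then show ?thesis by (simp add: matrix_add_ldistrib matrix_mul_assoc \<pi>(1))
  qed
  have Kpi: "K ** \<pi> = K" "\<pi> ** K = K" "K ** K = - \<pi>" using K' by auto
  have KSp: "K ** S ** \<pi> = 0"
  proof -
    have "K ** S ** \<pi> = K ** (\<pi> ** S ** \<pi>)" by (simp add: matrix_mul_assoc Kpi)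
    then show ?thesis by (simp add: S0)
  qed
  have pSK: "\<pi> ** S ** K = 0"
  proof -
    have "\<pi> ** S ** K = (\<pi> ** S ** \<pi>) ** K" by (simp add: Kp)
    then show ?thesis by (simp add: S0)
  qed
  have KSK: "K ** S ** K = 0"
  proof -
    have "K ** S ** K = (K ** S ** \<pi>) ** K" by (simp add: Kp)
    then show ?thesis by (simp add: KSp)
  qed
  have SS: "self_adjoint G S"
  proof -
    have "transpose \<pi> ** (transpose \<Gamma> ** G + G ** \<Gamma> + \<theta> *\<^sub>R G) + transpose \<pi>' ** G
        = G ** \<pi>' + (transpose \<Gamma> ** G + G ** \<Gamma> + \<theta> *\<^sub>R G) ** \<pi>"
      using \<pi>'(2) by (simp add: G')
    moreover have "transpose \<pi> ** G ** \<Gamma> = G ** \<pi> ** \<Gamma>" "transpose \<Gamma> ** transpose \<pi> ** G = transpose \<Gamma> ** G ** \<pi>"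
      "transpose \<pi> ** G = G ** \<pi>"
      using \<pi>(2) unfolding self_adjoint_def by (simp_all add: matrix_mul_assoc [symmetric])
    ultimately show ?thesis
      unfolding self_adjoint_def S_def
      by (simp add: transpose_simps matrix_ring_simps matrix_mul_assoc algebra_simps)
  qed
  have skS: "skew_adjoint G (K ** S + S ** K)"
    using K' SS by (intro skew_adjoint_anticommutator) auto
  have e1: "K ** \<pi>' + P ** \<pi> = P \<longleftrightarrow> K ** S + V ** \<pi> = V"
    unfolding S_def V_def by (simp add: matrix_ring_simps matrix_mul_assoc Kp Kpi algebra_simps)
  have e2: "\<pi> ** P + \<pi>' ** K = P \<longleftrightarrow> \<pi> ** V + S ** K = V"
    unfolding S_def V_def by (simp add: matrix_ring_simps matrix_mul_assoc Kp Kpi algebra_simps)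
  have e3: "K ** P + P ** K = - \<pi>' \<longleftrightarrow> K ** V + V ** K = - S"
    unfolding S_def V_def eq_neg_iff_add_eq_0
    by (simp add: matrix_ring_simps matrix_mul_assoc Kp Kpi algebra_simps)
  have e4: "transpose K ** G' + transpose P ** G = - (G ** P + G' ** K) \<longleftrightarrow> skew_adjoint G V"
  proof -
    have KG: "transpose K ** G = - (G ** K)" using K' by (simp add: skew_adjoint_def)
    have KG2: "transpose \<Gamma> ** transpose K ** G = - (transpose \<Gamma> ** G ** K)"
      by (simp only: matrix_mul_assoc [symmetric] KG matrix_neg_rmult)
    show ?thesis
      unfolding skew_adjoint_def V_def G'
      by (simp add: transpose_simps matrix_ring_simps matrix_mul_assoc KG KG2 algebra_simps)
  qed
  have "orth_acs_deriv G G' \<pi> \<pi>' K P \<longleftrightarrow>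
      K ** S + V ** \<pi> = V \<and> \<pi> ** V + S ** K = V \<and> K ** V + V ** K = - S \<and> skew_adjoint G V"
    unfolding orth_acs_deriv_def e1 e2 e3 e4 ..
  also have "\<dots> \<longleftrightarrow> A ** \<pi> = A \<and> \<pi> ** A = A \<and> K ** A + A ** K = 0 \<and> skew_adjoint G A"
  proof -
    have V: "V = A + (K ** S + S ** K)" by (simp add: A_def)
    have "K ** S + V ** \<pi> = V \<longleftrightarrow> A ** \<pi> = A"
      unfolding V by (simp add: matrix_ring_simps matrix_mul_assoc Kp KSp algebra_simps)
    moreover have "\<pi> ** V + S ** K = V \<longleftrightarrow> \<pi> ** A = A"
      unfolding V by (simp add: matrix_ring_simps matrix_mul_assoc Kpi pSK algebra_simps)
    moreover have "K ** V + V ** K = - S \<longleftrightarrow> K ** A + A ** K = 0"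
    proof -
      have "K ** V + V ** K = K ** A + A ** K - (\<pi> ** S + S ** \<pi>)"
        unfolding V by (simp add: matrix_ring_simps matrix_mul_assoc Kpi Kp KSK algebra_simps)
      then show ?thesis unfolding S by simp
    qed
    moreover have "skew_adjoint G V \<longleftrightarrow> skew_adjoint G A"
      using skew_adjoint_add [OF _ skS, of A, folded V] skew_adjoint_diff [OF _ skS, of V, folded A_def] by blast
    ultimately show ?thesis by simp
  qed
  finally show "orth_acs_deriv G G' \<pi> \<pi>' K P \<longleftrightarrow> P - hor_part \<pi> K \<Gamma> \<pi>' \<in> vert_space G \<pi> K"
    unfolding A vert_space_def mem_Collect_eq eq_neg_iff_add_eq_0 by blast
  have "\<pi> ** A ** \<pi> = \<pi> ** V ** \<pi>"
    unfolding A_def by (simp add: matrix_ring_simps matrix_mul_assoc Kpi KSp pSK)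
  then show "\<pi> ** (P + \<Gamma> ** K - K ** \<Gamma>) ** \<pi> = \<pi> ** (P - hor_part \<pi> K \<Gamma> \<pi>') ** \<pi>"
    unfolding A V_def ..
qed

section \<open>Linear algebra at a point of the immersion\<close>

lemma inner_matrix_vector_left: "(A *v v) \<bullet> w = v \<bullet> (transpose A *v (w :: real^'n))"
  by (simp only: vector_transpose_matrix [symmetric] dot_lmul_matrix)

lemma skew_adjoint_apply:
  assumes "skew_adjoint G A"
  shows "(A *v v) \<bullet> (G *v w) = - (v \<bullet> (G *v (A *v w)))"
  by (simp only: inner_matrix_vector_left matrix_vector_mul_assoc assms [unfolded skew_adjoint_def]
      matrix_neg_vmult inner_minus_right)

lemma self_adjoint_apply:
  assumes "self_adjoint G A"
  shows "(A *v v) \<bullet> (G *v w) = v \<bullet> (G *v (A *v w))"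
  by (simp only: inner_matrix_vector_left matrix_vector_mul_assoc assms [unfolded self_adjoint_def])

text \<open>The linear algebra behind the theorem at a point. \<open>L\<close> is the differential of the immersion,
  \<open>b\<close> its second fundamental form, \<open>\<pi>\<close> the normal projection; \<open>J\<close> and \<open>K\<close> are the complex
  structures given by \<open>p\<close> and \<open>p \<oplus> q\<close>, with covariant derivatives \<open>A\<close> and \<open>V\<close>.\<close>

lemma holomorphic_iff_pluriharmonic_part:
  fixes L :: "real^'m^'n" and b :: "real^'m \<Rightarrow> real^'m \<Rightarrow> real^'n"
  assumes KK: "K ** K = - mat 1" and JJ: "J ** J = - mat 1" and KL: "K ** L = L ** J"
    and b_add: "\<And>X Y Z. b X (Y + Z) = b X Y + b X Z" and b_sym: "\<And>X Y. b X Y = b Y X"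
    and V: "\<And>X Y. V X *v (L *v Y) = b X (J *v Y) - K *v b X Y + L *v (A X *v Y)"
    and sk: "\<And>X. skew_adjoint G (V X)" "\<And>X. K ** V X = - (V X ** K)" and skK: "skew_adjoint G K"
    and \<pi>: "K ** \<pi> = \<pi> ** K" "\<And>v. (\<And>Y. v \<bullet> (G *v (L *v Y)) = 0) \<Longrightarrow> \<pi> *v v = v"
      "\<And>v. \<exists>Y. v - \<pi> *v v = L *v Y" "\<pi> ** \<pi> = \<pi>"
    and p: "\<And>X. A (J *v X) = - (J ** A X)"
  shows "(\<forall>X. V (J *v X) = - (K ** V X)) \<longleftrightarrow>
    (\<forall>X Y. b X Y + b (J *v X) (J *v Y) = 0) \<and>
    (\<forall>X. \<pi> ** V (J *v X) ** \<pi> = - ((K ** \<pi>) ** (\<pi> ** V X ** \<pi>)))"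
    (is "?V \<longleftrightarrow> ?b \<and> ?q")
proof -
  have KKv: "K *v (K *v v) = - v" for v
    by (simp add: matrix_vector_mul_assoc KK matrix_neg_vmult)
  have JJv: "J *v (J *v v) = - v" for v
    by (simp add: matrix_vector_mul_assoc JJ matrix_neg_vmult)
  have KLv: "K *v (L *v v) = L *v (J *v v)" for v
    by (simp add: matrix_vector_mul_assoc KL)
  have b0: "b X 0 = 0" for X using b_add [of X 0 0] by simp
  have b_minus: "b X (- Y) = - b X Y" for X Y
    using b_add [of X Y "- Y"] by (simp add: b0 eq_neg_iff_add_eq_0 add.commute)
  have b_minus': "b (- X) Y = - b X Y" for X Y
    by (metis b_minus b_sym)
  \<comment> \<open>Twice the (1,1)-part of \<open>b\<close>: applying \<open>J\<close> to both
    arguments at once does not change \<open>C\<close>.\<close>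
  define C where "C X Y = b X Y + b (J *v X) (J *v Y)" for X Y
  have C_sym: "C X Y = C Y X" for X Y by (simp add: C_def b_sym)
  have CJ: "C X (J *v Y) = b X (J *v Y) - b (J *v X) Y" for X Y
    by (simp add: C_def JJv b_minus)
  have CJ': "C (J *v X) Y = - C X (J *v Y)" for X Y
    by (simp add: CJ) (simp add: C_def JJv b_minus')
  \<comment> \<open>The terms with \<open>A\<close> cancel: by \<open>p\<close> and
    \<open>KL\<close>, \<open>L ** A (J *v X)\<close> is
    \<open>- (L ** J ** A X) = - (K ** L ** A X)\<close>. Only second fundamental forms
    survive.\<close>
  have key: "(V (J *v X) + K ** V X) *v (L *v Y) = C (J *v X) (J *v Y) + - (K *v C (J *v X) Y)" for X Y
  proof -
    have "(V (J *v X) + K ** V X) *v (L *v Y) = V (J *v X) *v (L *v Y) + K *v (V X *v (L *v Y))"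
      by (simp only: matrix_vector_mult_add_rdistrib matrix_vector_mul_assoc [symmetric])
    also have "\<dots> = b (J *v X) (J *v Y) - K *v b (J *v X) Y + L *v (A (J *v X) *v Y)
        + (K *v b X (J *v Y) + b X Y + K *v (L *v (A X *v Y)))"
      unfolding V by (simp add: matrix_vector_right_distrib matrix_vector_mult_diff_distrib KKv)
    also have "\<dots> = C X Y + K *v (b X (J *v Y) - b (J *v X) Y)"
      by (simp add: p KLv matrix_neg_vmult matrix_vector_mul_assoc [symmetric] C_def
          matrix_vector_mult_diff_distrib matrix_vector_mult_minus)
    also have "C X Y = C (J *v X) (J *v Y)"
      by (simp add: C_def JJv b_minus b_minus')
    also have "b X (J *v Y) - b (J *v X) Y = - C (J *v X) Y"
      by (simp add: CJ' CJ)
    finally show ?thesis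
      by (metis diff_0 matrix_vector_mult_diff_distrib matrix_vector_mult_0_right)
  qed
  have Vq: "\<pi> ** V (J *v X) ** \<pi> = - ((K ** \<pi>) ** (\<pi> ** V X ** \<pi>)) \<longleftrightarrow>
      \<pi> ** (V (J *v X) + K ** V X) ** \<pi> = 0" for X
  proof -
    have "(K ** \<pi>) ** (\<pi> ** V X ** \<pi>) = K ** (\<pi> ** \<pi>) ** V X ** \<pi>" by (simp only: matrix_mul_assoc)
    also have "\<dots> = \<pi> ** K ** V X ** \<pi>" by (simp only: \<pi>)
    finally show ?thesis
      by (simp add: matrix_ring_simps matrix_mul_assoc eq_neg_iff_add_eq_0)
  qed
  show ?thesis
  proof
    assume ?V
    then have D: "V (J *v X) + K ** V X = 0" for X by simp
    have "C X Y = 0" for X Y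
    proof -
      have e: "C (J *v X) (J *v Y) = K *v C (J *v X) Y" for X Y
        using key [of X Y] by (simp add: D)
      have e': "C X (J *v Y) = K *v C X Y" for X Y
        using e [of "- (J *v X)" Y] by (simp add: JJv matrix_vector_mult_minus)
      \<comment> \<open>By \<open>e'\<close>, \<open>C\<close> is complex linear for
        \<open>K\<close> in its second argument, and by \<open>CJ'\<close> it is antilinear in its
        first; symmetry identifies the two.\<close>
      have "K *v C X Y = C X (J *v Y)" by (simp add: e')
      also have "\<dots> = - C Y (J *v X)" by (simp add: C_sym [of X] CJ')
      also have "\<dots> = - (K *v C X Y)" by (simp add: e' C_sym)
      finally have "K *v C X Y = 0" by (simp only: vec_eq_iff) simp
      then have "K *v (K *v C X Y) = 0" by simp
      then show ?thesis by (simp add: KKv)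
    qed
    then have ?b by (simp add: C_def)
    moreover have ?q unfolding Vq by (simp add: D)
    ultimately show "?b \<and> ?q" ..
  next
    assume bq: "?b \<and> ?q"
    show ?V
    proof
      fix X
      define D where "D = V (J *v X) + K ** V X"
      have C0: "C X Y = 0" for X Y using bq by (simp add: C_def)
      have DL: "D *v (L *v Y) = 0" for Y
        unfolding D_def key by (simp add: C0)
      \<comment> \<open>A skew matrix that kills the tangent space has values orthogonal to it. Thus
        \<open>D\<close> equals its normal component, which vanishes by the condition on
        \<open>q\<close>.\<close>
      have skD: "skew_adjoint G D"
        unfolding D_def by (intro skew_adjoint_add sk skew_adjoint_mult_anticommuting skK)
      have "\<pi> *v (D *v v) = D *v v" for v
        by (rule \<pi>(2)) (simp add: skew_adjoint_apply [OF skD] DL)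
      moreover have "D *v v = D *v (\<pi> *v v)" for v
      proof -
        obtain Y where "v - \<pi> *v v = L *v Y" using \<pi>(3) by blast
        then have "D *v (v - \<pi> *v v) = 0" by (simp add: DL)
        then show ?thesis by (simp add: matrix_vector_mult_diff_distrib)
      qed
      ultimately have "D *v v = (\<pi> ** D ** \<pi>) *v v" for v
        by (simp add: matrix_vector_mul_assoc [symmetric])
      moreover have "\<pi> ** D ** \<pi> = 0"
        using bq unfolding Vq D_def by blast
      ultimately have "D = 0"
        by (simp add: matrix_eq)
      then show "V (J *v X) = - (K ** V X)"
        by (simp add: D_def eq_neg_iff_add_eq_0)
    qed
  qed
qed

section \<open>Smooth functions\<close>

lemma Ck_on_cong:
  assumes "open S" "\<And>x. x \<in> S \<Longrightarrow> f x = g x" "Ck_on k f S"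
  shows "Ck_on k g S"
proof (cases k)
  case 0
  then show ?thesis using assms by (simp cong: continuous_on_cong)
next
  case (Suc j)
  then obtain f' where f': "\<And>x. x \<in> S \<Longrightarrow> (f has_derivative f' x) (at x)" "\<And>v. Ck_on j (\<lambda>x. f' x v) S"
    using assms(3) by auto
  have "(g has_derivative f' x) (at x)" if "x \<in> S" for x
    by (rule has_derivative_transform_within_open [OF f'(1) [OF that] assms(1) that assms(2)])
  then show ?thesis using f'(2) Suc by auto
qed

lemma Ck_on_subset: "Ck_on k f S \<Longrightarrow> T \<subseteq> S \<Longrightarrow> Ck_on k f T"
proof (induction k arbitrary: f)
  case 0
  then show ?case by (auto intro: continuous_on_subset)
next
  case (Suc k)
  then show ?case by (simp, metis subsetD)
qed

lemma Ck_on_Suc: "Ck_on (Suc k) f S \<Longrightarrow> Ck_on k f S"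
proof (induction k arbitrary: f)
  case 0
  then obtain f' where "\<And>x. x \<in> S \<Longrightarrow> (f has_derivative f' x) (at x)" by auto
  then have "continuous_on S f"
    by (intro continuous_at_imp_continuous_on ballI) (rule has_derivative_continuous)
  then show ?case by simp
next
  case (Suc k)
  from Suc.prems obtain f' where f': "\<forall>x\<in>S. (f has_derivative f' x) (at x)"
    "\<forall>v. Ck_on (Suc k) (\<lambda>x. f' x v) S"
    unfolding Ck_on.simps(2) [of "Suc k"] by blast
  then have "\<forall>v. Ck_on k (\<lambda>x. f' x v) S"
    using Suc.IH by simp
  with f'(1) show ?case
    unfolding Ck_on.simps(2) [of k] by (intro exI [of _ f'] conjI)
qed

lemma Ck_on_const: "Ck_on k (\<lambda>x. c) S"
proof (induction k arbitrary: c)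
  case 0
  then show ?case by simp
next
  case (Suc k)
  then show ?case
    unfolding Ck_on.simps by (intro exI [of _ "\<lambda>x v. 0"]) simp
qed

lemma Ck_on_bounded_linear_compose:
  assumes "bounded_linear h"
  shows "Ck_on k f S \<Longrightarrow> Ck_on k (\<lambda>x. h (f x)) S"
proof (induction k arbitrary: f)
  case 0
  then show ?case
    using linear_continuous_on_compose bounded_linear.linear [OF assms]
    by (metis Ck_on.simps(1) assms bounded_linear.continuous_on)
next
  case (Suc k)
  then obtain f' where f': "\<forall>x\<in>S. (f has_derivative f' x) (at x)" "\<forall>v. Ck_on k (\<lambda>x. f' x v) S"
    by auto
  have "\<forall>x\<in>S. ((\<lambda>x. h (f x)) has_derivative (\<lambda>v. h (f' x v))) (at x)"
    using f'(1) bounded_linear.has_derivative [OF assms] by blast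
  moreover have "\<forall>v. Ck_on k (\<lambda>x. h (f' x v)) S"
    using Suc.IH f'(2) by blast
  ultimately show ?case
    unfolding Ck_on.simps by (intro exI [of _ "\<lambda>x v. h (f' x v)"]) simp
qed

lemma Ck_on_add: "Ck_on k f S \<Longrightarrow> Ck_on k g S \<Longrightarrow> Ck_on k (\<lambda>x. f x + g x) S"
proof (induction k arbitrary: f g)
  case 0
  then show ?case by (auto intro: continuous_on_add)
next
  case (Suc k)
  obtain f' where f': "\<forall>x\<in>S. (f has_derivative f' x) (at x)" "\<forall>v. Ck_on k (\<lambda>x. f' x v) S"
    using Suc.prems(1) by auto
  obtain g' where g': "\<forall>x\<in>S. (g has_derivative g' x) (at x)" "\<forall>v. Ck_on k (\<lambda>x. g' x v) S"
    using Suc.prems(2) by auto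
  show ?case
    unfolding Ck_on.simps
    using f' g' Suc.IH by (intro exI [of _ "\<lambda>x v. f' x v + g' x v"]) (auto intro: has_derivative_add)
qed

lemma Ck_on_sum: "finite I \<Longrightarrow> (\<And>i. i \<in> I \<Longrightarrow> Ck_on k (f i) S) \<Longrightarrow> Ck_on k (\<lambda>x. \<Sum>i\<in>I. f i x) S"
  by (induction I rule: finite_induct) (auto intro: Ck_on_const Ck_on_add)

lemma Ck_on_bounded_bilinear:
  assumes "bounded_bilinear h"
  shows "Ck_on k f S \<Longrightarrow> Ck_on k g S \<Longrightarrow> Ck_on k (\<lambda>x. h (f x) (g x)) S"
proof (induction k arbitrary: f g)
  case 0
  then show ?case by (auto intro: bounded_bilinear.continuous_on [OF assms])
next
  case (Suc k)
  obtain f' where f': "\<forall>x\<in>S. (f has_derivative f' x) (at x)" "\<forall>v. Ck_on k (\<lambda>x. f' x v) S"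
    using Suc.prems(1) by auto
  obtain g' where g': "\<forall>x\<in>S. (g has_derivative g' x) (at x)" "\<forall>v. Ck_on k (\<lambda>x. g' x v) S"
    using Suc.prems(2) by auto
  have "Ck_on k f S" "Ck_on k g S"
    using Suc.prems by (auto dest: Ck_on_Suc simp del: Ck_on.simps)
  then have "Ck_on k (\<lambda>x. h (f x) (g' x v) + h (f' x v) (g x)) S" for v
    using f'(2) g'(2) by (intro Ck_on_add Suc.IH) auto
  then show ?case
    unfolding Ck_on.simps
    using f' g'
    by (intro exI [of _ "\<lambda>x v. h (f x) (g' x v) + h (f' x v) (g x)"])
      (auto intro: bounded_bilinear.FDERIV [OF assms])
qed

lemma Ck_on_compose:
  fixes f :: "'a::real_normed_vector \<Rightarrow> 'b::euclidean_space" and g :: "'b \<Rightarrow> 'c::real_normed_vector"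
  shows "Ck_on k f S \<Longrightarrow> Ck_on k g T \<Longrightarrow> f ` S \<subseteq> T \<Longrightarrow> Ck_on k (\<lambda>x. g (f x)) S"
proof (induction k arbitrary: f g)
  case 0
  then show ?case by (auto intro: continuous_on_compose2)
next
  case (Suc k)
  obtain f' where f': "\<forall>x\<in>S. (f has_derivative f' x) (at x)" "\<forall>v. Ck_on k (\<lambda>x. f' x v) S"
    using Suc.prems(1) by auto
  obtain g' where g': "\<forall>x\<in>T. (g has_derivative g' x) (at x)" "\<forall>v. Ck_on k (\<lambda>x. g' x v) T"
    using Suc.prems(2) by auto
  have fk: "Ck_on k f S"
    using Suc.prems(1) by (rule Ck_on_Suc)
  \<comment> \<open>\<open>Ck_on\<close> controls derivatives in fixed directions only, whereas the
    chain rule evaluates \<open>g'\<close> in the moving direction \<open>f' x v\<close>. Expanding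
    this vector in \<open>Basis\<close> leaves fixed directions with scalar coefficients.\<close>
  define d where "d x v = (\<Sum>b\<in>Basis. (f' x v \<bullet> b) *\<^sub>R g' (f x) b)" for x v
  have "((\<lambda>x. g (f x)) has_derivative d x) (at x)" if "x \<in> S" for x
  proof -
    have gx: "(g has_derivative g' (f x)) (at (f x))" using that g' Suc.prems(3) by blast
    have "((\<lambda>x. g (f x)) has_derivative (\<lambda>v. g' (f x) (f' x v))) (at x)"
      using diff_chain_at [OF f'(1) [rule_format, OF that] gx] by (simp add: o_def)
    moreover have "g' (f x) (f' x v) = d x v" for v
    proof -
      have "g' (f x) (\<Sum>b\<in>Basis. (f' x v \<bullet> b) *\<^sub>R b) = d x v"
        unfolding d_def linear_sum [OF has_derivative_linear [OF gx]]
          linear_scale [OF has_derivative_linear [OF gx]] ..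
      then show ?thesis by (simp only: euclidean_representation)
    qed
    ultimately show ?thesis by (simp only:)
  qed
  moreover have "Ck_on k (\<lambda>x. d x v) S" for v
    unfolding d_def
  proof (intro Ck_on_sum Ck_on_bounded_bilinear [OF bounded_bilinear_scaleR])
    fix b :: 'b
    show "Ck_on k (\<lambda>x. f' x v \<bullet> b) S"
      by (rule Ck_on_bounded_linear_compose [OF bounded_linear_inner_left f'(2) [rule_format]])
    show "Ck_on k (\<lambda>x. g' (f x) b) S"
      using Suc.IH [OF fk, of "\<lambda>y. g' y b"] g'(2) Suc.prems(3) by blast
  qed simp
  ultimately show ?case
    unfolding Ck_on.simps by (intro exI [of _ d] conjI) simp_all
qed

lemma smooth_on_cong: "open S \<Longrightarrow> (\<And>x. x \<in> S \<Longrightarrow> f x = g x) \<Longrightarrow> smooth_on f S \<Longrightarrow> smooth_on g S"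
  unfolding smooth_on_def using Ck_on_cong by blast

lemma smooth_on_subset: "smooth_on f S \<Longrightarrow> T \<subseteq> S \<Longrightarrow> smooth_on f T"
  unfolding smooth_on_def using Ck_on_subset by blast

lemma smooth_on_const: "smooth_on (\<lambda>x. c) S"
  by (simp add: smooth_on_def Ck_on_const)

lemma smooth_on_compose:
  fixes f :: "'a::real_normed_vector \<Rightarrow> 'b::euclidean_space"
  shows "smooth_on f S \<Longrightarrow> smooth_on g T \<Longrightarrow> f ` S \<subseteq> T \<Longrightarrow> smooth_on (\<lambda>x. g (f x)) S"
  unfolding smooth_on_def by (blast intro: Ck_on_compose)

lemma smooth_on_has_derivative:
  assumes "smooth_on f S" "x \<in> S"
  shows "(f has_derivative frechet_derivative f (at x)) (at x)"
proof -
  have "Ck_on (Suc 0) f S" using assms(1) by (simp add: smooth_on_def)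
  then show ?thesis
    using assms(2) by (auto simp: frechet_derivative_works [symmetric] differentiable_def)
qed

lemma smooth_on_frechet_derivative:
  assumes "open S" "smooth_on f S"
  shows "smooth_on (\<lambda>x. frechet_derivative f (at x) v) S"
  unfolding smooth_on_def
proof
  fix k
  have "Ck_on (Suc k) f S" using assms(2) by (simp add: smooth_on_def del: Ck_on.simps)
  then obtain f' where f': "\<forall>x\<in>S. (f has_derivative f' x) (at x)" "\<forall>v. Ck_on k (\<lambda>x. f' x v) S"
    by auto
  have "f' x v = frechet_derivative f (at x) v" if "x \<in> S" for x
    using frechet_derivative_at [OF f'(1) [rule_format, OF that]] by simp
  then show "Ck_on k (\<lambda>x. frechet_derivative f (at x) v) S"
    by (rule Ck_on_cong [OF assms(1) _ f'(2) [rule_format, of v]])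
qed

text \<open>Both mixed derivatives are the limit of the second difference
  \<open>(f (u + s v + s w) - f (u + s v) - f (u + s w) + f u) / s\<^sup>2\<close>.\<close>

lemma second_difference_limit:
  fixes f :: "'a::real_normed_vector \<Rightarrow> real"
  assumes S: "open S" "u \<in> S" and f: "\<And>x. x \<in> S \<Longrightarrow> (f has_derivative f' x) (at x)"
    and H: "((\<lambda>x. f' x v) has_derivative H) (at u)"
  shows "((\<lambda>s. (f (u + s *\<^sub>R v + s *\<^sub>R w) - f (u + s *\<^sub>R v) - f (u + s *\<^sub>R w) + f u) / s\<^sup>2) \<longlongrightarrow> H w)
    (at_right 0)"
proof (rule tendstoI)
  fix e :: real assume "e > 0"
  let ?h = "\<lambda>x. f' x v"
  \<comment> \<open>The two error estimates below carry the factors \<open>norm v\<close> and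
    \<open>norm v + norm w\<close>; the summand 1 makes their sum strictly smaller than
    \<open>c\<close>, also when both vectors vanish.\<close>
  define c where "c = 2 * norm v + norm w + 1"
  have c: "c > 0" "norm v \<le> c" "norm v + norm w \<le> c" "norm v + (norm v + norm w) < c" by (auto simp: c_def add_nonneg_pos)
  define \<epsilon> where "\<epsilon> = e / c"
  have \<epsilon>: "\<epsilon> > 0" using \<open>e > 0\<close> c by (simp add: \<epsilon>_def)
  have lin: "linear H" using H by (rule has_derivative_linear)
  obtain d where d: "d > 0" "\<And>y. norm (y - u) < d \<Longrightarrow> norm (?h y - ?h u - H (y - u)) \<le> \<epsilon> * norm (y - u)"
    using H \<epsilon> unfolding has_derivative_at_alt by blast
  obtain d' where d': "d' > 0" "ball u d' \<subseteq> S"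
    using S open_contains_ball by blast
  define m where "m = min d d' / c"
  have m: "m > 0" using d d' c by (simp add: m_def)
  have "\<forall>\<^sub>F s in at_right 0. s \<in> {0<..<m}"
    using eventually_at_right_real [OF m] .
  then show "\<forall>\<^sub>F s in at_right 0. dist ((f (u + s *\<^sub>R v + s *\<^sub>R w) - f (u + s *\<^sub>R v) - f (u + s *\<^sub>R w) + f u) / s\<^sup>2) (H w) < e"
  proof eventually_elim
    case (elim s)
    then have s: "0 < s" "s < m" by auto
    have sc: "s * c < d" "s * c < d'" using s c by (auto simp: m_def pos_less_divide_eq)
    have near: "norm (r *\<^sub>R v) \<le> s * norm v" "norm (r *\<^sub>R v + s *\<^sub>R w) \<le> s * (norm v + norm w)"
      if "0 \<le> r" "r \<le> s" for r
    proof -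
      show 1: "norm (r *\<^sub>R v) \<le> s * norm v" using that by (simp add: mult_right_mono)
      have "norm (r *\<^sub>R v + s *\<^sub>R w) \<le> norm (r *\<^sub>R v) + norm (s *\<^sub>R w)" by (rule norm_triangle_ineq)
      also have "\<dots> \<le> s * norm v + s * norm w" using 1 s by simp
      finally show "norm (r *\<^sub>R v + s *\<^sub>R w) \<le> s * (norm v + norm w)" by (simp add: distrib_left)
    qed
    have le: "s * norm v \<le> s * c" "s * (norm v + norm w) \<le> s * c"
      using s c by (auto intro: mult_left_mono)
    have inS: "u + r *\<^sub>R v \<in> S" "u + r *\<^sub>R v + s *\<^sub>R w \<in> S" if "0 \<le> r" "r \<le> s" for r
    proof -
      have "norm (r *\<^sub>R v) < d'" "norm (r *\<^sub>R v + s *\<^sub>R w) < d'"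
        using near [OF that] le sc by linarith+
      then have "dist (u + r *\<^sub>R v) u < d'" "dist (u + r *\<^sub>R v + s *\<^sub>R w) u < d'"
        by (simp_all add: dist_norm)
      then show "u + r *\<^sub>R v \<in> S" "u + r *\<^sub>R v + s *\<^sub>R w \<in> S"
        using d'(2) by (auto simp: dist_commute)
    qed
    \<comment> \<open>The first difference along \<open>w\<close> as a function of the step along
      \<open>v\<close>. The mean value theorem trades its increment for values of the derivative in
      direction \<open>v\<close>, so that differentiability of this derivative at the single point
      \<open>u\<close> suffices.\<close>
    define \<phi> where "\<phi> r = f (u + r *\<^sub>R v + s *\<^sub>R w) - f (u + r *\<^sub>R v)" for r
    have "(\<phi> has_real_derivative (?h (u + r *\<^sub>R v + s *\<^sub>R w) - ?h (u + r *\<^sub>R v))) (at r)"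
      if r: "0 \<le> r" "r \<le> s" for r
    proof -
      have l: "((\<lambda>r. u + r *\<^sub>R v + x) has_derivative (\<lambda>t. t *\<^sub>R v)) (at r)" for x
        by (auto intro!: derivative_eq_intros)
      have 1: "((\<lambda>r. f (u + r *\<^sub>R v + s *\<^sub>R w)) has_derivative (\<lambda>t. f' (u + r *\<^sub>R v + s *\<^sub>R w) (t *\<^sub>R v))) (at r)"
        using diff_chain_at [OF l f [OF inS(2) [OF r]]] by (simp add: o_def)
      have 2: "((\<lambda>r. f (u + r *\<^sub>R v)) has_derivative (\<lambda>t. f' (u + r *\<^sub>R v) (t *\<^sub>R v))) (at r)"
        using diff_chain_at [OF l [of 0], of f] f [OF inS(1) [OF r]] by (simp add: o_def)
      have 3: "f' x (t *\<^sub>R v) = t * f' x v" if "x \<in> S" for x t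
        using linear_scale [OF has_derivative_linear [OF f [OF that]]] by simp
      show ?thesis
        unfolding \<phi>_def has_field_derivative_def
        by (rule has_derivative_eq_rhs [OF has_derivative_diff [OF 1 2]])
          (rule ext, simp only: 3 [OF inS(1) [OF r]] 3 [OF inS(2) [OF r]], simp add: algebra_simps)
    qed
    then obtain r where r: "0 < r" "r < s" "\<phi> s - \<phi> 0 = s * (?h (u + r *\<^sub>R v + s *\<^sub>R w) - ?h (u + r *\<^sub>R v))"
      using MVT2 [of 0 s \<phi> "\<lambda>r. ?h (u + r *\<^sub>R v + s *\<^sub>R w) - ?h (u + r *\<^sub>R v)"] s by auto
    have r': "0 \<le> r" "r \<le> s" using r by auto
    have b1: "norm (?h (u + r *\<^sub>R v) - ?h u - H (r *\<^sub>R v)) \<le> \<epsilon> * (s * norm v)"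
      using d(2) [of "u + r *\<^sub>R v"] near(1) [OF r'] le(1) sc(1) \<epsilon>
      by (auto intro!: order_trans [OF _ mult_left_mono [OF near(1) [OF r']]])
    have b2: "norm (?h (u + r *\<^sub>R v + s *\<^sub>R w) - ?h u - H (r *\<^sub>R v + s *\<^sub>R w)) \<le> \<epsilon> * (s * (norm v + norm w))"
      using d(2) [of "u + (r *\<^sub>R v + s *\<^sub>R w)"] near(2) [OF r'] le(2) sc(1) \<epsilon>
      by (auto simp: add.assoc intro!: order_trans [OF _ mult_left_mono [OF near(2) [OF r']]])
    have Hs: "H (r *\<^sub>R v + s *\<^sub>R w) - H (r *\<^sub>R v) = s * H w"
      using lin by (simp add: linear_add linear_scale)
    have "\<bar>?h (u + r *\<^sub>R v + s *\<^sub>R w) - ?h (u + r *\<^sub>R v) - s * H w\<bar> \<le> \<epsilon> * (s * (norm v + norm w)) + \<epsilon> * (s * norm v)"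
      using b1 b2 Hs unfolding real_norm_def by linarith
    also have "\<dots> = \<epsilon> * s * (norm v + (norm v + norm w))" by (simp add: algebra_simps)
    also have "\<dots> < \<epsilon> * s * c" using \<epsilon> s c by (intro mult_strict_left_mono) auto
    also have "\<dots> = e * s" using c by (simp add: \<epsilon>_def)
    finally have b: "\<bar>?h (u + r *\<^sub>R v + s *\<^sub>R w) - ?h (u + r *\<^sub>R v) - s * H w\<bar> < e * s" .
    have "(f (u + s *\<^sub>R v + s *\<^sub>R w) - f (u + s *\<^sub>R v) - f (u + s *\<^sub>R w) + f u) / s\<^sup>2 - H w
      = (?h (u + r *\<^sub>R v + s *\<^sub>R w) - ?h (u + r *\<^sub>R v) - s * H w) / s"
    proof -
      have "f (u + s *\<^sub>R v + s *\<^sub>R w) - f (u + s *\<^sub>R v) - f (u + s *\<^sub>R w) + f u = \<phi> s - \<phi> 0"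
        by (simp add: \<phi>_def)
      then have "f (u + s *\<^sub>R v + s *\<^sub>R w) - f (u + s *\<^sub>R v) - f (u + s *\<^sub>R w) + f u
          = s * (?h (u + r *\<^sub>R v + s *\<^sub>R w) - ?h (u + r *\<^sub>R v))"
        by (simp only: r(3))
      moreover have "(s * q) / s\<^sup>2 - h = (q - s * h) / s" for q h :: real
        using s(1) by (simp add: field_simps power2_eq_square)
      ultimately show ?thesis by (simp only:)
    qed
    then show ?case
      using b s(1) by (simp add: dist_real_def abs_divide pos_divide_less_eq)
  qed
qed

lemma frechet_derivative_symmetric:
  fixes f :: "'a::real_normed_vector \<Rightarrow> 'b::euclidean_space"
  assumes S: "open S" "u \<in> S" and f: "smooth_on f S"
  shows "frechet_derivative (\<lambda>x. frechet_derivative f (at x) v) (at u) w =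
    frechet_derivative (\<lambda>x. frechet_derivative f (at x) w) (at u) v"
proof (rule euclidean_eqI)
  fix b :: 'b assume "b \<in> Basis"
  let ?D = "\<lambda>x. frechet_derivative f (at x)"
  let ?H = "\<lambda>v. frechet_derivative (\<lambda>x. ?D x v) (at u)"
  \<comment> \<open>Components are taken because \<open>second_difference_limit\<close> rests on the
    mean value theorem for real functions.\<close>
  note inn = bounded_linear.has_derivative [OF bounded_linear_inner_left, of _ _ _ b]
  have 1: "((\<lambda>x. f x \<bullet> b) has_derivative (\<lambda>v. ?D x v \<bullet> b)) (at x)" if "x \<in> S" for x
    by (rule inn [OF smooth_on_has_derivative [OF f that]])
  have 2: "((\<lambda>x. ?D x v \<bullet> b) has_derivative (\<lambda>w. ?H v w \<bullet> b)) (at u)" for v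
    by (rule inn [OF smooth_on_has_derivative [OF smooth_on_frechet_derivative [OF S(1) f] S(2)]])
  let ?q = "\<lambda>v w s. (f (u + s *\<^sub>R v + s *\<^sub>R w) \<bullet> b - f (u + s *\<^sub>R v) \<bullet> b - f (u + s *\<^sub>R w) \<bullet> b + f u \<bullet> b) / s\<^sup>2"
  have lim: "(?q v w \<longlongrightarrow> ?H v w \<bullet> b) (at_right 0)" for v w
    by (rule second_difference_limit [OF S 1 2])
  have "?q w v = ?q v w" by (rule ext) (simp add: ac_simps)
  with lim [of w v] have "(?q v w \<longlongrightarrow> ?H w v \<bullet> b) (at_right 0)" by (simp only:)
  then show "?H v w \<bullet> b = ?H w v \<bullet> b"
    by (rule tendsto_unique [OF trivial_limit_at_right_real lim])
qed

lemma has_derivative_matrixI: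
  fixes F :: "'a::real_normed_vector \<Rightarrow> real^'m^'n"
  assumes "\<And>i j. ((\<lambda>u. F u $ i $ j) has_derivative (\<lambda>v. F' v $ i $ j)) (at x)"
  shows "(F has_derivative F') (at x)"
proof (subst has_derivative_componentwise_within, intro ballI)
  fix b :: "real^'m^'n" assume "b \<in> Basis"
  then obtain i j where "b = axis i (axis j 1)"
    by (auto simp: Basis_vec_def)
  then show "((\<lambda>u. F u \<bullet> b) has_derivative (\<lambda>v. F' v \<bullet> b)) (at x)"
    using assms [of i j] by (simp add: inner_axis)
qed

section \<open>Charts and differentials\<close>

lemma matrix_linear_works: "linear f \<Longrightarrow> matrix f *v x = f x"
  for f :: "real^'m \<Rightarrow> real^'n"
  by (simp add: matrix_works linear_matrix_vector_mul_eq)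

text \<open>\<open>fn_deriv\<close> is total and says nothing about differentiability; this relation
  carries both the existence and the value of the derivative in the preferred chart at
  \<open>x\<close>.\<close>

definition has_mderiv ::
  "('x, 'm::finite) atlas \<Rightarrow> ('x \<Rightarrow> 'b::real_normed_vector) \<Rightarrow> (real^'m \<Rightarrow> 'b) \<Rightarrow> 'x \<Rightarrow> bool" where
  "has_mderiv A F D x \<longleftrightarrow>
     ((F \<circ> chart_inv (chart_at A x)) has_derivative D) (at (snd (chart_at A x) x))"

lemma has_mderiv_fn_deriv: "has_mderiv A F D x \<Longrightarrow> fn_deriv A F x = D"
  unfolding has_mderiv_def fn_deriv_def by (metis frechet_derivative_at)

lemma has_mderiv_linear: "has_mderiv A F D x \<Longrightarrow> linear D"
  unfolding has_mderiv_def by (rule has_derivative_linear)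

lemma has_mderiv_const: "has_mderiv A (\<lambda>z. c) (\<lambda>h. 0) x"
  by (simp add: has_mderiv_def o_def)

lemma has_mderiv_add:
  "has_mderiv A F D x \<Longrightarrow> has_mderiv A F' D' x \<Longrightarrow> has_mderiv A (\<lambda>z. F z + F' z) (\<lambda>h. D h + D' h) x"
  unfolding has_mderiv_def o_def by (rule has_derivative_add)

lemma has_mderiv_bounded_linear:
  "bounded_linear l \<Longrightarrow> has_mderiv A F D x \<Longrightarrow> has_mderiv A (\<lambda>z. l (F z)) (\<lambda>h. l (D h)) x"
  unfolding has_mderiv_def o_def by (rule bounded_linear.has_derivative)

lemmas has_mderiv_minus = has_mderiv_bounded_linear [OF bounded_linear_minus [OF bounded_linear_ident]]

lemma (in oriented_manifold) chart_at: "chart_at A x \<in> A" "x \<in> fst (chart_at A x)"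
proof -
  have "\<exists>C. C \<in> A \<and> x \<in> fst C" using charts_cover by blast
  from someI_ex [OF this] show "chart_at A x \<in> A" "x \<in> fst (chart_at A x)"
    by (simp_all add: chart_at_def)
qed

lemma (in oriented_manifold) chart:
  assumes "C \<in> A"
  shows open_chart: "open (fst C)" and open_chart_image: "open (snd C ` fst C)"
    and continuous_chart: "continuous_on (fst C) (snd C)"
    and continuous_chart_inv: "continuous_on (snd C ` fst C) (chart_inv C)"
    and chart_inv_chart [simp]: "z \<in> fst C \<Longrightarrow> chart_inv C (snd C z) = z"
    and chart_chart_inv [simp]: "u \<in> snd C ` fst C \<Longrightarrow> snd C (chart_inv C u) = u"
  using charts_homeomorphic [OF assms] by (auto simp: homeomorphism_def)

lemma (in oriented_manifold) open_chart_at: "open (fst (chart_at A x))"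
  using open_chart chart_at by blast

lemma (in oriented_manifold) open_chart_image_Int:
  assumes "C \<in> A" "open U"
  shows "open (snd C ` (fst C \<inter> U))"
proof -
  have "snd C ` (fst C \<inter> U) = chart_inv C -` U \<inter> snd C ` fst C"
    using assms(1) by force
  then show ?thesis
    using continuous_open_preimage [OF continuous_chart_inv [OF assms(1)] open_chart_image [OF assms(1)] assms(2)]
    by (simp add: Int_commute)
qed

lemma (in oriented_manifold) tendsto_chart_inv:
  assumes "C \<in> A" "z \<in> fst C"
  shows "(chart_inv C \<longlongrightarrow> z) (nhds (snd C z))"
proof -
  have "isCont (chart_inv C) (snd C z)"
    using continuous_chart_inv [OF assms(1)] open_chart_image [OF assms(1)] assms(2)
    by (simp add: continuous_on_eq_continuous_at)
  then show ?thesis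
    using assms by (simp add: continuous_at tendsto_nhds_iff)
qed

lemma (in oriented_manifold) tendsto_chart:
  assumes "C \<in> A" "z \<in> fst C"
  shows "(snd C \<longlongrightarrow> snd C z) (nhds z)"
proof -
  have "isCont (snd C) z"
    using continuous_chart [OF assms(1)] open_chart [OF assms(1)] assms(2)
    by (simp add: continuous_on_eq_continuous_at)
  then show ?thesis
    by (simp add: continuous_at tendsto_nhds_iff)
qed

lemma (in oriented_manifold) eventually_chart_inv:
  assumes "C \<in> A" "z \<in> fst C" "\<forall>\<^sub>F z' in nhds z. P z'"
  shows "\<forall>\<^sub>F u in nhds (snd C z). P (chart_inv C u)"
  using eventually_compose_filterlim [OF assms(3) tendsto_chart_inv [OF assms(1,2)]] .

lemma (in oriented_manifold) eventually_chart_at: "\<forall>\<^sub>F z in nhds x. z \<in> fst (chart_at A x)"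
  by (rule eventually_nhds_in_open [OF open_chart_at chart_at(2)])

lemma (in oriented_manifold) has_mderiv_cong:
  assumes "\<forall>\<^sub>F z in nhds x. F z = H z" "has_mderiv A F D x"
  shows "has_mderiv A H D x"
proof -
  let ?C = "chart_at A x"
  have ev: "\<forall>\<^sub>F u in nhds (snd ?C x). F (chart_inv ?C u) = H (chart_inv ?C u)"
    using eventually_chart_inv [OF chart_at assms(1)] .
  show ?thesis
    unfolding has_mderiv_def
  proof (rule has_derivative_transform_eventually [OF assms(2) [unfolded has_mderiv_def]])
    show "\<forall>\<^sub>F u in at (snd ?C x). (F \<circ> chart_inv ?C) u = (H \<circ> chart_inv ?C) u"
      using ev by (simp add: eventually_nhds_conv_at)
    show "(F \<circ> chart_inv ?C) (snd ?C x) = (H \<circ> chart_inv ?C) (snd ?C x)"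
      using eventually_nhds_x_imp_x [OF ev] by simp
  qed simp
qed

lemma (in oriented_manifold) smooth_fn_has_mderiv:
  assumes "open U" "x \<in> U" "smooth_fn A U F"
  shows "has_mderiv A F (fn_deriv A F x) x"
proof -
  have "smooth_on (F \<circ> chart_inv (chart_at A x)) (snd (chart_at A x) ` (fst (chart_at A x) \<inter> U))"
    using assms(3) chart_at(1) by (simp add: smooth_fn_def)
  then show ?thesis
    unfolding has_mderiv_def fn_deriv_def
    by (rule smooth_on_has_derivative [THEN has_derivative_eq_rhs]) (use assms(2) chart_at(2) in \<open>auto\<close>)
qed

lemma (in oriented_manifold) jac_has_derivative:
  assumes "C \<in> A" "C' \<in> A" "z \<in> fst C" "z \<in> fst C'"
  shows "((snd C' \<circ> chart_inv C) has_derivative ((*v) (jac C C' z))) (at (snd C z))"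
proof -
  let ?D = "frechet_derivative (snd C' \<circ> chart_inv C) (at (snd C z))"
  have d: "((snd C' \<circ> chart_inv C) has_derivative ?D) (at (snd C z))"
    using smooth_on_has_derivative [OF transitions_smooth [OF assms(1,2)]] assms by blast
  have "(*v) (matrix ?D) = ?D"
    by (rule ext) (rule matrix_linear_works [OF has_derivative_linear [OF d]])
  with d show ?thesis
    by (simp only: jac_def)
qed

lemma (in oriented_manifold) jac_compose:
  assumes C: "C \<in> A" "C' \<in> A" "C'' \<in> A" and z: "z \<in> fst C" "z \<in> fst C'" "z \<in> fst C''"
  shows "jac C' C'' z ** jac C C' z = jac C C'' z"
proof -
  have "((snd C' \<circ> chart_inv C) has_derivative ((*v) (jac C C' z))) (at (snd C z))"
    using C z by (intro jac_has_derivative)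
  moreover have "((snd C'' \<circ> chart_inv C') has_derivative ((*v) (jac C' C'' z))) (at ((snd C' \<circ> chart_inv C) (snd C z)))"
    using jac_has_derivative [OF C(2,3) z(2,3)] C z by simp
  ultimately have d: "((snd C'' \<circ> chart_inv C') \<circ> (snd C' \<circ> chart_inv C) has_derivative ((*v) (jac C' C'' z)) \<circ> ((*v) (jac C C' z))) (at (snd C z))"
    by (rule diff_chain_at)
  have "\<forall>\<^sub>F z' in nhds z. z' \<in> fst C' \<inter> fst C"
    by (rule eventually_nhds_in_open) (simp_all add: open_Int open_chart C z)
  then have ev: "\<forall>\<^sub>F u in nhds (snd C z). chart_inv C u \<in> fst C' \<inter> fst C"
    by (rule eventually_chart_inv [OF C(1) z(1)])
  then have ev': "\<forall>\<^sub>F u in at (snd C z). ((snd C'' \<circ> chart_inv C') \<circ> (snd C' \<circ> chart_inv C)) u = (snd C'' \<circ> chart_inv C) u"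
    unfolding eventually_nhds_conv_at by (auto elim!: eventually_mono simp: C)
  have "((snd C'' \<circ> chart_inv C) has_derivative ((*v) (jac C' C'' z)) \<circ> ((*v) (jac C C' z))) (at (snd C z))"
    by (rule has_derivative_transform_eventually [OF d ev']) (use C z in \<open>simp_all\<close>)
  then have "((*v) (jac C' C'' z)) \<circ> ((*v) (jac C C' z)) = ((*v) (jac C C'' z))"
    using jac_has_derivative [OF C(1,3) z(1,3)] by (rule has_derivative_unique)
  then show ?thesis
    by (simp add: matrix_eq fun_eq_iff matrix_vector_mul_assoc)
qed

lemma (in oriented_manifold) jac_same:
  assumes "C \<in> A" "z \<in> fst C"
  shows "jac C C z = mat 1"
proof -
  have "\<forall>\<^sub>F u in nhds (snd C z). u \<in> snd C ` fst C"
    by (rule eventually_nhds_in_open) (use open_chart_image assms in \<open>auto\<close>)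
  then have ev: "\<forall>\<^sub>F u in at (snd C z). u = (snd C \<circ> chart_inv C) u"
    unfolding eventually_nhds_conv_at by (auto elim!: eventually_mono simp: assms)
  have "((snd C \<circ> chart_inv C) has_derivative (\<lambda>v. v)) (at (snd C z))"
    by (rule has_derivative_transform_eventually [OF has_derivative_ident ev]) (use assms in \<open>simp_all\<close>)
  then have "(\<lambda>v. v) = ((*v) (jac C C z))"
    using jac_has_derivative [OF assms(1,1) assms(2,2)] by (rule has_derivative_unique)
  then show ?thesis
    by (simp add: matrix_eq fun_eq_iff)
qed

lemma (in oriented_manifold) to_at_from_at:
  assumes "z \<in> fst (chart_at A x)"
  shows "to_at A x z ** from_at A x z = mat 1" "from_at A x z ** to_at A x z = mat 1"
    "det (to_at A x z) > 0" "det (from_at A x z) > 0"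
  unfolding to_at_def from_at_def
  using assms chart_at by (auto simp: jac_compose jac_same intro!: transitions_oriented)

lemma (in oriented_manifold) to_at_self [simp]: "to_at A x x = mat 1" "from_at A x x = mat 1"
  unfolding to_at_def from_at_def by (simp_all add: jac_same chart_at)

text \<open>Seen from another chart, the components are the derivative of a transition map in the
  fixed direction \<open>w\<close>, hence smooth.\<close>

lemma (in oriented_manifold) smooth_field_const_field:
  "smooth_field A (fst (chart_at A x)) (const_field A x w)"
  unfolding smooth_field_def smooth_fn_def
proof (intro allI ballI)
  fix x' C assume C: "C \<in> A"
  let ?D = "chart_at A x" and ?D' = "chart_at A x'"
  let ?f = "\<lambda>u. frechet_derivative (snd ?D' \<circ> chart_inv ?D) (at u) w"
  have sm: "smooth_on ?f (snd ?D ` (fst ?D \<inter> fst ?D'))"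
    using transitions_smooth chart_at open_chart_image_Int [OF chart_at(1) open_chart_at]
    by (intro smooth_on_frechet_derivative) auto
  have "smooth_on (\<lambda>u. ?f ((snd ?D \<circ> chart_inv C) u)) (snd C ` (fst C \<inter> (fst ?D \<inter> fst ?D')))"
    by (rule smooth_on_compose [OF smooth_on_subset [OF transitions_smooth [OF C chart_at(1)]] sm])
      (auto simp: C)
  moreover have "open (snd C ` (fst C \<inter> (fst ?D \<inter> fst ?D')))"
    by (intro open_chart_image_Int C open_Int open_chart_at)
  moreover have "?f ((snd ?D \<circ> chart_inv C) u) = ((\<lambda>z. to_at A x' z *v const_field A x w z) \<circ> chart_inv C) u"
    if "u \<in> snd C ` (fst C \<inter> (fst ?D \<inter> fst ?D'))" for u
  proof -
    obtain z where z: "u = snd C z" "z \<in> fst C" "z \<in> fst ?D" "z \<in> fst ?D'" using \<open>u \<in> _\<close> by auto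
    have "to_at A x' z ** from_at A x z = jac ?D ?D' z"
      unfolding to_at_def from_at_def by (rule jac_compose) (use z chart_at in \<open>auto\<close>)
    then have "to_at A x' z *v const_field A x w z = jac ?D ?D' z *v w"
      by (simp add: const_field_def matrix_vector_mul_assoc)
    moreover have "jac ?D ?D' z *v w = ?f (snd ?D z)"
      using frechet_derivative_at [OF jac_has_derivative [OF chart_at(1) chart_at(1) z(3,4)]] by simp
    ultimately show ?thesis using z C by simp
  qed
  ultimately show "smooth_on ((\<lambda>z. to_at A x' z *v const_field A x w z) \<circ> chart_inv C)
      (snd C ` (fst C \<inter> (fst ?D \<inter> fst ?D')))"
    by (rule smooth_on_cong [rotated 2])
qed

lemma (in oriented_manifold) velocity_compose:
  assumes "mfd_velocity A c X" "c 0 = x" "has_mderiv A F D x"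
  shows "((\<lambda>t. F (c t)) has_vector_derivative D X) (at 0)"
proof -
  let ?C = "chart_at A x"
  have c: "isCont c 0" "((\<lambda>t. snd ?C (c t)) has_vector_derivative X) (at 0)"
    using assms by (auto simp: mfd_velocity_def)
  have "((F \<circ> chart_inv ?C) \<circ> (\<lambda>t. snd ?C (c t)) has_derivative D \<circ> (\<lambda>t. t *\<^sub>R X)) (at 0)"
    by (rule diff_chain_at) (use c(2) assms(2,3) in \<open>auto simp: has_vector_derivative_def has_mderiv_def\<close>)
  moreover have "D \<circ> (\<lambda>t. t *\<^sub>R X) = (\<lambda>t. t *\<^sub>R D X)"
    using linear_scale [OF has_mderiv_linear [OF assms(3)]] by (simp add: fun_eq_iff)
  ultimately have d: "((\<lambda>t. F (chart_inv ?C (snd ?C (c t)))) has_vector_derivative D X) (at 0)"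
    unfolding has_vector_derivative_def by (simp add: o_def)
  have "\<forall>\<^sub>F t in at 0. c t \<in> fst ?C"
    using c(1) assms(2) topological_tendstoD [of c x "at 0" "fst ?C"] open_chart_at chart_at(2)
    by (simp add: continuous_at)
  then have "\<forall>\<^sub>F t in at 0. F (chart_inv ?C (snd ?C (c t))) = F (c t)"
    by eventually_elim (simp add: chart_at)
  from has_derivative_transform_eventually [OF d [unfolded has_vector_derivative_def] this]
  show ?thesis
    unfolding has_vector_derivative_def by (simp add: assms(2) chart_at)
qed

lemma (in oriented_manifold) velocity_exists:
  obtains c where "c 0 = x" "mfd_velocity A c X"
proof -
  let ?C = "chart_at A x"
  let ?u = "\<lambda>t. snd ?C x + t *\<^sub>R X"
  \<comment> \<open>A straight line in the chart, replaced by the constant \<open>x\<close> where it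
    leaves the chart: a velocity at 0 sees only small \<open>t\<close>.\<close>
  define c where "c t = (if ?u t \<in> snd ?C ` fst ?C then chart_inv ?C (?u t) else x)" for t :: real
  have c0: "c 0 = x" using chart_at by (simp add: c_def)
  have "(?u \<longlongrightarrow> snd ?C x + 0 *\<^sub>R X) (at 0)"
    by (intro tendsto_intros)
  then have u0: "(?u \<longlongrightarrow> snd ?C x) (at 0)" by simp
  have ev: "\<forall>\<^sub>F t in at 0. ?u t \<in> snd ?C ` fst ?C"
    using topological_tendstoD [OF u0 open_chart_image [OF chart_at(1)]] chart_at(2) by blast
  then have evc: "\<forall>\<^sub>F t in at 0. chart_inv ?C (?u t) = c t"
    by eventually_elim (simp add: c_def)
  have "((\<lambda>t. chart_inv ?C (?u t)) \<longlongrightarrow> x) (at 0)"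
    by (rule filterlim_compose [OF tendsto_chart_inv [OF chart_at] u0])
  then have "isCont c 0"
    unfolding continuous_at c0 using tendsto_cong [OF evc] by blast
  moreover have "((\<lambda>t. snd ?C (c t)) has_vector_derivative X) (at 0)"
  proof -
    have "(?u has_derivative (\<lambda>t. t *\<^sub>R X)) (at 0)"
      by (auto intro!: derivative_eq_intros)
    moreover have "\<forall>\<^sub>F t in at 0. ?u t = snd ?C (c t)"
      using ev by eventually_elim (simp add: c_def chart_at)
    ultimately show ?thesis
      unfolding has_vector_derivative_def
      by (rule has_derivative_transform_eventually) (simp_all add: c0)
  qed
  ultimately show thesis
    using that [of c] c0 by (simp add: mfd_velocity_def)
qed

lemma (in oriented_manifold) velocity_const: "mfd_velocity A (\<lambda>t. x) 0"
  by (simp add: mfd_velocity_def)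

section \<open>Smooth maps between manifolds\<close>

locale smooth_mfd_map = dom: oriented_manifold A + cod: oriented_manifold B
  for A :: "('x::{t2_space,second_countable_topology}, 'm::finite) atlas"
    and B :: "('y::{t2_space,second_countable_topology}, 'n::finite) atlas" +
  fixes f :: "'x \<Rightarrow> 'y"
  assumes smooth_map: "smooth_map A B f"
begin

lemma continuous_map: "continuous_on UNIV f"
  using smooth_map by (simp add: smooth_map_def)

lemma tendsto_map: "(f \<longlongrightarrow> f x) (nhds x)"
  using continuous_map by (simp add: continuous_on_eq_continuous_at continuous_at tendsto_nhds_iff)

lemma eventually_map_chart: "\<forall>\<^sub>F z in nhds x. f z \<in> fst (chart_at B (f x))"
  using topological_tendstoD [OF tendsto_map cod.open_chart_at cod.chart_at(2)] .

lemma open_map_chart: "open (f -` fst (chart_at B y))"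
  using continuous_map cod.open_chart_at by (simp add: continuous_on_open_vimage)

abbreviation "local_rep x \<equiv> snd (chart_at B (f x)) \<circ> f \<circ> chart_inv (chart_at A x)"
abbreviation "local_dom x \<equiv> snd (chart_at A x) ` (fst (chart_at A x) \<inter> f -` fst (chart_at B (f x)))"

lemma local_rep_smooth: "smooth_on (local_rep x) (local_dom x)"
  using smooth_map cod.chart_at(1) dom.chart_at(1) unfolding smooth_map_def smooth_fn_def by blast

lemma open_local_dom: "open (local_dom x)"
  by (intro dom.open_chart_image_Int dom.chart_at open_map_chart)

lemma mfd_deriv_has_mderiv: "has_mderiv A (snd (chart_at B (f x)) \<circ> f) (mfd_deriv A B f x) x"
proof -
  have "smooth_fn A (f -` fst (chart_at B (f x))) (snd (chart_at B (f x)) \<circ> f)"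
    using smooth_map cod.chart_at(1) unfolding smooth_map_def by blast
  from dom.smooth_fn_has_mderiv [OF open_map_chart _ this, of x]
  show ?thesis unfolding mfd_deriv_def using cod.chart_at(2) by simp
qed

lemma mfd_deriv_linear: "linear (mfd_deriv A B f x)"
  by (rule has_mderiv_linear [OF mfd_deriv_has_mderiv])

lemma has_mderiv_compose:
  assumes "has_mderiv B H D (f x)"
  shows "has_mderiv A (\<lambda>z. H (f z)) (\<lambda>X. D (mfd_deriv A B f x X)) x"
proof -
  let ?C = "chart_at B (f x)"
  have "((H \<circ> chart_inv ?C) \<circ> local_rep x has_derivative D \<circ> mfd_deriv A B f x) (at (snd (chart_at A x) x))"
    by (rule diff_chain_at)
      (use mfd_deriv_has_mderiv [of x] assms dom.chart_at in \<open>simp_all add: has_mderiv_def\<close>)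
  then have "has_mderiv A (\<lambda>z. H (chart_inv ?C (snd ?C (f z)))) (\<lambda>X. D (mfd_deriv A B f x X)) x"
    by (simp add: has_mderiv_def o_def)
  moreover have "\<forall>\<^sub>F z in nhds x. H (chart_inv ?C (snd ?C (f z))) = H (f z)"
    using eventually_map_chart by eventually_elim (simp add: cod.chart_at)
  ultimately show ?thesis
    by (rule dom.has_mderiv_cong [rotated])
qed

lemma velocity_map:
  assumes "mfd_velocity A c X" "c 0 = x"
  shows "mfd_velocity B (f \<circ> c) (mfd_deriv A B f x X)"
  unfolding mfd_velocity_def
proof
  have "isCont f (c 0)" using continuous_map by (simp add: continuous_on_eq_continuous_at)
  then show "isCont (f \<circ> c) 0"
    using assms(1) unfolding mfd_velocity_def by (intro continuous_at_compose) auto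
  show "((\<lambda>t. snd (chart_at B ((f \<circ> c) 0)) ((f \<circ> c) t)) has_vector_derivative mfd_deriv A B f x X) (at 0)"
    using dom.velocity_compose [OF assms mfd_deriv_has_mderiv] assms(2) by simp
qed

text \<open>The differential at \<open>z\<close>, expressed in the preferred charts at
  \<open>x\<close> and \<open>f x\<close>. The preferred charts at \<open>z\<close> may jump with
  \<open>z\<close>, so \<open>matrix (mfd_deriv A B f z)\<close> itself is no object to
  differentiate in \<open>z\<close>.\<close>

definition deriv_matrix :: "'x \<Rightarrow> 'x \<Rightarrow> real^'m^'n" where
  "deriv_matrix x z = to_at B (f x) (f z) ** matrix (mfd_deriv A B f z) ** from_at A x z"

lemma deriv_matrix_self: "deriv_matrix x x = matrix (mfd_deriv A B f x)"
  by (simp add: deriv_matrix_def)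

lemma deriv_matrix_self_apply: "deriv_matrix x x *v v = mfd_deriv A B f x v"
  by (simp add: deriv_matrix_self matrix_linear_works mfd_deriv_linear)

lemma deriv_matrix_apply:
  "deriv_matrix x z *v w = to_at B (f x) (f z) *v mfd_deriv A B f z (from_at A x z *v w)"
  by (simp add: deriv_matrix_def matrix_vector_mul_assoc [symmetric] matrix_linear_works mfd_deriv_linear)

text \<open>Chain rule: near \<open>z\<close> the representative \<open>local_rep x\<close> is
  \<open>local_rep z\<close> between two changes of coordinates.\<close>

lemma deriv_matrix_frechet:
  assumes z: "z \<in> fst (chart_at A x)" "f z \<in> fst (chart_at B (f x))"
  shows "frechet_derivative (local_rep x) (at (snd (chart_at A x) z)) w = deriv_matrix x z *v w"
proof -
  let ?C = "chart_at A x" and ?D = "chart_at A z" and ?C' = "chart_at B (f x)" and ?D' = "chart_at B (f z)"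
  have 1: "((snd ?D \<circ> chart_inv ?C) has_derivative ((*v) (from_at A x z))) (at (snd ?C z))"
    unfolding from_at_def by (intro dom.jac_has_derivative dom.chart_at z)
  have 2: "(local_rep z has_derivative mfd_deriv A B f z) (at ((snd ?D \<circ> chart_inv ?C) (snd ?C z)))"
    using mfd_deriv_has_mderiv [of z] z by (simp add: has_mderiv_def dom.chart_at)
  have 3: "((snd ?C' \<circ> chart_inv ?D') has_derivative ((*v) (to_at B (f x) (f z))))
      (at ((local_rep z \<circ> (snd ?D \<circ> chart_inv ?C)) (snd ?C z)))"
    using cod.jac_has_derivative [OF cod.chart_at(1) cod.chart_at(1) cod.chart_at(2) z(2)] z
    by (simp add: to_at_def dom.chart_at)
  have d: "((snd ?C' \<circ> chart_inv ?D') \<circ> (local_rep z \<circ> (snd ?D \<circ> chart_inv ?C)) has_derivative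
      (*v) (to_at B (f x) (f z)) \<circ> (mfd_deriv A B f z \<circ> (*v) (from_at A x z))) (at (snd ?C z))"
    by (intro diff_chain_at 1 2 3)
  have "\<forall>\<^sub>F z' in nhds z. z' \<in> fst ?C \<inter> (fst ?D \<inter> f -` fst ?D')"
    by (rule eventually_nhds_in_open)
      (use z open_map_chart dom.open_chart_at dom.chart_at cod.chart_at in \<open>auto\<close>)
  from dom.eventually_chart_inv [OF dom.chart_at(1) z(1) this]
  have ev: "\<forall>\<^sub>F u in at (snd ?C z).
      ((snd ?C' \<circ> chart_inv ?D') \<circ> (local_rep z \<circ> (snd ?D \<circ> chart_inv ?C))) u = local_rep x u"
    unfolding eventually_nhds_conv_at
    by (auto elim!: eventually_mono simp: dom.chart_at cod.chart_at)
  have "(local_rep x has_derivative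
      (*v) (to_at B (f x) (f z)) \<circ> (mfd_deriv A B f z \<circ> (*v) (from_at A x z))) (at (snd ?C z))"
    by (rule has_derivative_transform_eventually [OF d ev])
      (use z in \<open>simp_all add: dom.chart_at cod.chart_at\<close>)
  from frechet_derivative_at [OF this] show ?thesis
    by (metis comp_apply deriv_matrix_apply)
qed

text \<open>The Hessian in coordinates: the part of the second fundamental form that is free of
  Christoffel terms.\<close>

definition second_deriv :: "'x \<Rightarrow> real^'m \<Rightarrow> real^'m \<Rightarrow> real^'n" where
  "second_deriv x v w =
     frechet_derivative (\<lambda>u. frechet_derivative (local_rep x) (at u) w) (at (snd (chart_at A x) x)) v"

lemma second_deriv_symmetric: "second_deriv x v w = second_deriv x w v"
  unfolding second_deriv_def
  by (rule frechet_derivative_symmetric [OF open_local_dom _ local_rep_smooth])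
    (use dom.chart_at cod.chart_at in \<open>auto\<close>)

lemma deriv_matrix_apply_has_mderiv:
  "has_mderiv A (\<lambda>z. deriv_matrix x z *v w) (\<lambda>v. second_deriv x v w) x"
proof -
  let ?C = "chart_at A x"
  let ?F = "\<lambda>u. frechet_derivative (local_rep x) (at u) w"
  have x: "snd ?C x \<in> local_dom x" using dom.chart_at cod.chart_at by blast
  have d: "(?F has_derivative (\<lambda>v. second_deriv x v w)) (at (snd ?C x))"
    unfolding second_deriv_def
    by (rule smooth_on_has_derivative [OF smooth_on_frechet_derivative [OF open_local_dom local_rep_smooth] x])
  have "\<forall>\<^sub>F u in nhds (snd ?C x). u \<in> local_dom x"
    by (rule eventually_nhds_in_open [OF open_local_dom x])
  then have ev: "\<forall>\<^sub>F u in nhds (snd ?C x). ?F u = ((\<lambda>z. deriv_matrix x z *v w) \<circ> chart_inv ?C) u"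
  proof eventually_elim
    case (elim u)
    then obtain z where "u = snd ?C z" "z \<in> fst ?C" "f z \<in> fst (chart_at B (f x))" by blast
    then show ?case using deriv_matrix_frechet by (simp add: dom.chart_at)
  qed
  show ?thesis
    unfolding has_mderiv_def
    by (rule has_derivative_transform_eventually [OF d])
      (use ev eventually_nhds_x_imp_x [OF ev] in \<open>simp_all add: eventually_nhds_conv_at\<close>)
qed

lemma second_deriv_linear: "linear (\<lambda>v. second_deriv x v w)"
  by (rule has_mderiv_linear [OF deriv_matrix_apply_has_mderiv])

lemma second_deriv_linear_right: "linear (second_deriv x v)"
  using second_deriv_linear [of x v] second_deriv_symmetric by (simp add: linear_iff)

lemma deriv_matrix_has_mderiv:
  "has_mderiv A (deriv_matrix x) (\<lambda>v. matrix (second_deriv x v)) x"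
proof -
  have "((\<lambda>u. (deriv_matrix x \<circ> chart_inv (chart_at A x)) u $ i $ j) has_derivative
      (\<lambda>v. matrix (second_deriv x v) $ i $ j)) (at (snd (chart_at A x) x))" for i j
    using bounded_linear.has_derivative [OF bounded_linear_vec_nth
        deriv_matrix_apply_has_mderiv [of x "axis j 1", unfolded has_mderiv_def], of i]
    by (simp add: matrix_def o_def matrix_vector_mult_basis column_def)
  then show ?thesis
    unfolding has_mderiv_def by (rule has_derivative_matrixI)
qed

end

section \<open>Weyl connections in charts\<close>

lemma (in oriented_manifold) smooth_map_id: "smooth_map A A id"
  unfolding smooth_map_def smooth_fn_def by (simp add: continuous_on_id' transitions_smooth)

lemma (in oriented_manifold) mfd_deriv_id [simp]: "mfd_deriv A A id x = (\<lambda>v. v)"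
proof -
  let ?C = "chart_at A x"
  have "((snd ?C \<circ> chart_inv ?C) has_derivative ((*v) (jac ?C ?C x))) (at (snd ?C x))"
    by (intro jac_has_derivative chart_at)
  from frechet_derivative_at [OF this] show ?thesis
    unfolding mfd_deriv_def fn_deriv_def by (simp add: jac_same chart_at fun_eq_iff)
qed

lemma (in oriented_manifold) smooth_mfd_map_id: "smooth_mfd_map A A id"
  by (intro smooth_mfd_map.intro smooth_mfd_map_axioms.intro smooth_map_id oriented_manifold_axioms)

lemma smooth_fn_const: "smooth_fn A U (\<lambda>x. r)"
  by (simp add: smooth_fn_def o_def smooth_on_const)

lemma bilinear_matrix:
  assumes "bilinear g"
  shows "g v w = v \<bullet> ((\<chi> i j. g (axis i 1) (axis j 1)) *v (w :: real^'n))"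
proof -
  have l: "linear (\<lambda>v. g v w)" for w using assms by (simp add: bilinear_def)
  have r: "linear (g v)" for v using assms by (simp add: bilinear_def)
  have "g v w = g (\<Sum>i\<in>UNIV. v $ i *\<^sub>R axis i 1) (\<Sum>j\<in>UNIV. w $ j *\<^sub>R axis j 1)"
    using basis_expansion [of v] basis_expansion [of w] by (simp only: scalar_mult_eq_scaleR)
  also have "\<dots> = (\<Sum>i\<in>UNIV. v $ i *\<^sub>R g (axis i 1) (\<Sum>j\<in>UNIV. w $ j *\<^sub>R axis j 1))"
    by (simp only: linear_sum [OF l] linear_scale [OF l])
  also have "\<dots> = (\<Sum>i\<in>UNIV. v $ i * (\<Sum>j\<in>UNIV. w $ j * g (axis i 1) (axis j 1)))"
    by (simp only: linear_sum [OF r] linear_scale [OF r] real_scaleR_def)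
  also have "\<dots> = v \<bullet> ((\<chi> i j. g (axis i 1) (axis j 1)) *v w)"
    by (simp add: inner_vec_def matrix_vector_mult_def mult.commute)
  finally show ?thesis .
qed

lemma matrix_entry: "A $ i $ j = axis i 1 \<bullet> (A *v (axis j 1 :: real^'n))"
  by (simp add: inner_axis' matrix_vector_mult_basis column_def)

lemma matrix_eq_inner:
  fixes A B :: "real^'n^'m"
  assumes "\<And>v w. v \<bullet> (A *v w) = v \<bullet> (B *v w)"
  shows "A = B"
  unfolding vec_eq_iff matrix_entry [of A] matrix_entry [of B] using assms by blast

context oriented_weyl_space
begin

lemma christoffel_linear_left: "linear (\<lambda>v. christoffel A D x v w)"
  unfolding christoffel_def
  by (rule linear_direction [OF open_chart_at chart_at(2) smooth_field_const_field])

lemma christoffel_linear_right: "linear (christoffel A D x v)"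
proof (rule linearI)
  note o = open_chart_at [of x] chart_at(2) [of x]
  fix a b :: "real^'m" and r :: real
  have "const_field A x (a + b) = (\<lambda>z. const_field A x a z + const_field A x b z)"
    by (simp add: const_field_def fun_eq_iff matrix_vector_right_distrib)
  then show "christoffel A D x v (a + b) = christoffel A D x v a + christoffel A D x v b"
    unfolding christoffel_def by (simp add: additive [OF o smooth_field_const_field smooth_field_const_field])
  have "const_field A x (r *\<^sub>R a) = (\<lambda>z. r *\<^sub>R const_field A x a z)"
    by (simp add: const_field_def fun_eq_iff matrix_vector_mult_scaleR)
  moreover have "fn_deriv A (\<lambda>z. r) x = (\<lambda>h. 0)"
    by (rule has_mderiv_fn_deriv [OF has_mderiv_const])
  ultimately show "christoffel A D x v (r *\<^sub>R a) = r *\<^sub>R christoffel A D x v a"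
    unfolding christoffel_def by (simp add: leibniz [OF o smooth_fn_const smooth_field_const_field])
qed

lemma const_field_self [simp]: "const_field A x w x = w"
  by (simp add: const_field_def)

text \<open>Coordinate fields have constant components in the chart at \<open>x\<close>, so their
  bracket vanishes at \<open>x\<close> and torsion-freeness becomes symmetry.\<close>

lemma christoffel_symmetric: "christoffel A D x v w = christoffel A D x w v"
proof -
  have "has_mderiv A (\<lambda>z. to_at A x z *v const_field A x a z) (\<lambda>h. 0) x" for a
  proof (rule has_mderiv_cong [OF _ has_mderiv_const])
    show "\<forall>\<^sub>F z in nhds x. a = to_at A x z *v const_field A x a z"
      using eventually_chart_at
      by eventually_elim (simp add: const_field_def matrix_vector_mul_assoc to_at_from_at)
  qed
  then have "fn_deriv A (\<lambda>z. to_at A x z *v const_field A x a z) x = (\<lambda>h. 0)" for a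
    by (rule has_mderiv_fn_deriv)
  then have "lie_bracket A (const_field A x v) (const_field A x w) x = 0"
    unfolding lie_bracket_def by simp
  moreover have "D x (const_field A x v x) (const_field A x w) - D x (const_field A x w x) (const_field A x v)
      = lie_bracket A (const_field A x v) (const_field A x w) x"
    using weyl_torsion_free [unfolded torsion_free_def] open_chart_at smooth_field_const_field chart_at(2)
    by blast
  ultimately show ?thesis
    by (simp add: christoffel_def)
qed

definition conn_matrix :: "'x \<Rightarrow> real^'m \<Rightarrow> real^'m^'m" where
  "conn_matrix x v = matrix (christoffel A D x v)"

lemma conn_matrix_apply: "conn_matrix x v *v w = christoffel A D x v w"
  by (simp add: conn_matrix_def matrix_linear_works christoffel_linear_right)

lemma conn_matrix_linear: "linear (conn_matrix x)"
  by (rule linearI)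
    (simp_all add: matrix_eq conn_matrix_apply matrix_vector_mult_add_rdistrib
      scaleR_matrix_vector_assoc [symmetric] linear_add [OF christoffel_linear_left]
      linear_scale [OF christoffel_linear_left])

text \<open>An arbitrary representative of \<open>c\<close>: orthogonality, isotropy and skewness
  are insensitive to the positive factors by which representatives differ.\<close>

definition metric :: "'x \<Rightarrow> real^'m \<Rightarrow> real^'m \<Rightarrow> real" where
  "metric = (SOME g. riemannian_metric A g \<and>
     c = {(\<lambda>x v w. l x * g x v w) |l. smooth_fn A UNIV l \<and> (\<forall>x. l x > 0)})"

lemma metric: "riemannian_metric A metric"
    "c = {(\<lambda>x v w. l x * metric x v w) |l. smooth_fn A UNIV l \<and> (\<forall>x. l x > 0)}"
  using someI_ex [OF conformal [unfolded conformal_structure_def]] by (simp_all add: metric_def)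

lemma in_conformal_class_iff:
  "g \<in> c \<longleftrightarrow> (\<exists>l. g = (\<lambda>x v w. l x * metric x v w) \<and> smooth_fn A UNIV l \<and> (\<forall>x. l x > 0))"
  using arg_cong [OF metric(2), of "\<lambda>S. g \<in> S"] by (simp only: mem_Collect_eq)

lemma metric_in: "metric \<in> c"
  unfolding in_conformal_class_iff
  using smooth_fn_const [of A UNIV "1::real"] by (intro exI [of _ "\<lambda>x. 1"]) simp

lemma conformal_factor:
  assumes "g \<in> c"
  shows "\<exists>l>0. \<forall>v w. g x v w = l * metric x v w"
proof -
  from assms obtain l where "g = (\<lambda>x v w. l x * metric x v w)" "\<forall>x. l x > 0"
    unfolding in_conformal_class_iff by blast
  then show ?thesis by (intro exI [of _ "l x"]) simp
qed

lemma metric_bilinear: "bilinear (metric x)"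
  and metric_sym: "metric x v w = metric x w v"
  and metric_pos: "v \<noteq> 0 \<Longrightarrow> metric x v v > 0"
  using metric(1) by (auto simp: riemannian_metric_def)

definition metric_matrix :: "'x \<Rightarrow> real^'m^'m" where
  "metric_matrix x = (\<chi> i j. metric x (axis i 1) (axis j 1))"

lemma metric_eq: "metric x v w = v \<bullet> (metric_matrix x *v w)"
  unfolding metric_matrix_def by (rule bilinear_matrix [OF metric_bilinear])

definition gram :: "'x \<Rightarrow> 'x \<Rightarrow> real^'m^'m" where
  "gram x z = transpose (from_at A x z) ** metric_matrix z ** from_at A x z"

lemma gram_self [simp]: "gram x x = metric_matrix x"
  by (simp add: gram_def transpose_mat)

lemma gram_apply: "v \<bullet> (gram x z *v w) = metric z (from_at A x z *v v) (from_at A x z *v w)"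
  by (simp only: gram_def metric_eq inner_matrix_vector_left matrix_vector_mul_assoc matrix_mul_assoc)

lemma metric_matrix_sym: "transpose (metric_matrix x) = metric_matrix x"
  by (simp add: transpose_def metric_matrix_def vec_eq_iff metric_sym)

lemma gram_sym: "transpose (gram x z) = gram x z"
  by (simp add: gram_def matrix_transpose_mul metric_matrix_sym matrix_mul_assoc)

lemma metric_matrix_invertible: "invertible (metric_matrix x)"
proof -
  have "v = 0" if "metric_matrix x *v v = 0" for v
    using that metric_pos [of v x] by (cases "v = 0") (simp_all add: metric_eq)
  then show ?thesis
    by (simp add: invertible_left_inverse matrix_left_invertible_ker)
qed

text \<open>The condition that \<open>D\<close> preserves \<open>c\<close>, evaluated on pairs of
  coordinate fields, gives the entries one by one. The form \<open>\<theta>\<close> belongs to the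
  chosen representative and disappears in \<open>orth_acs_deriv_iff\<close>.\<close>

lemma gram_has_mderiv:
  obtains \<theta> where "has_mderiv A (gram x)
    (\<lambda>v. transpose (conn_matrix x v) ** metric_matrix x + metric_matrix x ** conn_matrix x v
       + \<theta> v *\<^sub>R metric_matrix x) x"
proof -
  let ?X = "\<lambda>i. const_field A x (axis i 1)"
  obtain \<theta> where \<theta>: "\<forall>U Y Z. open U \<and> smooth_field A U Y \<and> smooth_field A U Z \<longrightarrow> (\<forall>y\<in>U. \<forall>v.
       fn_deriv A (\<lambda>z. metric z (Y z) (Z z)) y v - metric y (D y v Y) (Z y) - metric y (Y y) (D y v Z)
          = \<theta> y v * metric y (Y y) (Z y))"
    using bspec [OF weyl_preserves [unfolded preserves_conformal_def] metric_in] by (elim exE)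
  let ?D = "\<lambda>v. transpose (conn_matrix x v) ** metric_matrix x + metric_matrix x ** conn_matrix x v
       + \<theta> x v *\<^sub>R metric_matrix x"
  have "has_mderiv A (\<lambda>z. metric z (?X i z) (?X j z)) (\<lambda>v. ?D v $ i $ j) x" for i j
  proof -
    have "smooth_fn A (fst (chart_at A x)) (\<lambda>z. metric z (?X i z) (?X j z))"
      using metric(1) open_chart_at smooth_field_const_field unfolding riemannian_metric_def by blast
    from smooth_fn_has_mderiv [OF open_chart_at chart_at(2) this]
    have d: "has_mderiv A (\<lambda>z. metric z (?X i z) (?X j z)) (fn_deriv A (\<lambda>z. metric z (?X i z) (?X j z)) x) x" .
    have "fn_deriv A (\<lambda>z. metric z (?X i z) (?X j z)) x v = ?D v $ i $ j" for v
    proof -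
      have "fn_deriv A (\<lambda>z. metric z (?X i z) (?X j z)) x v
          = metric x (D x v (?X i)) (?X j x) + metric x (?X i x) (D x v (?X j)) + \<theta> x v * metric x (?X i x) (?X j x)"
        using \<theta> [rule_format, OF conjI [OF open_chart_at conjI [OF smooth_field_const_field smooth_field_const_field]] chart_at(2),
            of x "axis i 1" "axis j 1" v]
        by simp
      also have "\<dots> = ?D v $ i $ j"
        unfolding matrix_entry [of _ i j]
        by (simp add: matrix_vector_mult_add_rdistrib inner_add_right metric_eq christoffel_def [symmetric]
            conn_matrix_apply [symmetric] inner_matrix_vector_left matrix_vector_mul_assoc
            scaleR_matrix_vector_assoc [symmetric])
      finally show ?thesis .
    qed
    then have "fn_deriv A (\<lambda>z. metric z (?X i z) (?X j z)) x = (\<lambda>v. ?D v $ i $ j)" by (rule ext)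
    with d show ?thesis by (simp only:)
  qed
  moreover have "metric z (?X i z) (?X j z) = gram x z $ i $ j" for i j z
    unfolding matrix_entry [of _ i j] gram_apply const_field_def ..
  ultimately have "has_mderiv A (gram x) ?D x"
    unfolding has_mderiv_def by (intro has_derivative_matrixI) (simp add: o_def)
  then show thesis by (rule that)
qed

end

section \<open>Bundles of positive maximal isotropic spaces\<close>

text \<open>Dimension count: by positivity \<open>M\<close> is injective, so the vectors orthogonal
  to the image of \<open>T\<close> under \<open>M\<close> form a space of complementary dimension,
  and again by positivity it meets \<open>T\<close> only in 0.\<close>

lemma complement_exists:
  fixes M :: "real^'n^'n"
  assumes T: "subspace T" and pos: "\<And>v. v \<noteq> 0 \<Longrightarrow> v \<bullet> (M *v v) > 0"
  obtains w where "\<And>t. t \<in> T \<Longrightarrow> w \<bullet> (M *v t) = 0" "v - w \<in> T"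
proof -
  let ?f = "\<lambda>x. M *v x"
  let ?U = "{y \<in> UNIV. \<forall>x \<in> ?f ` T. orthogonal x y}"
  have inj: "inj ?f"
  proof (rule linear_injective_0 [THEN iffD2, rule_format])
    show "linear ?f" by (rule matrix_vector_mul_linear)
    show "x = 0" if "M *v x = 0" for x using pos [of x] that by (cases "x = 0") simp_all
  qed
  have U: "subspace ?U"
    by (auto simp: subspace_def orthogonal_def inner_add_right)
  have "dim ?U + dim (?f ` T) = dim (UNIV :: (real^'n) set)"
    by (rule dim_subspace_orthogonal_to_vectors)
      (simp_all add: linear_subspace_image [OF matrix_vector_mul_linear T])
  moreover have "dim (?f ` T) = dim T"
    by (rule dim_image_eq [OF matrix_vector_mul_linear]) (rule inj_on_subset [OF inj subset_UNIV])
  moreover have "T \<inter> ?U = {0}"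
  proof (intro equalityI subsetI)
    fix x assume x: "x \<in> T \<inter> ?U"
    then have "orthogonal (M *v x) x" by blast
    then have "x = 0" using pos [of x] by (cases "x = 0") (simp_all add: orthogonal_def inner_commute)
    then show "x \<in> {0}" by simp
  qed (use subspace_0 [OF T] subspace_0 [OF U] in \<open>simp\<close>)
  ultimately have "dim {x + y |x y. x \<in> T \<and> y \<in> ?U} = dim (UNIV :: (real^'n) set)"
    using dim_sums_Int [OF T U] by simp
  moreover have "subspace {x + y |x y. x \<in> T \<and> y \<in> ?U}"
    by (rule subspace_sums [OF T U])
  ultimately have "{x + y |x y. x \<in> T \<and> y \<in> ?U} = UNIV"
    by (intro subspace_dim_equal) simp_all
  then obtain x y where "v = x + y" "x \<in> T" "y \<in> ?U" by blast
  then show thesis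
    using that [of y] by (simp add: orthogonal_def inner_commute)
qed

lemma orth_acs_conj:
  assumes F: "F ** F' = mat 1" "F' ** F = mat 1" and K: "orth_acs M \<pi> K"
  shows "orth_acs (transpose F ** M ** F) (F' ** \<pi> ** F) (F' ** K ** F)"
proof -
  have m: "(F' ** X ** F) ** (F' ** Y ** F) = F' ** (X ** Y) ** F" for X Y
  proof -
    have "(F' ** X ** F) ** (F' ** Y ** F) = F' ** X ** (F ** F') ** Y ** F"
      by (simp only: matrix_mul_assoc)
    then show ?thesis by (simp add: F matrix_mul_assoc)
  qed
  have "transpose (F' ** K ** F) ** (transpose F ** M ** F)
      = transpose F ** (transpose K ** transpose (F ** F') ** M) ** F"
    by (simp only: matrix_transpose_mul matrix_mul_assoc)
  also have "\<dots> = - (transpose F ** (M ** K) ** F)"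
    using K by (simp add: F transpose_mat orth_acs_def skew_adjoint_def matrix_ring_simps)
  also have "transpose F ** (M ** K) ** F = transpose F ** M ** (F ** F') ** K ** F"
    by (simp add: F matrix_mul_assoc)
  also have "\<dots> = (transpose F ** M ** F) ** (F' ** K ** F)"
    by (simp only: matrix_mul_assoc)
  finally have "skew_adjoint (transpose F ** M ** F) (F' ** K ** F)"
    by (simp add: skew_adjoint_def)
  moreover have "F' ** (- \<pi>) ** F = - (F' ** \<pi> ** F)" by (simp add: matrix_ring_simps)
  ultimately show ?thesis
    using K unfolding orth_acs_def m by simp
qed

text \<open>Linear algebra in single fibres only; how the complement varies with the base point is
  restricted in \<open>weyl_bundle\<close>.\<close>

locale weyl_subbundle = smooth_mfd_map A B f + W: oriented_weyl_space B c D
  for A :: "('x::{t2_space,second_countable_topology}, 'm::finite) atlas"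
    and B :: "('y::{t2_space,second_countable_topology}, 'n::finite) atlas"
    and f :: "'x \<Rightarrow> 'y" and c D +
  fixes E :: "('x, 'm, 'y, 'n) obundle"
  assumes bundle_simps: "bbase E = A" "bambient E = B" "bfoot E = f" "bconf E = c" "bconn E = D"
    and subspace_compl: "subspace (bcompl E x)"
begin

definition fmetric :: "'x \<Rightarrow> real^'n^'n" where
  "fmetric x = W.metric_matrix (f x)"

definition pr :: "'x \<Rightarrow> real^'n^'n" where
  "pr x = matrix (proj E x)"

lemma fmetric_pos: "v \<noteq> 0 \<Longrightarrow> v \<bullet> (fmetric x *v v) > 0"
  using W.metric_pos by (simp add: fmetric_def W.metric_eq)

lemma fmetric_sym: "transpose (fmetric x) = fmetric x"
  by (simp add: fmetric_def W.metric_matrix_sym)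

lemma fmetric_commute: "v \<bullet> (fmetric x *v w) = w \<bullet> (fmetric x *v v)"
  using W.metric_sym by (simp add: fmetric_def W.metric_eq [symmetric])

lemma conf_iff: "(\<forall>g\<in>c. P (g (f x))) \<longleftrightarrow> P (W.metric (f x))"
  if "\<And>l. l > 0 \<Longrightarrow> P (\<lambda>v w. l * W.metric (f x) v w) \<longleftrightarrow> P (W.metric (f x))"
proof
  assume "P (W.metric (f x))"
  show "\<forall>g\<in>c. P (g (f x))"
  proof
    fix g assume "g \<in> c"
    then obtain l where l: "l > 0" "\<forall>v w. g (f x) v w = l * W.metric (f x) v w"
      using W.conformal_factor [where x = "f x"] by blast
    then have "g (f x) = (\<lambda>v w. l * W.metric (f x) v w)" by blast
    then show "P (g (f x))" using that [OF l(1)] \<open>P _\<close> by simp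
  qed
qed (use W.metric_in in blast)

lemma fibre_iff: "v \<in> fibre E x \<longleftrightarrow> (\<forall>w\<in>bcompl E x. v \<bullet> (fmetric x *v w) = 0)"
  unfolding fibre_def bundle_simps mem_Collect_eq fmetric_def W.metric_eq [symmetric]
  by (rule conf_iff) auto

lemma subspace_fibre: "subspace (fibre E x)"
  unfolding subspace_def by (auto simp: fibre_iff inner_add_left)

lemma fibre_compl_0:
  assumes "v \<in> fibre E x" "v \<in> bcompl E x" shows "v = 0"
  using assms fmetric_pos [of v x] unfolding fibre_iff by (cases "v = 0") auto

lemma proj_eqI:
  assumes "w \<in> fibre E x" "v - w \<in> bcompl E x"
  shows "proj E x v = w"
  unfolding proj_def
proof (rule the_equality)
  fix w' assume w': "w' \<in> fibre E x \<and> v - w' \<in> bcompl E x"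
  have "w' - w \<in> fibre E x" using w' assms subspace_fibre by (simp add: subspace_diff)
  moreover have "w' - w \<in> bcompl E x"
    using subspace_diff [OF subspace_compl assms(2), of "v - w'"] w' by simp
  ultimately have "w' - w = 0" by (rule fibre_compl_0)
  then show "w' = w" by simp
qed (use assms in simp)

lemma proj_in: "proj E x v \<in> fibre E x" and proj_diff_in: "v - proj E x v \<in> bcompl E x"
proof -
  obtain w where w: "\<And>t. t \<in> bcompl E x \<Longrightarrow> w \<bullet> (fmetric x *v t) = 0" "v - w \<in> bcompl E x"
    using complement_exists [OF subspace_compl fmetric_pos] by blast
  then have "w \<in> fibre E x" by (simp add: fibre_iff)
  then have "proj E x v = w" using w(2) by (rule proj_eqI)
  then show "proj E x v \<in> fibre E x" "v - proj E x v \<in> bcompl E x"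
    using w(2) \<open>w \<in> fibre E x\<close> by simp_all
qed

lemma proj_linear: "linear (proj E x)"
proof (rule linearI)
  fix a b r
  show "proj E x (a + b) = proj E x a + proj E x b"
  proof (rule proj_eqI)
    show "proj E x a + proj E x b \<in> fibre E x" by (intro subspace_add subspace_fibre proj_in)
    show "a + b - (proj E x a + proj E x b) \<in> bcompl E x"
      using subspace_add [OF subspace_compl proj_diff_in [where x = x and v = a] proj_diff_in [where x = x and v = b]] by (simp add: algebra_simps)
  qed
  show "proj E x (r *\<^sub>R a) = r *\<^sub>R proj E x a"
  proof (rule proj_eqI)
    show "r *\<^sub>R proj E x a \<in> fibre E x" by (intro subspace_scale subspace_fibre proj_in)
    show "r *\<^sub>R a - r *\<^sub>R proj E x a \<in> bcompl E x"
      using subspace_scale [OF subspace_compl proj_diff_in [where x = x and v = a], of r] by (simp add: algebra_simps)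
  qed
qed

lemma pr_apply: "pr x *v v = proj E x v"
  by (simp add: pr_def matrix_linear_works proj_linear)

lemma pr_in: "pr x *v v \<in> fibre E x" and pr_diff_in: "v - pr x *v v \<in> bcompl E x"
  by (simp_all add: pr_apply proj_in proj_diff_in)

lemma pr_fixes: "v \<in> fibre E x \<Longrightarrow> pr x *v v = v"
  using subspace_compl by (simp add: pr_apply proj_eqI subspace_0)

lemma pr_fixes_iff: "pr x *v v = v \<longleftrightarrow> v \<in> fibre E x"
  using pr_fixes pr_in by metis

lemma pr_kills: "v \<in> bcompl E x \<Longrightarrow> pr x *v v = 0"
  using subspace_fibre by (simp add: pr_apply proj_eqI subspace_0)

lemma pr_idem: "pr x ** pr x = pr x"
  by (simp add: matrix_eq matrix_vector_mul_assoc [symmetric] pr_fixes pr_in)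

lemma pr_self_adjoint: "self_adjoint (fmetric x) (pr x)"
  unfolding self_adjoint_def
proof (rule matrix_eq_inner)
  fix v w :: "real^'n"
  have o: "(pr x *v a) \<bullet> (fmetric x *v (b - pr x *v b)) = 0" for a b
    using pr_in pr_diff_in fibre_iff by blast
  have "(pr x *v v) \<bullet> (fmetric x *v w) = (pr x *v v) \<bullet> (fmetric x *v (pr x *v w))"
    using o [of v w] by (simp add: matrix_vector_mult_diff_distrib inner_diff_right)
  also have "\<dots> = v \<bullet> (fmetric x *v (pr x *v w))"
    using o [of w v] fmetric_commute [where v = v and w = "pr x *v w" and x = x]
      fmetric_commute [where v = "pr x *v v" and w = "pr x *v w" and x = x]
    by (simp add: matrix_vector_mult_diff_distrib inner_diff_right)
  finally show "v \<bullet> ((transpose (pr x) ** fmetric x) *v w) = v \<bullet> ((fmetric x ** pr x) *v w)"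
    by (simp only: inner_matrix_vector_left matrix_vector_mul_assoc)
qed

text \<open>\<open>(v, K *v v)\<close> stands for \<open>v + i K v\<close>, and
  \<open>K (v + i K v) = - i (v + i K v)\<close>: this is the \<open>-i\<close>-eigenspace of
  \<open>K\<close> on the fibre.\<close>

definition graph :: "'x \<Rightarrow> real^'n^'n \<Rightarrow> (real^'n) cx set" where
  "graph x K = {(v, K *v v) |v. v \<in> fibre E x}"

definition positive_acs :: "'x \<Rightarrow> real^'n^'n \<Rightarrow> bool" where
  "positive_acs x K \<longleftrightarrow> orth_acs (fmetric x) (pr x) K \<and>
     (\<exists>es. set es \<subseteq> fibre E x \<and> concat (map (\<lambda>e. [e, K *v e]) es) \<in> borient E x)"

lemma orth_acs_maps:
  assumes "orth_acs (fmetric x) (pr x) K"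
  shows "K *v v \<in> fibre E x" "v \<in> bcompl E x \<Longrightarrow> K *v v = 0" "v \<in> fibre E x \<Longrightarrow> K *v (K *v v) = - v"
proof -
  have K: "K ** pr x = K" "pr x ** K = K" "K ** K = - pr x" using assms by (auto simp: orth_acs_def)
  have "pr x *v (K *v v) = K *v v" by (simp add: matrix_vector_mul_assoc K)
  then show "K *v v \<in> fibre E x" by (simp add: pr_fixes_iff)
  show "K *v v = 0" if "v \<in> bcompl E x"
  proof -
    have "K *v v = K *v (pr x *v v)" by (simp add: matrix_vector_mul_assoc K)
    then show ?thesis using that by (simp add: pr_kills)
  qed
  show "K *v (K *v v) = - v" if "v \<in> fibre E x"
    by (simp add: matrix_vector_mul_assoc K matrix_neg_vmult pr_fixes that)
qed

lemma eig_minus_i_graph: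
  assumes "J ` fibre E x \<subseteq> fibre E x" "\<And>v. v \<in> fibre E x \<Longrightarrow> J (J v) = - v"
    "\<And>v. v \<in> fibre E x \<Longrightarrow> J v = K *v v"
  shows "eig_minus_i (fibre E x) J = graph x K"
proof (intro equalityI subsetI)
  fix z assume "z \<in> eig_minus_i (fibre E x) J"
  then show "z \<in> graph x K"
    using assms(3) by (auto simp: eig_minus_i_def cmap_def cI_def graph_def)
next
  fix z assume "z \<in> graph x K"
  then obtain v where v: "z = (v, J v)" "v \<in> fibre E x"
    using assms(3) by (auto simp: graph_def)
  then show "z \<in> eig_minus_i (fibre E x) J"
    using assms(1,2) by (auto simp: eig_minus_i_def cmap_def cI_def)
qed

text \<open>The graph determines the matrix on the fibre, the vanishing on the complement determines
  the rest.\<close>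

lemma acs_matrix_graph:
  assumes K: "orth_acs (fmetric x) (pr x) K"
  shows "acs_matrix E (x, graph x K) = K"
  unfolding acs_matrix_def fst_conv snd_conv
proof (rule the_equality)
  show "(\<forall>v\<in>bcompl E x. K *v v = 0) \<and> eig_minus_i (fibre E x) ((*v) K) = graph x K"
    using orth_acs_maps [OF K] eig_minus_i_graph [of "(*v) K" x K] by blast
next
  fix K' assume K': "(\<forall>v\<in>bcompl E x. K' *v v = 0) \<and> eig_minus_i (fibre E x) ((*v) K') = graph x K"
  have fib: "K' *v v = K *v v" if "v \<in> fibre E x" for v
  proof -
    have "(v, K *v v) \<in> eig_minus_i (fibre E x) ((*v) K')" using K' that by (auto simp: graph_def)
    then show ?thesis by (simp add: eig_minus_i_def cmap_def cI_def)
  qed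
  have "K' *v v = K *v v" for v
  proof -
    have z: "K' *v (v - pr x *v v) = 0" "K *v (v - pr x *v v) = 0"
      using K' orth_acs_maps(2) [OF K] pr_diff_in by blast+
    have "K' *v v = K' *v (pr x *v v)" "K *v v = K *v (pr x *v v)"
      using z by (simp_all add: matrix_vector_mult_diff_distrib)
    then show ?thesis using fib pr_in by metis
  qed
  then show "K' = K" by (simp add: matrix_eq)
qed

text \<open>\<open>K\<close> is \<open>J\<close> after the orthogonal projection. As
  \<open>J\<close> squares to \<open>-1\<close>, preserving the metric amounts to being skew, a
  condition linear in \<open>K\<close> and thus convenient to differentiate.\<close>

lemma isotropic_bundle_iff:
  "(x, u) \<in> isotropic_bundle E \<longleftrightarrow> (\<exists>K. positive_acs x K \<and> u = graph x K)"
proof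
  assume "(x, u) \<in> isotropic_bundle E"
  then obtain J where u: "u = eig_minus_i (fibre E x) J" and J: "positive_orthogonal_acs E x J"
    by (auto simp: isotropic_bundle_def)
  have cs: "linear J" "J ` fibre E x \<subseteq> fibre E x" "\<And>v. v \<in> fibre E x \<Longrightarrow> J (J v) = - v"
    and es: "\<exists>es. set es \<subseteq> fibre E x \<and> concat (map (\<lambda>e. [e, J e]) es) \<in> borient E x"
    using J by (auto simp: positive_orthogonal_acs_def complex_structure_def)
  have orth: "W.metric (f x) (J v) (J w) = W.metric (f x) v w" if "v \<in> fibre E x" "w \<in> fibre E x" for v w
    using J that W.metric_in unfolding positive_orthogonal_acs_def bundle_simps by blast
  define K where "K = matrix J ** pr x"
  have KJ: "K *v v = J (pr x *v v)" for v
    by (simp add: K_def matrix_vector_mul_assoc [symmetric] matrix_linear_works cs)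
  have Kf: "K *v v = J v" if "v \<in> fibre E x" for v
    by (simp add: KJ pr_fixes that)
  have in1: "K *v v \<in> fibre E x" for v unfolding KJ using cs(2) pr_in by blast
  have "K ** pr x = K"
    by (simp add: matrix_eq matrix_vector_mul_assoc [symmetric] KJ pr_fixes pr_in)
  moreover have "pr x ** K = K"
    by (simp add: matrix_eq matrix_vector_mul_assoc [symmetric] pr_fixes in1)
  moreover have "K ** K = - pr x"
    by (simp add: matrix_eq matrix_vector_mul_assoc [symmetric] matrix_neg_vmult Kf in1)
      (simp add: KJ cs(3) pr_in)
  moreover have "skew_adjoint (fmetric x) K"
    unfolding skew_adjoint_def
  proof (rule matrix_eq_inner)
    fix v w :: "real^'n"
    have sa: "a \<bullet> (fmetric x *v (pr x *v b)) = (pr x *v a) \<bullet> (fmetric x *v b)" for a b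
      using self_adjoint_apply [OF pr_self_adjoint] by simp
    have m: "(J a) \<bullet> (fmetric x *v J b) = a \<bullet> (fmetric x *v b)" if "a \<in> fibre E x" "b \<in> fibre E x" for a b
      using orth [OF that] by (simp add: W.metric_eq fmetric_def)
    let ?v = "pr x *v v" and ?w = "pr x *v w"
    have "(K *v v) \<bullet> (fmetric x *v w) = (pr x *v (J ?v)) \<bullet> (fmetric x *v w)"
      using cs(2) pr_in by (simp add: KJ pr_fixes image_subset_iff)
    also have "\<dots> = J ?v \<bullet> (fmetric x *v ?w)"
      by (rule sa [symmetric])
    also have "\<dots> = - (J ?v \<bullet> (fmetric x *v J (J ?w)))"
      by (simp add: cs(3) pr_in matrix_vector_mult_minus)
    also have "J ?v \<bullet> (fmetric x *v J (J ?w)) = ?v \<bullet> (fmetric x *v J ?w)"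
      using cs(2) pr_in by (intro m) auto
    also have "\<dots> = v \<bullet> (fmetric x *v (pr x *v J ?w))"
      by (rule sa [symmetric])
    also have "pr x *v J ?w = K *v w"
      using cs(2) pr_in by (simp add: KJ pr_fixes image_subset_iff)
    finally show "v \<bullet> ((transpose K ** fmetric x) *v w) = v \<bullet> (- (fmetric x ** K) *v w)"
      by (simp add: inner_matrix_vector_left matrix_vector_mul_assoc matrix_neg_vmult)
  qed
  ultimately have "orth_acs (fmetric x) (pr x) K"
    by (simp add: orth_acs_def)
  moreover have "concat (map (\<lambda>e. [e, K *v e]) es) = concat (map (\<lambda>e. [e, J e]) es)"
    if "set es \<subseteq> fibre E x" for es
    using that by (induction es) (simp_all add: Kf)
  ultimately have "positive_acs x K"
    using es unfolding positive_acs_def by fastforce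
  moreover have "u = graph x K"
    unfolding u using cs Kf by (intro eig_minus_i_graph) auto
  ultimately show "\<exists>K. positive_acs x K \<and> u = graph x K" by blast
next
  assume "\<exists>K. positive_acs x K \<and> u = graph x K"
  then obtain K where K: "positive_acs x K" "u = graph x K" by blast
  then have o: "orth_acs (fmetric x) (pr x) K" by (simp add: positive_acs_def)
  note m = orth_acs_maps [OF o]
  have g: "W.metric (f x) (K *v v) (K *v w) = W.metric (f x) v w" if "v \<in> fibre E x" "w \<in> fibre E x" for v w
  proof -
    have "skew_adjoint (fmetric x) K" using o by (simp add: orth_acs_def)
    from skew_adjoint_apply [OF this, of v "K *v w"] show ?thesis
      using m(3) [OF that(2)] by (simp add: W.metric_eq fmetric_def matrix_vector_mult_minus)
  qed
  have "\<forall>g\<in>c. \<forall>v\<in>fibre E x. \<forall>w\<in>fibre E x. g (f x) (K *v v) (K *v w) = g (f x) v w"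
    using g by (subst conf_iff [where P = "\<lambda>h. \<forall>v\<in>fibre E x. \<forall>w\<in>fibre E x. h (K *v v) (K *v w) = h v w"]) auto
  then have "positive_orthogonal_acs E x ((*v) K)"
    using K m unfolding positive_orthogonal_acs_def complex_structure_def positive_acs_def bundle_simps
    by auto
  moreover have "u = eig_minus_i (fibre E x) ((*v) K)"
    unfolding K(2) using m by (intro eig_minus_i_graph [symmetric]) auto
  ultimately show "(x, u) \<in> isotropic_bundle E"
    by (auto simp: isotropic_bundle_def)
qed

lemma acs_coord_graph:
  assumes "orth_acs (fmetric z) (pr z) K"
  shows "acs_coord E x (z, graph z K) = to_at B (f x) (f z) ** K ** from_at B (f x) (f z)"
  by (simp add: acs_coord_def bundle_simps acs_matrix_graph [OF assms])

end

text \<open>The two properties that the construction of curves calls for: a differentiable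
  projection, and stability of positive bases under transport to nearby fibres by matrices which, in
  the chart at \<open>f x\<close>, are close to the identity.\<close>

locale weyl_bundle = weyl_subbundle A B f c D E
  for A :: "('x::{t2_space,second_countable_topology}, 'm::finite) atlas"
    and B :: "('y::{t2_space,second_countable_topology}, 'n::finite) atlas"
    and f :: "'x \<Rightarrow> 'y" and c D and E :: "('x, 'm, 'y, 'n) obundle" +
  assumes proj_mderiv: "\<exists>D'. has_mderiv A
        (\<lambda>z. to_at B (f x) (f z) ** pr z ** from_at B (f x) (f z)) D' x"
    and orient_open: "\<lbrakk>ws \<in> borient E x; (\<gamma> \<longlongrightarrow> x) (at (0::real)); (M \<longlongrightarrow> mat 1) (at 0)\<rbrakk> \<Longrightarrow>
        \<forall>\<^sub>F t in at 0. map (\<lambda>w. (from_at B (f x) (f (\<gamma> t)) ** M t) *v w) ws \<in> borient E (\<gamma> t)"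

section \<open>Tangent spaces of the bundles\<close>

lemma has_mderiv_unique: "has_mderiv A F D x \<Longrightarrow> has_mderiv A F D' x \<Longrightarrow> D = D'"
  unfolding has_mderiv_def by (rule has_derivative_unique)

lemma has_mderiv_matrix_mult:
  fixes F :: "'x \<Rightarrow> real^'b^'a" and H :: "'x \<Rightarrow> real^'c^'b"
  shows "has_mderiv A F D x \<Longrightarrow> has_mderiv A H D' x \<Longrightarrow> F x = F0 \<Longrightarrow> H x = H0 \<Longrightarrow>
    (chart_inv (chart_at A x) (snd (chart_at A x) x)) = x \<Longrightarrow>
    has_mderiv A (\<lambda>z. F z ** H z) (\<lambda>h. F0 ** D' h + D h ** H0) x"
  unfolding has_mderiv_def o_def
  by (drule (1) matrix_mult_has_derivative) simp

lemma self_adjoint_conj: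
  assumes F: "F ** F' = mat 1" and \<pi>: "self_adjoint M \<pi>"
  shows "self_adjoint (transpose F ** M ** F) (F' ** \<pi> ** F)"
proof -
  have "transpose (F' ** \<pi> ** F) ** (transpose F ** M ** F)
      = transpose F ** (transpose \<pi> ** transpose (F ** F') ** M) ** F"
    by (simp only: matrix_transpose_mul matrix_mul_assoc)
  also have "\<dots> = transpose F ** (M ** \<pi>) ** F"
    using \<pi> by (simp add: F transpose_mat self_adjoint_def)
  also have "\<dots> = transpose F ** M ** (F ** F') ** \<pi> ** F"
    by (simp add: F matrix_mul_assoc)
  also have "\<dots> = (transpose F ** M ** F) ** (F' ** \<pi> ** F)"
    by (simp only: matrix_mul_assoc)
  finally show ?thesis by (simp add: self_adjoint_def)
qed

lemma hor_part_add:
  "hor_part \<pi> K (\<Gamma> + \<Gamma>') (\<pi>' + \<pi>'') = hor_part \<pi> K \<Gamma> \<pi>' + hor_part \<pi> K \<Gamma>' \<pi>''"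
  and hor_part_scaleR: "hor_part \<pi> K (r *\<^sub>R \<Gamma>) (r *\<^sub>R \<pi>') = r *\<^sub>R hor_part \<pi> K \<Gamma> \<pi>'"
  by (simp_all add: hor_part_def matrix_ring_simps scaleR_add_right scaleR_diff_right)

context weyl_bundle
begin

definition pr_at :: "'x \<Rightarrow> 'x \<Rightarrow> real^'n^'n" where
  "pr_at x z = to_at B (f x) (f z) ** pr z ** from_at B (f x) (f z)"

definition dpr :: "'x \<Rightarrow> real^'m \<Rightarrow> real^'n^'n" where
  "dpr x = fn_deriv A (pr_at x) x"

definition conn :: "'x \<Rightarrow> real^'m \<Rightarrow> real^'n^'n" where
  "conn x X = W.conn_matrix (f x) (mfd_deriv A B f x X)"

definition hor :: "'x \<Rightarrow> real^'n^'n \<Rightarrow> real^'m \<Rightarrow> real^'n^'n" where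
  "hor x K X = hor_part (pr x) K (conn x X) (dpr x X)"

definition gram_at :: "'x \<Rightarrow> 'x \<Rightarrow> real^'n^'n" where
  "gram_at x z = W.gram (f x) (f z)"

lemma pr_at_self [simp]: "pr_at x x = pr x" and gram_at_self [simp]: "gram_at x x = fmetric x"
  by (simp_all add: pr_at_def gram_at_def fmetric_def)

lemma pr_at_mderiv: "has_mderiv A (pr_at x) (dpr x) x"
proof -
  obtain D' where "has_mderiv A (pr_at x) D' x"
    using proj_mderiv [of x] by (auto simp: pr_at_def [abs_def])
  then show ?thesis
    by (simp add: dpr_def has_mderiv_fn_deriv)
qed

lemma dpr_linear: "linear (dpr x)"
  by (rule has_mderiv_linear [OF pr_at_mderiv])

lemma conn_linear: "linear (conn x)"
  unfolding conn_def using linear_compose [OF mfd_deriv_linear W.conn_matrix_linear] by (simp add: o_def)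

lemma hor_linear: "linear (hor x K)"
  by (rule linearI)
    (simp_all add: hor_def linear_add [OF dpr_linear] linear_add [OF conn_linear]
      linear_scale [OF dpr_linear] linear_scale [OF conn_linear] hor_part_add hor_part_scaleR)

lemma gram_at_mderiv:
  obtains \<theta> where "has_mderiv A (gram_at x)
    (\<lambda>X. transpose (conn x X) ** fmetric x + fmetric x ** conn x X + \<theta> X *\<^sub>R fmetric x) x"
proof -
  obtain \<theta> where "has_mderiv B (W.gram (f x)) (\<lambda>v. transpose (W.conn_matrix (f x) v) ** W.metric_matrix (f x)
      + W.metric_matrix (f x) ** W.conn_matrix (f x) v + \<theta> v *\<^sub>R W.metric_matrix (f x)) (f x)"
    by (rule W.gram_has_mderiv)
  from has_mderiv_compose [OF this] show thesis
    by (intro that [of "\<lambda>X. \<theta> (mfd_deriv A B f x X)"]) (simp add: gram_at_def [abs_def] conn_def fmetric_def)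
qed

lemma to_from:
  assumes "f z \<in> fst (chart_at B (f x))"
  shows "to_at B (f x) (f z) ** from_at B (f x) (f z) = mat 1"
    "from_at B (f x) (f z) ** to_at B (f x) (f z) = mat 1"
  using cod.to_at_from_at [OF assms] by auto

lemma gram_at_sym: "transpose (gram_at x z) = gram_at x z"
  by (simp add: gram_at_def W.gram_sym)

lemma gram_at_conj: "gram_at x z = transpose (from_at B (f x) (f z)) ** fmetric z ** from_at B (f x) (f z)"
  by (simp add: gram_at_def W.gram_def fmetric_def)

lemma pr_at_self_adjoint:
  "f z \<in> fst (chart_at B (f x)) \<Longrightarrow> self_adjoint (gram_at x z) (pr_at x z)"
  unfolding gram_at_conj pr_at_def by (rule self_adjoint_conj [OF to_from(2) pr_self_adjoint])

lemma pr_at_idem: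
  assumes "f z \<in> fst (chart_at B (f x))"
  shows "pr_at x z ** pr_at x z = pr_at x z"
proof -
  have "pr_at x z ** pr_at x z = to_at B (f x) (f z) ** pr z ** (from_at B (f x) (f z) ** to_at B (f x) (f z))
      ** pr z ** from_at B (f x) (f z)"
    by (simp only: pr_at_def matrix_mul_assoc)
  also have "\<dots> = to_at B (f x) (f z) ** (pr z ** pr z) ** from_at B (f x) (f z)"
    by (simp add: to_from [OF assms] matrix_mul_assoc)
  finally show ?thesis by (simp add: pr_idem pr_at_def)
qed

lemma orth_acs_to_coord:
  assumes "f z \<in> fst (chart_at B (f x))" "orth_acs (fmetric z) (pr z) K"
  shows "orth_acs (gram_at x z) (pr_at x z) (to_at B (f x) (f z) ** K ** from_at B (f x) (f z))"
  unfolding gram_at_conj pr_at_def using to_from [OF assms(1)] assms(2) by (intro orth_acs_conj)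

lemma orth_acs_from_coord:
  assumes z: "f z \<in> fst (chart_at B (f x))" and k: "orth_acs (gram_at x z) (pr_at x z) k"
  shows "orth_acs (fmetric z) (pr z) (from_at B (f x) (f z) ** k ** to_at B (f x) (f z))"
proof -
  let ?T = "to_at B (f x) (f z)" and ?F = "from_at B (f x) (f z)"
  have t: "transpose ?T ** transpose ?F = mat 1"
    unfolding matrix_transpose_mul [symmetric] by (simp add: to_from [OF z] transpose_mat)
  have "transpose ?T ** (transpose ?F ** fmetric z ** ?F) ** ?T
      = (transpose ?T ** transpose ?F) ** fmetric z ** (?F ** ?T)"
    by (simp only: matrix_mul_assoc)
  then have 1: "transpose ?T ** gram_at x z ** ?T = fmetric z"
    by (simp add: t to_from [OF z] gram_at_conj)
  have "?F ** (?T ** pr z ** ?F) ** ?T = (?F ** ?T) ** pr z ** (?F ** ?T)"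
    by (simp only: matrix_mul_assoc)
  then have 2: "?F ** pr_at x z ** ?T = pr z"
    by (simp add: to_from [OF z] pr_at_def)
  show ?thesis
    using orth_acs_conj [OF to_from [OF z] k] unfolding 1 2 .
qed

lemma dpr_idem: "pr x ** dpr x X + dpr x X ** pr x = dpr x X"
proof -
  have ci: "chart_inv (chart_at A x) (snd (chart_at A x) x) = x"
    by (simp add: dom.chart_at)
  have "has_mderiv A (\<lambda>z. pr_at x z ** pr_at x z) (\<lambda>X. pr x ** dpr x X + dpr x X ** pr x) x"
    by (intro has_mderiv_matrix_mult pr_at_mderiv ci) simp_all
  moreover have "\<forall>\<^sub>F z in nhds x. pr_at x z = pr_at x z ** pr_at x z"
    using eventually_map_chart by eventually_elim (simp add: pr_at_idem)
  ultimately have "(\<lambda>X. pr x ** dpr x X + dpr x X ** pr x) = dpr x"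
    using has_mderiv_unique [OF _ dom.has_mderiv_cong [OF _ pr_at_mderiv]] by blast
  then show ?thesis by (rule fun_cong)
qed

text \<open>The hypotheses of \<open>orth_acs_deriv_iff\<close> on the derivative of the projection
  result from differentiating its idempotence and self-adjointness in the chart.\<close>

lemma orth_acs_deriv_hor:
  assumes K: "orth_acs (fmetric x) (pr x) K"
    and G': "G' = transpose (conn x X) ** fmetric x + fmetric x ** conn x X + \<theta> *\<^sub>R fmetric x"
    and G: "has_mderiv A (gram_at x) DG x" "DG X = G'"
  shows "orth_acs_deriv (fmetric x) G' (pr x) (dpr x X) K P \<longleftrightarrow> P - hor x K X \<in> vert_space (fmetric x) (pr x) K"
    and "pr x ** (P + conn x X ** K - K ** conn x X) ** pr x = pr x ** (P - hor x K X) ** pr x"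
proof -
  have ci: "chart_inv (chart_at A x) (snd (chart_at A x) x) = x"
    by (simp add: dom.chart_at)
  note mm = has_mderiv_matrix_mult [OF _ _ _ _ ci]
  note tr = has_mderiv_bounded_linear [OF bounded_linear_transpose]
  have "has_mderiv A (\<lambda>z. transpose (pr_at x z) ** gram_at x z)
      (\<lambda>X. transpose (pr x) ** DG X + transpose (dpr x X) ** fmetric x) x"
    by (intro mm tr pr_at_mderiv G) simp_all
  moreover have "\<forall>\<^sub>F z in nhds x. transpose (pr_at x z) ** gram_at x z = gram_at x z ** pr_at x z"
    using eventually_map_chart by eventually_elim (use pr_at_self_adjoint in \<open>simp add: self_adjoint_def\<close>)
  ultimately have "has_mderiv A (\<lambda>z. gram_at x z ** pr_at x z)
      (\<lambda>X. transpose (pr x) ** DG X + transpose (dpr x X) ** fmetric x) x"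
    by (rule dom.has_mderiv_cong [rotated])
  moreover have "has_mderiv A (\<lambda>z. gram_at x z ** pr_at x z)
      (\<lambda>X. fmetric x ** dpr x X + DG X ** pr x) x"
    by (intro mm pr_at_mderiv G) simp_all
  ultimately have 2: "(\<lambda>X. transpose (pr x) ** DG X + transpose (dpr x X) ** fmetric x)
      = (\<lambda>X. fmetric x ** dpr x X + DG X ** pr x)"
    by (rule has_mderiv_unique)
  note * = orth_acs_deriv_iff [OF K pr_idem pr_self_adjoint dpr_idem _ G', where P = P]
  show "orth_acs_deriv (fmetric x) G' (pr x) (dpr x X) K P \<longleftrightarrow> P - hor x K X \<in> vert_space (fmetric x) (pr x) K"
    and "pr x ** (P + conn x X ** K - K ** conn x X) ** pr x = pr x ** (P - hor x K X) ** pr x"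
    unfolding hor_def using fun_cong [OF 2, of X] G(2) by (intro *; simp)+
qed

lemma eventually_velocity_chart_map:
  assumes "mfd_velocity A \<gamma> X" "\<gamma> 0 = x"
  shows "\<forall>\<^sub>F t in nhds 0. f (\<gamma> t) \<in> fst (chart_at B (f x))"
proof -
  have "(\<gamma> \<longlongrightarrow> x) (nhds 0)"
    using assms by (simp add: mfd_velocity_def continuous_at tendsto_nhds_iff)
  from eventually_compose_filterlim [OF eventually_map_chart this] show ?thesis .
qed

text \<open>\<open>orth_acs_curve_exists\<close> supplies complex structures along
  \<open>\<kappa>\<close>; they have to be shown positive near 0, and the curve has to be extended
  to all \<open>t\<close>. The last clause keeps the curve in one fibre when \<open>\<kappa>\<close>
  is constant, which the complex structure of the fibres relies on.\<close>

lemma bundle_curve_exists: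
  assumes K: "positive_acs x K" and \<kappa>: "\<kappa> 0 = x" "mfd_velocity A \<kappa> X"
    and vert: "P - hor x K X \<in> vert_space (fmetric x) (pr x) K"
  shows "\<exists>\<gamma>. (\<forall>t. \<gamma> t \<in> isotropic_bundle E) \<and> \<gamma> 0 = (x, graph x K) \<and> bundle_velocity E \<gamma> (X, P) \<and>
    (\<forall>t. fst (\<gamma> t) = \<kappa> t \<or> fst (\<gamma> t) = x)"
proof -
  have oK: "orth_acs (fmetric x) (pr x) K" using K by (simp add: positive_acs_def)
  let ?s = "(x, graph x K)"
  have s: "?s \<in> isotropic_bundle E" using K isotropic_bundle_iff by blast
  obtain \<theta> where G: "has_mderiv A (gram_at x)
    (\<lambda>X. transpose (conn x X) ** fmetric x + fmetric x ** conn x X + \<theta> X *\<^sub>R fmetric x) x"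
    by (rule gram_at_mderiv)
  let ?G' = "\<lambda>X. transpose (conn x X) ** fmetric x + fmetric x ** conn x X + \<theta> X *\<^sub>R fmetric x"
  note ev_dom = eventually_velocity_chart_map
  have "orth_acs_deriv (fmetric x) (?G' X) (pr x) (dpr x X) K P \<longleftrightarrow>
      P - hor x K X \<in> vert_space (fmetric x) (pr x) K"
    by (rule orth_acs_deriv_hor(1) [OF oK _ G, where \<theta> = "\<theta> X"]) simp_all
  with vert have lin: "orth_acs_deriv (fmetric x) (?G' X) (pr x) (dpr x X) K P" by blast
  have \<kappa>': "(\<kappa> \<longlongrightarrow> x) (at 0)" using \<kappa> by (simp add: mfd_velocity_def continuous_at)
  have Gc: "((\<lambda>t. gram_at x (\<kappa> t)) has_vector_derivative ?G' X) (at 0)"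
    by (rule dom.velocity_compose [OF \<kappa>(2,1) G])
  have pc: "((\<lambda>t. pr_at x (\<kappa> t)) has_vector_derivative dpr x X) (at 0)"
    by (rule dom.velocity_compose [OF \<kappa>(2,1) pr_at_mderiv])
  have alg: "\<forall>\<^sub>F t in nhds 0. transpose (gram_at x (\<kappa> t)) = gram_at x (\<kappa> t) \<and>
      self_adjoint (gram_at x (\<kappa> t)) (pr_at x (\<kappa> t)) \<and> pr_at x (\<kappa> t) ** pr_at x (\<kappa> t) = pr_at x (\<kappa> t)"
    using ev_dom [OF \<kappa>(2,1)] by eventually_elim (simp add: gram_at_sym pr_at_self_adjoint pr_at_idem)
  have inv: "invertible (gram_at x (\<kappa> 0))"
    by (simp add: \<kappa>(1) fmetric_def W.metric_matrix_invertible)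
  obtain k where k: "k 0 = K" "(k has_vector_derivative P) (at 0)"
    "\<forall>\<^sub>F t in nhds 0. orth_acs (gram_at x (\<kappa> t)) (pr_at x (\<kappa> t)) (k t)"
    using orth_acs_curve_exists [OF Gc pc alg inv, of K P] oK lin by (auto simp: \<kappa>(1))
  \<comment> \<open>\<open>M t\<close> tends to the identity and intertwines \<open>K\<close> with
    \<open>k t\<close> on the fibre at \<open>x\<close>, because averaging \<open>1\<close> and
    \<open>- k t K\<close> is the standard way to make a map complex linear. Hence it carries a
    frame of pairs \<open>e, K e\<close> to one of pairs \<open>e', k t e'\<close>. The last summand
    supplies the identity on the complement in the limit.\<close>
  define M where "M t = (1/2) *\<^sub>R (pr_at x (\<kappa> t) ** pr x - k t ** K)
      + (mat 1 - pr_at x (\<kappa> t)) ** (mat 1 - pr x)" for t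
  have klim: "(k \<longlongrightarrow> K) (at 0)" and plim: "((\<lambda>t. pr_at x (\<kappa> t)) \<longlongrightarrow> pr x) (at 0)"
    using has_vector_derivative_continuous [OF k(2)] has_vector_derivative_continuous [OF pc]
    by (simp_all add: continuous_at k(1) \<kappa>(1))
  have "(M \<longlongrightarrow> (1/2) *\<^sub>R (pr x ** pr x - K ** K) + (mat 1 - pr x) ** (mat 1 - pr x)) (at 0)"
    unfolding M_def by (intro tendsto_intros klim plim)
  also have "(1/2) *\<^sub>R (pr x ** pr x - K ** K) = pr x"
    using oK by (simp only: orth_acs_def pr_idem diff_minus_eq_add scaleR_half_double)
  also have "pr x + (mat 1 - pr x) ** (mat 1 - pr x) = mat 1"
    by (simp add: matrix_ring_simps pr_idem)
  finally have Mlim: "(M \<longlongrightarrow> mat 1) (at 0)" .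
  obtain es where es: "set es \<subseteq> fibre E x" "concat (map (\<lambda>e. [e, K *v e]) es) \<in> borient E x"
    using K by (auto simp: positive_acs_def)
  have or: "\<forall>\<^sub>F t in at 0. map (\<lambda>w. (from_at B (f x) (f (\<kappa> t)) ** M t) *v w)
      (concat (map (\<lambda>e. [e, K *v e]) es)) \<in> borient E (\<kappa> t)"
    by (rule orient_open [OF es(2) \<kappa>' Mlim])
  define Kt where "Kt t = from_at B (f x) (f (\<kappa> t)) ** k t ** to_at B (f x) (f (\<kappa> t))" for t
  have pos: "\<forall>\<^sub>F t in at 0. f (\<kappa> t) \<in> fst (chart_at B (f x)) \<and> positive_acs (\<kappa> t) (Kt t)"
    using or k(3) [unfolded eventually_nhds_conv_at, THEN conjunct1]
      ev_dom [OF \<kappa>(2,1), unfolded eventually_nhds_conv_at, THEN conjunct1]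
  proof eventually_elim
    case (elim t)
    let ?F = "from_at B (f x) (f (\<kappa> t))" and ?T = "to_at B (f x) (f (\<kappa> t))"
    have o: "orth_acs (fmetric (\<kappa> t)) (pr (\<kappa> t)) (Kt t)"
      unfolding Kt_def by (rule orth_acs_from_coord [OF elim(3,2)])
    have kk: "k t ** k t = - pr_at x (\<kappa> t)" "k t ** pr_at x (\<kappa> t) = k t" "pr_at x (\<kappa> t) ** k t = k t"
      using elim(2) by (auto simp: orth_acs_def)
    have Me: "M t *v e = (1/2) *\<^sub>R (pr_at x (\<kappa> t) *v e - k t *v (K *v e))" if "e \<in> fibre E x" for e
    proof -
      have "(mat 1 - pr x) *v e = 0"
        using pr_fixes [OF that] by (simp add: matrix_vector_mult_diff_rdistrib)
      then show ?thesis
        unfolding M_def matrix_vector_mult_add_rdistrib matrix_vector_mul_assoc [symmetric]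
          scaleR_matrix_vector_assoc [symmetric] matrix_vector_mult_diff_rdistrib [of "pr_at x (\<kappa> t) ** pr x"]
        by (simp add: pr_fixes [OF that])
    qed
    have MK: "M t *v (K *v e) = k t *v (M t *v e)" if e: "e \<in> fibre E x" for e
    proof -
      have "M t *v (K *v e) = (1/2) *\<^sub>R (pr_at x (\<kappa> t) *v (K *v e) + k t *v e)"
        by (simp add: Me orth_acs_maps [OF oK] e matrix_vector_mult_minus)
      moreover have "k t *v (M t *v e) = (1/2) *\<^sub>R ((k t ** pr_at x (\<kappa> t)) *v e - (k t ** k t) *v (K *v e))"
        by (simp only: Me [OF e] matrix_vector_mult_scaleR matrix_vector_mult_diff_distrib
            matrix_vector_mul_assoc matrix_mul_assoc)
      ultimately show ?thesis
        by (simp add: kk matrix_neg_vmult add.commute)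
    qed
    have Mfib: "(?F ** M t) *v e \<in> fibre E (\<kappa> t)" if e: "e \<in> fibre E x" for e
    proof -
      have "pr_at x (\<kappa> t) *v (M t *v e)
          = (1/2) *\<^sub>R ((pr_at x (\<kappa> t) ** pr_at x (\<kappa> t)) *v e - (pr_at x (\<kappa> t) ** k t) *v (K *v e))"
        by (simp only: Me [OF e] matrix_vector_mult_scaleR matrix_vector_mult_diff_distrib
            matrix_vector_mul_assoc matrix_mul_assoc)
      then have p: "pr_at x (\<kappa> t) *v (M t *v e) = M t *v e"
        by (simp add: Me [OF e] kk pr_at_idem [OF elim(3)])
      have "pr (\<kappa> t) *v (?F *v (M t *v e)) = (?F ** ?T) *v (pr (\<kappa> t) *v (?F *v (M t *v e)))"
        by (simp add: to_from [OF elim(3)])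
      also have "\<dots> = ?F *v (pr_at x (\<kappa> t) *v (M t *v e))"
        by (simp only: pr_at_def matrix_vector_mul_assoc matrix_mul_assoc)
      finally have "pr (\<kappa> t) *v (?F *v (M t *v e)) = ?F *v (M t *v e)"
        by (simp only: p)
      then show ?thesis by (simp only: pr_fixes_iff matrix_vector_mul_assoc [symmetric])
    qed
    have KF: "(?F ** M t) *v (K *v e) = Kt t *v ((?F ** M t) *v e)" if e: "e \<in> fibre E x" for e
    proof -
      have "Kt t *v ((?F ** M t) *v e) = (?F ** k t ** (?T ** ?F)) *v (M t *v e)"
        by (simp only: Kt_def matrix_vector_mul_assoc matrix_mul_assoc)
      also have "\<dots> = ?F *v (k t *v (M t *v e))"
        by (simp add: to_from [OF elim(3)] matrix_vector_mul_assoc matrix_mul_assoc)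
      finally show ?thesis by (simp only: MK [OF e] matrix_vector_mul_assoc [symmetric])
    qed
    have eq: "map (\<lambda>w. (?F ** M t) *v w) (concat (map (\<lambda>e. [e, K *v e]) es))
        = concat (map (\<lambda>e. [e, Kt t *v e]) (map (\<lambda>e. (?F ** M t) *v e) es))"
      using es(1) by (induction es) (simp_all add: KF)
    have "set (map (\<lambda>e. (?F ** M t) *v e) es) \<subseteq> fibre E (\<kappa> t)"
      using es(1) Mfib by auto
    with elim(1) [unfolded eq] show ?case
      using o elim(3) unfolding positive_acs_def by blast
  qed
  \<comment> \<open>Where positivity is not known the curve stays at its starting point;
    \<open>t = 0\<close> is treated separately because \<open>pos\<close> speaks of punctured
    neighbourhoods.\<close>
  define \<gamma> where "\<gamma> t = (if t = 0 then ?s else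
    if f (\<kappa> t) \<in> fst (chart_at B (f x)) \<and> positive_acs (\<kappa> t) (Kt t) then (\<kappa> t, graph (\<kappa> t) (Kt t)) else ?s)" for t
  have ev\<gamma>: "\<forall>\<^sub>F t in at 0. fst (\<gamma> t) = \<kappa> t \<and> acs_coord E x (\<gamma> t) = k t"
    using pos eventually_neq_at_within [of 0 0 UNIV]
  proof eventually_elim
    case (elim t)
    have \<gamma>t: "\<gamma> t = (\<kappa> t, graph (\<kappa> t) (Kt t))" using elim by (simp add: \<gamma>_def)
    have o: "orth_acs (fmetric (\<kappa> t)) (pr (\<kappa> t)) (Kt t)" using elim by (simp add: positive_acs_def)
    let ?F = "from_at B (f x) (f (\<kappa> t))" and ?T = "to_at B (f x) (f (\<kappa> t))"
    have "?T ** Kt t ** ?F = (?T ** ?F) ** k t ** (?T ** ?F)"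
      by (simp only: Kt_def matrix_mul_assoc)
    then show ?case
      using elim(1) by (simp add: \<gamma>t acs_coord_graph [OF o] to_from)
  qed
  have \<gamma>0: "\<gamma> 0 = ?s" by (simp add: \<gamma>_def)
  have ev1: "\<forall>\<^sub>F t in at 0. \<kappa> t = (fst \<circ> \<gamma>) t" and ev2: "\<forall>\<^sub>F t in at 0. k t = acs_coord E x (\<gamma> t)"
    using ev\<gamma> by (auto elim: eventually_mono)
  have "mfd_velocity A (fst \<circ> \<gamma>) X"
    unfolding mfd_velocity_def
  proof
    show "isCont (fst \<circ> \<gamma>) 0"
      using tendsto_cong [OF ev1, of x] \<kappa>' \<gamma>0 by (simp add: continuous_at comp_def)
    have ev1': "\<forall>\<^sub>F t in at 0. snd (chart_at A x) (\<kappa> t) = snd (chart_at A x) ((fst \<circ> \<gamma>) t)"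
      using ev1 by eventually_elim simp
    have "((\<lambda>t. snd (chart_at A x) (\<kappa> t)) has_derivative (\<lambda>t. t *\<^sub>R X)) (at 0)"
      using \<kappa> by (simp add: mfd_velocity_def has_vector_derivative_def)
    from has_derivative_transform_eventually [OF this ev1']
    show "((\<lambda>t. snd (chart_at A ((fst \<circ> \<gamma>) 0)) ((fst \<circ> \<gamma>) t)) has_vector_derivative X) (at 0)"
      by (simp add: has_vector_derivative_def \<gamma>0 \<kappa>(1))
  qed
  moreover have "((\<lambda>t. acs_coord E x (\<gamma> t)) has_vector_derivative P) (at 0)"
    using has_derivative_transform_eventually [OF k(2) [unfolded has_vector_derivative_def] ev2]
    by (simp add: has_vector_derivative_def \<gamma>0 k(1) acs_coord_graph [OF oK])
  ultimately have "bundle_velocity E \<gamma> (X, P)"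
    by (simp add: bundle_velocity_def bundle_simps \<gamma>0)
  moreover have "\<gamma> t \<in> isotropic_bundle E" for t
    using s by (auto simp: \<gamma>_def isotropic_bundle_iff)
  moreover have "fst (\<gamma> t) = \<kappa> t \<or> fst (\<gamma> t) = x" for t
    by (simp add: \<gamma>_def)
  ultimately show ?thesis using \<gamma>0 by (intro exI [of _ \<gamma>] conjI allI)
qed

text \<open>One inclusion differentiates the equations of \<open>orth_acs\<close> along a given
  curve, in the chart at the foot point; the other is \<open>bundle_curve_exists\<close> over any
  base curve with velocity \<open>X\<close>.\<close>

lemma bundle_tangent_graph:
  assumes K: "positive_acs x K"
  shows "bundle_tangent E (x, graph x K) = {(X, P). P - hor x K X \<in> vert_space (fmetric x) (pr x) K}"
proof -
  have oK: "orth_acs (fmetric x) (pr x) K" using K by (simp add: positive_acs_def)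
  let ?s = "(x, graph x K)"
  have s: "?s \<in> isotropic_bundle E" using K isotropic_bundle_iff by blast
  obtain \<theta> where G: "has_mderiv A (gram_at x)
    (\<lambda>X. transpose (conn x X) ** fmetric x + fmetric x ** conn x X + \<theta> X *\<^sub>R fmetric x) x"
    by (rule gram_at_mderiv)
  let ?G' = "\<lambda>X. transpose (conn x X) ** fmetric x + fmetric x ** conn x X + \<theta> X *\<^sub>R fmetric x"
  note ev_dom = eventually_velocity_chart_map
  have iff: "orth_acs_deriv (fmetric x) (?G' X) (pr x) (dpr x X) K P \<longleftrightarrow>
      P - hor x K X \<in> vert_space (fmetric x) (pr x) K" for X P
    by (rule orth_acs_deriv_hor(1) [OF oK _ G, where \<theta> = "\<theta> X"]) simp_all
  show ?thesis
  proof (intro equalityI subsetI; clarify)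
    fix X P assume "(X, P) \<in> bundle_tangent E ?s"
    then obtain \<gamma> where \<gamma>: "\<And>t. \<gamma> t \<in> isotropic_bundle E" "\<gamma> 0 = ?s" "bundle_velocity E \<gamma> (X, P)"
      by (auto simp: tangent_space_def)
    define c where "c = fst \<circ> \<gamma>"
    have c: "mfd_velocity A c X" "c 0 = x"
      using \<gamma>(2,3) by (simp_all add: bundle_velocity_def bundle_simps c_def)
    define k where "k t = acs_coord E x (\<gamma> t)" for t
    have k: "(k has_vector_derivative P) (at 0)"
      using \<gamma>(2,3) by (simp add: bundle_velocity_def k_def [abs_def])
    have k0: "k 0 = K"
      by (simp add: k_def \<gamma>(2) acs_coord_graph [OF oK])
    have "\<forall>\<^sub>F t in nhds 0. orth_acs (gram_at x (c t)) (pr_at x (c t)) (k t)"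
      using ev_dom [OF c]
    proof eventually_elim
      case (elim t)
      have "(c t, snd (\<gamma> t)) \<in> isotropic_bundle E"
        using \<gamma>(1) [of t] by (simp add: c_def)
      then obtain Kt where "positive_acs (c t) Kt" "snd (\<gamma> t) = graph (c t) Kt"
        unfolding isotropic_bundle_iff by (elim exE conjE)
      then have Kt: "positive_acs (c t) Kt" "\<gamma> t = (c t, graph (c t) Kt)"
        by (simp_all add: c_def prod_eq_iff)
      then have o: "orth_acs (fmetric (c t)) (pr (c t)) Kt" by (simp add: positive_acs_def)
      show ?case
        unfolding k_def Kt(2) acs_coord_graph [OF o] by (rule orth_acs_to_coord [OF elim o])
    qed
    from orth_acs_curve_deriv [OF dom.velocity_compose [OF c G] dom.velocity_compose [OF c pr_at_mderiv] k this]
    show "P - hor x K X \<in> vert_space (fmetric x) (pr x) K"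
      unfolding c(2) k0 iff [symmetric] by simp
  next
    fix X P assume "P - hor x K X \<in> vert_space (fmetric x) (pr x) K"
    moreover obtain c where "c 0 = x" "mfd_velocity A c X" by (rule dom.velocity_exists)
    ultimately obtain \<gamma> where "\<forall>t. \<gamma> t \<in> isotropic_bundle E" "\<gamma> 0 = ?s" "bundle_velocity E \<gamma> (X, P)"
      using bundle_curve_exists [OF K] by blast
    then show "(X, P) \<in> bundle_tangent E ?s"
      by (auto simp: tangent_space_def)
  qed
qed

end

section \<open>Vertical and horizontal spaces, almost complex structures\<close>

lemma eig_minus_i_complex_structure:
  assumes "J ` V \<subseteq> V" "\<And>v. v \<in> V \<Longrightarrow> J (J v) = - v"
  shows "eig_minus_i V J = {(v, J v) |v. v \<in> V}"
  using assms by (auto simp: eig_minus_i_def cmap_def cI_def)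

lemma eig_plus_i_complex_structure:
  assumes "J ` V \<subseteq> V" "\<And>v. v \<in> V \<Longrightarrow> J (J v) = - v" "\<And>v. v \<in> V \<Longrightarrow> - v \<in> V" "\<And>v. v \<in> V \<Longrightarrow> J (- v) = - J v"
  shows "eig_plus_i V J = {(v, - J v) |v. v \<in> V}"
proof (intro equalityI subsetI)
  fix z assume "z \<in> eig_plus_i V J"
  then show "z \<in> {(v, - J v) |v. v \<in> V}"
    by (auto simp: eig_plus_i_def cmap_def cI_def)
next
  fix z assume "z \<in> {(v, - J v) |v. v \<in> V}"
  then obtain v where v: "z = (v, - J v)" "v \<in> V" by blast
  then have "J v \<in> V" using assms(1) by blast
  then show "z \<in> eig_plus_i V J"
    using v assms(2-4) by (simp add: eig_plus_i_def cmap_def cI_def)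
qed

text \<open>The eigenspace is the graph of the complex structure over \<open>V\<close>, so the
  choice made by \<open>acs_minus\<close> is forced on \<open>V\<close>.\<close>

lemma acs_minus_eq:
  assumes J: "complex_structure V J" and E: "eig_minus_i V J = E" and v: "v \<in> V"
  shows "acs_minus V E v = J v"
proof -
  have "complex_structure V (acs_minus V E) \<and> eig_minus_i V (acs_minus V E) = E"
    unfolding acs_minus_def by (rule someI [of _ J]) (use J E in simp)
  then have "(v, J v) \<in> eig_minus_i V (acs_minus V E)"
    using J v E eig_minus_i_complex_structure [of J V] by (auto simp: complex_structure_def)
  then show ?thesis
    by (simp add: eig_minus_i_def cmap_def cI_def)
qed

lemma acs_plus_eq:
  assumes J: "complex_structure V J" and E: "eig_plus_i V J = E" and v: "v \<in> V" and V: "\<And>v. v \<in> V \<Longrightarrow> - v \<in> V"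
  shows "acs_plus V E v = J v"
proof -
  have "complex_structure V (acs_plus V E) \<and> eig_plus_i V (acs_plus V E) = E"
    unfolding acs_plus_def by (rule someI [of _ J]) (use J E in simp)
  then have "(v, - J v) \<in> eig_plus_i V (acs_plus V E)"
    using J v E V eig_plus_i_complex_structure [of J V] linear_neg by (auto simp: complex_structure_def)
  then show ?thesis
    by (simp add: eig_plus_i_def cmap_def cI_def)
qed

lemma mfd_velocity_unique:
  "mfd_velocity A \<gamma> X \<Longrightarrow> mfd_velocity A \<gamma> X' \<Longrightarrow> X = X'"
  unfolding mfd_velocity_def using vector_derivative_at by metis

lemma bundle_velocity_unique:
  assumes "bundle_velocity E \<gamma> v" "bundle_velocity E \<gamma> v'"
  shows "v = v'"
proof (rule prod_eqI)
  show "fst v = fst v'" using assms mfd_velocity_unique unfolding bundle_velocity_def by blast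
  show "snd v = snd v'" using assms vector_derivative_at unfolding bundle_velocity_def by metis
qed

lemma vert_space_mult_mult:
  assumes "orth_acs G \<pi> K" "A \<in> vert_space G \<pi> K"
  shows "K ** (K ** A) = - A"
proof -
  have "K ** K = - \<pi>" "\<pi> ** A = A" using assms by (simp_all add: orth_acs_def vert_space_def)
  then show ?thesis by (simp only: matrix_mul_assoc matrix_neg_lmult)
qed

context weyl_bundle
begin

lemma vert_spaceD:
  assumes "Z \<in> vert_space G (pr x) K"
  shows "Z *v v \<in> fibre E x" "Z *v (pr x *v v) = Z *v v" "K *v (Z *v v) = - (Z *v (K *v v))"
proof -
  have *: "pr x ** Z = Z" "Z ** pr x = Z" "K ** Z = - (Z ** K)" using assms by (auto simp: vert_space_def)
  show "Z *v v \<in> fibre E x" using * by (simp add: pr_fixes_iff [symmetric] matrix_vector_mul_assoc)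
  show "Z *v (pr x *v v) = Z *v v" "K *v (Z *v v) = - (Z *v (K *v v))"
    by (simp_all add: matrix_vector_mul_assoc * matrix_neg_vmult)
qed

lemma vert_space_0: "0 \<in> vert_space G \<pi> K"
  by (simp add: vert_space_def skew_adjoint_def transpose_def vec_eq_iff matrix_matrix_mult_def)

text \<open>The defining condition tests the compression by \<open>pr x\<close>. To it only the
  vertical remainder \<open>P - hor x K X\<close> contributes, and this equals its own compression,
  so it must vanish.\<close>

lemma horizontal_graph:
  assumes K: "positive_acs x K"
  shows "horizontal E (x, graph x K) = {(X, hor x K X) |X. True}"
proof -
  have oK: "orth_acs (fmetric x) (pr x) K" using K by (simp add: positive_acs_def)
  obtain \<theta> where G: "has_mderiv A (gram_at x)
    (\<lambda>X. transpose (conn x X) ** fmetric x + fmetric x ** conn x X + \<theta> X *\<^sub>R fmetric x) x"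
    by (rule gram_at_mderiv)
  have iff: "(X, P) \<in> horizontal E (x, graph x K) \<longleftrightarrow> P = hor x K X" for X P
  proof -
    define V where "V = P + conn x X ** K - K ** conn x X"
    have pp: "pr x ** V ** pr x = pr x ** (P - hor x K X) ** pr x"
      unfolding V_def by (rule orth_acs_deriv_hor(2) [OF oK _ G, where \<theta> = "\<theta> X"]) simp_all
    have "(\<forall>w\<in>fibre E x. proj E x (V *v w) = 0) \<longleftrightarrow> pr x ** V ** pr x = 0"
    proof
      assume "\<forall>w\<in>fibre E x. proj E x (V *v w) = 0"
      then show "pr x ** V ** pr x = 0"
        by (simp add: matrix_eq matrix_vector_mul_assoc [symmetric] pr_apply proj_in)
    next
      assume z: "pr x ** V ** pr x = 0"
      show "\<forall>w\<in>fibre E x. proj E x (V *v w) = 0"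
      proof
        fix w assume "w \<in> fibre E x"
        then have "proj E x (V *v w) = (pr x ** V ** pr x) *v w"
          by (simp add: matrix_vector_mul_assoc [symmetric] pr_apply [symmetric] pr_fixes)
        then show "proj E x (V *v w) = 0" by (simp add: z)
      qed
    qed
    then have "(X, P) \<in> horizontal E (x, graph x K) \<longleftrightarrow>
        P - hor x K X \<in> vert_space (fmetric x) (pr x) K \<and> pr x ** (P - hor x K X) ** pr x = 0"
      using bundle_tangent_graph [OF K]
      unfolding horizontal_def
      by (simp add: bundle_simps conn_def [symmetric] W.conn_matrix_def [symmetric] acs_matrix_graph [OF oK] V_def [symmetric] pp [symmetric])
    also have "\<dots> \<longleftrightarrow> P = hor x K X"
      using vert_space_0 by (auto simp: vert_space_def)
    finally show ?thesis .
  qed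
  show ?thesis by (auto simp: iff)
qed

lemma hor_0 [simp]: "hor x K 0 = 0"
  by (rule linear_0 [OF hor_linear])

lemma vertical_graph:
  assumes "positive_acs x K"
  shows "vertical E (x, graph x K) = {(0, Z) |Z. Z \<in> vert_space (fmetric x) (pr x) K}"
  unfolding vertical_def bundle_tangent_graph [OF assms] by auto

text \<open>Points of the moving space are \<open>(a, k *v a)\<close>, so a curve in it has velocity
  \<open>(a', K *v a' + Z *v v)\<close>. The free part \<open>(a', K *v a')\<close> lies in the
  space itself: in the quotient the class is that of \<open>(0, Z *v v)\<close>. Conversely, a
  straight line in the fibre realises any \<open>a'\<close>.\<close>

lemma grassmann_hom_graph:
  assumes K: "positive_acs x K" and Z: "Z \<in> vert_space (fmetric x) (pr x) K" and v: "v \<in> fibre E x"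
  shows "grassmann_hom E (x, graph x K) (0, Z) (v, K *v v) w \<longleftrightarrow>
    fst w \<in> fibre E x \<and> snd w = K *v fst w + Z *v v"
proof -
  have oK: "orth_acs (fmetric x) (pr x) K" using K by (simp add: positive_acs_def)
  have Kt: "\<exists>Kt. orth_acs (fmetric x) (pr x) Kt \<and> snd s = graph x Kt \<and> acs_coord E x s = Kt"
    if "s \<in> isotropic_bundle E" "fst s = x" for s
  proof -
    have "(x, snd s) \<in> isotropic_bundle E" using that by (metis prod.collapse)
    then obtain Kt where "positive_acs x Kt" "snd s = graph x Kt"
      unfolding isotropic_bundle_iff by blast
    moreover from this have "acs_coord E x s = Kt"
      using acs_coord_graph [of x Kt x] that by (cases s) (auto simp: positive_acs_def)
    ultimately show ?thesis by (auto simp: positive_acs_def)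
  qed
  show ?thesis
  proof
    assume "grassmann_hom E (x, graph x K) (0, Z) (v, K *v v) w"
    then obtain \<gamma> \<zeta> where \<gamma>: "\<And>t. \<gamma> t \<in> isotropic_bundle E" "\<And>t. fst (\<gamma> t) = x" "\<gamma> 0 = (x, graph x K)"
      "bundle_velocity E \<gamma> (0, Z)" and \<zeta>: "\<And>t. \<zeta> t \<in> snd (\<gamma> t)" "\<zeta> 0 = (v, K *v v)"
      "(\<zeta> has_vector_derivative w) (at 0)"
      by (auto simp: grassmann_hom_def)
    define k where "k t = acs_coord E x (\<gamma> t)" for t
    have k: "(k has_vector_derivative Z) (at 0)"
      using \<gamma>(2-4) by (simp add: bundle_velocity_def k_def [abs_def])
    have kt: "snd (\<gamma> t) = graph x (k t)" for t
      using Kt [OF \<gamma>(1,2)] by (auto simp: k_def)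
    have k0: "k 0 = K"
      using acs_coord_graph [OF oK, of x] by (simp add: k_def \<gamma>(3))
    have zt: "fst (\<zeta> t) \<in> fibre E x" "snd (\<zeta> t) = k t *v fst (\<zeta> t)" for t
      using \<zeta>(1) [of t] unfolding kt graph_def by auto
    have d1: "((\<lambda>t. fst (\<zeta> t)) has_vector_derivative fst w) (at 0)"
      by (rule bounded_linear.has_vector_derivative [OF bounded_linear_fst \<zeta>(3)])
    have d2: "((\<lambda>t. snd (\<zeta> t)) has_vector_derivative snd w) (at 0)"
      by (rule bounded_linear.has_vector_derivative [OF bounded_linear_snd \<zeta>(3)])
    have "((\<lambda>t. pr x *v fst (\<zeta> t)) has_vector_derivative pr x *v fst w) (at 0)"
      by (rule bounded_linear.has_vector_derivative [OF _ d1]) simp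
    then have "((\<lambda>t. fst (\<zeta> t)) has_vector_derivative pr x *v fst w) (at 0)"
      by (simp add: pr_fixes zt)
    with d1 have "pr x *v fst w = fst w"
      using vector_derivative_at by metis
    moreover have "((\<lambda>t. k t *v fst (\<zeta> t)) has_vector_derivative k 0 *v fst w + Z *v fst (\<zeta> 0)) (at 0)"
      by (rule bounded_bilinear.has_vector_derivative [OF bounded_bilinear_matrix_vector_mult k d1])
    then have "((\<lambda>t. snd (\<zeta> t)) has_vector_derivative K *v fst w + Z *v v) (at 0)"
      by (simp add: zt k0 \<zeta>)
    with d2 have "snd w = K *v fst w + Z *v v"
      using vector_derivative_at by metis
    ultimately show "fst w \<in> fibre E x \<and> snd w = K *v fst w + Z *v v"
      by (simp add: pr_fixes_iff)
  next
    assume w: "fst w \<in> fibre E x \<and> snd w = K *v fst w + Z *v v"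
    have Z0: "Z - hor x K 0 \<in> vert_space (fmetric x) (pr x) K" using Z by simp
    obtain \<gamma> where \<gamma>: "\<forall>t. \<gamma> t \<in> isotropic_bundle E" "\<gamma> 0 = (x, graph x K)" "bundle_velocity E \<gamma> (0, Z)"
      "\<forall>t. fst (\<gamma> t) = x"
      using bundle_curve_exists [OF K refl dom.velocity_const Z0] by (elim exE conjE) simp
    define k where "k t = acs_coord E x (\<gamma> t)" for t
    have k: "(k has_vector_derivative Z) (at 0)"
      using \<gamma>(2,3) by (simp add: bundle_velocity_def k_def [abs_def])
    have kt: "snd (\<gamma> t) = graph x (k t)" for t
      using Kt [OF \<gamma>(1) [rule_format] \<gamma>(4) [rule_format]] by (auto simp: k_def)
    have k0: "k 0 = K"
      using acs_coord_graph [OF oK, of x] by (simp add: k_def \<gamma>(2))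
    define a where "a t = v + t *\<^sub>R fst w" for t
    have a: "(a has_vector_derivative fst w) (at 0)"
      unfolding a_def by (auto intro!: derivative_eq_intros)
    have at: "a t \<in> fibre E x" for t
      unfolding a_def using w v by (intro subspace_add subspace_scale subspace_fibre) auto
    have "((\<lambda>t. k t *v a t) has_vector_derivative k 0 *v fst w + Z *v a 0) (at 0)"
      by (rule bounded_bilinear.has_vector_derivative [OF bounded_bilinear_matrix_vector_mult k a])
    then have "((\<lambda>t. (a t, k t *v a t)) has_vector_derivative (fst w, k 0 *v fst w + Z *v a 0)) (at 0)"
      by (rule has_vector_derivative_Pair [OF a])
    also have "(fst w, k 0 *v fst w + Z *v a 0) = w"
      using w by (simp add: k0 a_def prod_eq_iff)
    finally have "((\<lambda>t. (a t, k t *v a t)) has_vector_derivative w) (at 0)" .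
    moreover have "(a t, k t *v a t) \<in> snd (\<gamma> t)" for t
      unfolding kt graph_def using at by blast
    moreover have "(a 0, k 0 *v a 0) = (v, K *v v)" by (simp add: a_def k0)
    ultimately show "grassmann_hom E (x, graph x K) (0, Z) (v, K *v v) w"
      unfolding grassmann_hom_def using \<gamma>
      by (intro exI [of _ \<gamma>] exI [of _ "\<lambda>t. (a t, k t *v a t)"]) (simp add: k0)
  qed
qed

text \<open>Multiplication by i sends \<open>(0, Z *v v)\<close> to \<open>(- (Z *v v), 0)\<close>,
  which modulo \<open>graph x K\<close> is \<open>(0, K *v (Z *v v))\<close>. So i acts as left
  multiplication by \<open>K\<close>; uniqueness is tested on the representatives
  \<open>(0, Z *v v)\<close>.\<close>

lemma fibre_acs_graph:
  assumes K: "positive_acs x K" and Z: "Z \<in> vert_space (fmetric x) (pr x) K"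
  shows "fibre_acs E (x, graph x K) (0, Z) = (0, K ** Z)"
proof -
  have oK: "orth_acs (fmetric x) (pr x) K" using K by (simp add: positive_acs_def)
  note KA = vert_space_mult [OF oK Z]
  note Km = orth_acs_maps [OF oK]
  show ?thesis
    unfolding fibre_acs_def
  proof (rule the_equality)
    have "grassmann_hom E (x, graph x K) (0, K ** Z) z (cI w)"
      if z: "z \<in> graph x K" and w: "grassmann_hom E (x, graph x K) (0, Z) z w" for z w
    proof -
      obtain v where v: "z = (v, K *v v)" "v \<in> fibre E x" using z by (auto simp: graph_def)
      have w': "fst w \<in> fibre E x" "snd w = K *v fst w + Z *v v"
        using w grassmann_hom_graph [OF K Z v(2)] unfolding v(1) by auto
      have "K *v (- snd w) + (K ** Z) *v v = fst w"
        by (simp add: w'(2) matrix_vector_mult_minus matrix_vector_right_distrib Km(3) w'(1)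
            matrix_vector_mul_assoc [symmetric] matrix_vector_mult_diff_distrib)
      moreover have "- snd w \<in> fibre E x"
        unfolding w'(2) using Km(1) vert_spaceD(1) [OF Z]
        by (intro subspace_neg subspace_add subspace_fibre) auto
      ultimately show ?thesis
        unfolding v(1) grassmann_hom_graph [OF K KA v(2)] by (simp add: cI_def)
    qed
    then show "(0, K ** Z) \<in> vertical E (x, graph x K) \<and> (\<forall>z\<in>snd (x, graph x K). \<forall>w.
        grassmann_hom E (x, graph x K) (0, Z) z w \<longrightarrow> grassmann_hom E (x, graph x K) (0, K ** Z) z (cI w))"
      using KA by (simp add: vertical_graph [OF K])
  next
    fix b assume b: "b \<in> vertical E (x, graph x K) \<and> (\<forall>z\<in>snd (x, graph x K). \<forall>w.
        grassmann_hom E (x, graph x K) (0, Z) z w \<longrightarrow> grassmann_hom E (x, graph x K) b z (cI w))"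
    then obtain Z' where Z': "b = (0, Z')" "Z' \<in> vert_space (fmetric x) (pr x) K"
      by (auto simp: vertical_graph [OF K])
    have fib: "Z' *v v = (K ** Z) *v v" if v: "v \<in> fibre E x" for v
    proof -
      have "grassmann_hom E (x, graph x K) (0, Z) (v, K *v v) (0, Z *v v)"
        unfolding grassmann_hom_graph [OF K Z v] using subspace_0 [OF subspace_fibre] by simp
      moreover have "(v, K *v v) \<in> graph x K" using v by (auto simp: graph_def)
      ultimately have "grassmann_hom E (x, graph x K) (0, Z') (v, K *v v) (cI (0, Z *v v))"
        using b unfolding Z'(1) by simp
      then have "0 = K *v (- (Z *v v)) + Z' *v v"
        unfolding grassmann_hom_graph [OF K Z'(2) v] by (simp add: cI_def)
      then show ?thesis
        by (simp add: matrix_vector_mult_minus matrix_vector_mul_assoc)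
    qed
    have "Z' *v v = (K ** Z) *v v" for v
      using fib [OF pr_in [of x v]] vert_spaceD(2) [OF Z'(2)] vert_spaceD(2) [OF KA] by simp
    then show "b = (0, K ** Z)" by (simp add: Z'(1) matrix_eq)
  qed
qed

text \<open>The almost complex structures on the bundle: \<open>j\<close> on horizontal vectors, minus that of the
  fibres on vertical ones.\<close>

definition bundle_acs :: "'x \<Rightarrow> real^'n^'n \<Rightarrow> real^'m^'m \<Rightarrow> ('m, 'n) btangent \<Rightarrow> ('m, 'n) btangent" where
  "bundle_acs x K j v = (j *v fst v, hor x K (j *v fst v) - K ** (snd v - hor x K (fst v)))"

lemma bundle_acs_complex_structure:
  assumes K: "positive_acs x K" and j: "j ** j = - mat 1"
  shows "complex_structure (bundle_tangent E (x, graph x K)) (bundle_acs x K j)"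
proof -
  have oK: "orth_acs (fmetric x) (pr x) K" using K by (simp add: positive_acs_def)
  have jj: "j *v (j *v X) = - X" for X
    by (simp add: matrix_vector_mul_assoc j matrix_neg_vmult)
  have "linear (bundle_acs x K j)"
    by (rule linearI)
      (simp_all add: bundle_acs_def matrix_vector_right_distrib linear_add [OF hor_linear]
        linear_scale [OF hor_linear] matrix_ring_simps matrix_vector_mult_scaleR scaleR_diff_right)
  moreover have "bundle_acs x K j v \<in> bundle_tangent E (x, graph x K) \<and> bundle_acs x K j (bundle_acs x K j v) = - v"
    if "v \<in> bundle_tangent E (x, graph x K)" for v
  proof -
    obtain X P where v: "v = (X, P)" by (cases v)
    then have P: "P - hor x K X \<in> vert_space (fmetric x) (pr x) K"
      using that by (simp add: bundle_tangent_graph [OF K])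
    have "K ** (K ** (P - hor x K X)) = - (P - hor x K X)"
      by (rule vert_space_mult_mult [OF oK P])
    then show ?thesis
      using vert_space_minus [OF vert_space_mult [OF oK P]]
      unfolding v bundle_tangent_graph [OF K]
      by (simp add: bundle_acs_def jj linear_neg [OF hor_linear] matrix_neg_rmult)
  qed
  ultimately show ?thesis
    unfolding complex_structure_def by blast
qed

lemma bundle_tangent_uminus:
  assumes K: "positive_acs x K" and "v \<in> bundle_tangent E (x, graph x K)"
  shows "- v \<in> bundle_tangent E (x, graph x K)"
proof -
  obtain X P where v: "v = (X, P)" by (cases v)
  then have P: "P - hor x K X \<in> vert_space (fmetric x) (pr x) K"
    using assms(2) by (simp add: bundle_tangent_graph [OF K])
  then show ?thesis
    using vert_space_minus [OF P] unfolding v bundle_tangent_graph [OF K]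
    by (simp add: linear_neg [OF hor_linear])
qed

lemma vertical_eig:
  assumes K: "positive_acs x K"
  shows "vertical10 E (x, graph x K) = {((0, Z), - (0, K ** Z)) |Z. Z \<in> vert_space (fmetric x) (pr x) K}"
    and "vertical01 E (x, graph x K) = {((0, Z), (0, K ** Z)) |Z. Z \<in> vert_space (fmetric x) (pr x) K}"
proof -
  have oK: "orth_acs (fmetric x) (pr x) K" using K by (simp add: positive_acs_def)
  let ?V = "vertical E (x, graph x K)" and ?J = "fibre_acs E (x, graph x K)"
  have J: "?J v \<in> ?V" "?J (?J v) = - v" "- v \<in> ?V" "?J (- v) = - ?J v" if "v \<in> ?V" for v
  proof -
    obtain Z where v: "v = (0, Z)" and Z: "Z \<in> vert_space (fmetric x) (pr x) K"
      using \<open>v \<in> ?V\<close> by (auto simp: vertical_graph [OF K])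
    have "K ** (K ** Z) = - Z"
      by (rule vert_space_mult_mult [OF oK Z])
    then show "?J v \<in> ?V" "?J (?J v) = - v" "- v \<in> ?V" "?J (- v) = - ?J v"
      using Z vert_space_mult [OF oK Z] vert_space_minus [OF Z]
      by (simp_all add: v fibre_acs_graph [OF K] vertical_graph [OF K] matrix_neg_rmult)
  qed
  have "vertical10 E (x, graph x K) = {(v, - ?J v) |v. v \<in> ?V}"
    unfolding vertical10_def using J by (intro eig_plus_i_complex_structure) auto
  then show "vertical10 E (x, graph x K) = {((0, Z), - (0, K ** Z)) |Z. Z \<in> vert_space (fmetric x) (pr x) K}"
    by (auto simp: vertical_graph [OF K] fibre_acs_graph [OF K])
  have "vertical01 E (x, graph x K) = {(v, ?J v) |v. v \<in> ?V}"
    unfolding vertical01_def using J by (intro eig_minus_i_complex_structure) auto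
  then show "vertical01 E (x, graph x K) = {((0, Z), (0, K ** Z)) |Z. Z \<in> vert_space (fmetric x) (pr x) K}"
    by (auto simp: vertical_graph [OF K] fibre_acs_graph [OF K])
qed

text \<open>A \<open>-i\<close>-eigenspace consists of the pairs \<open>(v, J v)\<close>; the pairs
  \<open>(Z, - K Z)\<close> of \<open>vertical10\<close> force the minus sign of
  \<open>bundle_acs\<close> on vertical vectors.\<close>

lemma acs_minus_bundle_acs:
  assumes K: "positive_acs x K" and j: "j ** j = - mat 1" and v: "v \<in> bundle_tangent E (x, graph x K)"
  shows "acs_minus (bundle_tangent E (x, graph x K))
    (ssum (horizontal_lift E (x, graph x K) {(X, j *v X) |X. True}) (vertical10 E (x, graph x K))) v
    = bundle_acs x K j v"
proof (rule acs_minus_eq [OF bundle_acs_complex_structure [OF K j] _ v])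
  let ?T = "bundle_tangent E (x, graph x K)"
  have "eig_minus_i ?T (bundle_acs x K j) = {(v, bundle_acs x K j v) |v. v \<in> ?T}"
    using bundle_acs_complex_structure [OF K j]
    by (intro eig_minus_i_complex_structure) (auto simp: complex_structure_def)
  also have "\<dots> = {((X, hor x K X + Z), (j *v X, hor x K (j *v X) - K ** Z)) |X Z. Z \<in> vert_space (fmetric x) (pr x) K}"
    (is "?L = ?R")
  proof (intro equalityI subsetI)
    fix z assume "z \<in> ?L"
    then obtain X P where "z = ((X, P), bundle_acs x K j (X, P))" "P - hor x K X \<in> vert_space (fmetric x) (pr x) K"
      by (auto simp: bundle_tangent_graph [OF K])
    then show "z \<in> ?R"
      by (intro CollectI exI [of _ X] exI [of _ "P - hor x K X"]) (simp add: bundle_acs_def)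
  next
    fix z assume "z \<in> ?R"
    then obtain X Z where "z = ((X, hor x K X + Z), (j *v X, hor x K (j *v X) - K ** Z))"
      "Z \<in> vert_space (fmetric x) (pr x) K" by blast
    then show "z \<in> ?L"
      by (intro CollectI exI [of _ "(X, hor x K X + Z)"]) (simp add: bundle_acs_def bundle_tangent_graph [OF K])
  qed
  also have "\<dots> = ssum (horizontal_lift E (x, graph x K) {(X, j *v X) |X. True}) (vertical10 E (x, graph x K))"
  proof -
    have "horizontal_lift E (x, graph x K) {(X, j *v X) |X. True} = {((X, hor x K X), (j *v X, hor x K (j *v X))) |X. True}"
      by (auto simp: horizontal_lift_def horizontal_graph [OF K] cmap_def)
    then show ?thesis
      unfolding vertical_eig [OF K] ssum_def by fastforce
  qed
  finally show "eig_minus_i ?T (bundle_acs x K j) =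
    ssum (horizontal_lift E (x, graph x K) {(X, j *v X) |X. True}) (vertical10 E (x, graph x K))" .
qed

text \<open>Both summands are the complex conjugates of those in
  \<open>acs_minus_bundle_acs\<close>, and so is the eigenvalue; hence the same formula. This brings
  \<open>J_section\<close> to the form found for \<open>J_nonint\<close>.\<close>

lemma acs_plus_bundle_acs:
  assumes K: "positive_acs x K" and j: "j ** j = - mat 1" and v: "v \<in> bundle_tangent E (x, graph x K)"
  shows "acs_plus (bundle_tangent E (x, graph x K))
    (ssum (horizontal_lift E (x, graph x K) {(X, - (j *v X)) |X. True}) (vertical01 E (x, graph x K))) v
    = bundle_acs x K j v"
proof (rule acs_plus_eq [OF bundle_acs_complex_structure [OF K j] _ v])
  let ?T = "bundle_tangent E (x, graph x K)"
  show "- v \<in> ?T" if "v \<in> ?T" for v by (rule bundle_tangent_uminus [OF K that])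
  have "eig_plus_i ?T (bundle_acs x K j) = {(v, - bundle_acs x K j v) |v. v \<in> ?T}"
    using bundle_acs_complex_structure [OF K j] bundle_tangent_uminus [OF K] linear_neg
    by (intro eig_plus_i_complex_structure) (auto simp: complex_structure_def)
  also have "\<dots> = {((X, hor x K X + Z), - (j *v X, hor x K (j *v X) - K ** Z)) |X Z. Z \<in> vert_space (fmetric x) (pr x) K}"
    (is "?L = ?R")
  proof (intro equalityI subsetI)
    fix z assume "z \<in> ?L"
    then obtain X P where "z = ((X, P), - bundle_acs x K j (X, P))" "P - hor x K X \<in> vert_space (fmetric x) (pr x) K"
      by (auto simp: bundle_tangent_graph [OF K])
    then show "z \<in> ?R"
      by (intro CollectI exI [of _ X] exI [of _ "P - hor x K X"]) (simp add: bundle_acs_def)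
  next
    fix z assume "z \<in> ?R"
    then obtain X Z where "z = ((X, hor x K X + Z), - (j *v X, hor x K (j *v X) - K ** Z))"
      "Z \<in> vert_space (fmetric x) (pr x) K" by blast
    then show "z \<in> ?L"
      by (intro CollectI exI [of _ "(X, hor x K X + Z)"]) (simp add: bundle_acs_def bundle_tangent_graph [OF K])
  qed
  also have "\<dots> = ssum (horizontal_lift E (x, graph x K) {(X, - (j *v X)) |X. True}) (vertical01 E (x, graph x K))"
  proof -
    have "horizontal_lift E (x, graph x K) {(X, - (j *v X)) |X. True} = {((X, hor x K X), - (j *v X, hor x K (j *v X))) |X. True}"
      by (auto simp: horizontal_lift_def horizontal_graph [OF K] cmap_def linear_neg [OF hor_linear])
    then show ?thesis
      unfolding vertical_eig [OF K] ssum_def by fastforce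
  qed
  finally show "eig_plus_i ?T (bundle_acs x K j) =
    ssum (horizontal_lift E (x, graph x K) {(X, - (j *v X)) |X. True}) (vertical01 E (x, graph x K))" .
qed

end

section \<open>Holomorphic sections\<close>

lemma eig_minus_i_mem:
  assumes "complex_structure V J'" "\<And>v. v \<in> V \<Longrightarrow> J v = J' v"
  shows "(a, b) \<in> eig_minus_i V J \<longleftrightarrow> a \<in> V \<and> b = J' a"
  using assms by (auto simp: eig_minus_i_def cmap_def cI_def complex_structure_def)

lemma (in oriented_manifold) tangent_space_UNIV: "tangent_space (mfd_velocity A) UNIV x = UNIV"
proof (rule equalityI [OF subset_UNIV], rule subsetI)
  fix X
  obtain \<gamma> where "\<gamma> 0 = x" "mfd_velocity A \<gamma> X" by (rule velocity_exists)
  then show "X \<in> tangent_space (mfd_velocity A) UNIV x"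
    by (auto simp: tangent_space_def)
qed

context weyl_bundle
begin

definition acs_of :: "('x \<Rightarrow> (real^'n) cx set) \<Rightarrow> 'x \<Rightarrow> real^'n^'n" where
  "acs_of \<sigma> x = acs_matrix E (x, \<sigma> x)"

definition section_deriv :: "('x \<Rightarrow> (real^'n) cx set) \<Rightarrow> 'x \<Rightarrow> real^'m \<Rightarrow> real^'n^'n" where
  "section_deriv \<sigma> x = fn_deriv A (\<lambda>z. acs_coord E x (z, \<sigma> z)) x"

text \<open>The covariant derivative of the complex structure given by a section.\<close>

definition section_cov :: "('x \<Rightarrow> (real^'n) cx set) \<Rightarrow> 'x \<Rightarrow> real^'m \<Rightarrow> real^'n^'n" where
  "section_cov \<sigma> x X = section_deriv \<sigma> x X - hor x (acs_of \<sigma> x) X"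

lemma acs_of:
  assumes "(x, \<sigma> x) \<in> isotropic_bundle E"
  shows "positive_acs x (acs_of \<sigma> x)" "\<sigma> x = graph x (acs_of \<sigma> x)" "orth_acs (fmetric x) (pr x) (acs_of \<sigma> x)"
proof -
  obtain K where K: "positive_acs x K" "\<sigma> x = graph x K"
    using assms unfolding isotropic_bundle_iff by blast
  then have "acs_of \<sigma> x = K"
    by (simp add: acs_of_def acs_matrix_graph positive_acs_def)
  with K show "positive_acs x (acs_of \<sigma> x)" "\<sigma> x = graph x (acs_of \<sigma> x)" "orth_acs (fmetric x) (pr x) (acs_of \<sigma> x)"
    by (simp_all add: positive_acs_def)
qed

lemma smooth_section_mderiv:
  assumes "smooth_section E \<sigma>"
  shows "has_mderiv A (\<lambda>z. acs_coord E x (z, \<sigma> z)) (section_deriv \<sigma> x) x"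
proof -
  have "smooth_fn A (f -` fst (chart_at B (f x))) (\<lambda>z. acs_coord E x (z, \<sigma> z))"
    using assms by (simp add: smooth_section_def bundle_simps)
  from dom.smooth_fn_has_mderiv [OF open_map_chart _ this, of x]
  show ?thesis unfolding section_deriv_def using cod.chart_at(2) by simp
qed

lemma section_velocity:
  assumes "smooth_section E \<sigma>" and \<gamma>: "mfd_velocity A \<gamma> X" "\<gamma> 0 = x"
  shows "bundle_velocity E (\<lambda>t. (\<gamma> t, \<sigma> (\<gamma> t))) (X, section_deriv \<sigma> x X)"
  using dom.velocity_compose [OF \<gamma> smooth_section_mderiv [OF assms(1)]] \<gamma>
  by (simp add: bundle_velocity_def bundle_simps o_def)

lemma differential_section:
  assumes "smooth_section E \<sigma>"
  shows "differential (mfd_velocity A) UNIV (bundle_velocity E) (\<lambda>x. (x, \<sigma> x)) x X = (X, section_deriv \<sigma> x X)"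
  unfolding differential_def
proof (rule the_equality)
  obtain \<gamma> where "\<gamma> 0 = x" "mfd_velocity A \<gamma> X" by (rule dom.velocity_exists)
  then show "\<exists>\<gamma>. (\<forall>t. \<gamma> t \<in> UNIV) \<and> \<gamma> 0 = x \<and> mfd_velocity A \<gamma> X \<and>
      bundle_velocity E ((\<lambda>x. (x, \<sigma> x)) \<circ> \<gamma>) (X, section_deriv \<sigma> x X)"
    using section_velocity [OF assms] by (auto simp: o_def)
next
  fix w assume "\<exists>\<gamma>. (\<forall>t. \<gamma> t \<in> UNIV) \<and> \<gamma> 0 = x \<and> mfd_velocity A \<gamma> X \<and>
      bundle_velocity E ((\<lambda>x. (x, \<sigma> x)) \<circ> \<gamma>) w"
  then obtain \<gamma> where \<gamma>: "\<gamma> 0 = x" "mfd_velocity A \<gamma> X" "bundle_velocity E (\<lambda>t. (\<gamma> t, \<sigma> (\<gamma> t))) w"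
    by (auto simp: o_def)
  from bundle_velocity_unique [OF \<gamma>(3) section_velocity [OF assms \<gamma>(2,1)]]
  show "w = (X, section_deriv \<sigma> x X)" .
qed

lemma section_tangent:
  assumes "smooth_section E \<sigma>"
  shows "tangent_space (bundle_velocity E) (section_image \<sigma>) (x, \<sigma> x) = {(X, section_deriv \<sigma> x X) |X. True}"
proof (intro equalityI subsetI)
  fix v assume "v \<in> tangent_space (bundle_velocity E) (section_image \<sigma>) (x, \<sigma> x)"
  then obtain \<gamma> where \<gamma>: "\<And>t. \<gamma> t \<in> section_image \<sigma>" "\<gamma> 0 = (x, \<sigma> x)" "bundle_velocity E \<gamma> v"
    by (auto simp: tangent_space_def)
  have eq: "\<gamma> = (\<lambda>t. (fst (\<gamma> t), \<sigma> (fst (\<gamma> t))))"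
  proof
    show "\<gamma> t = (fst (\<gamma> t), \<sigma> (fst (\<gamma> t)))" for t
      using \<gamma>(1) [of t] by (auto simp: section_image_def)
  qed
  have "mfd_velocity A (\<lambda>t. fst (\<gamma> t)) (fst v)"
    using \<gamma>(3) by (simp add: bundle_velocity_def bundle_simps o_def)
  from section_velocity [OF assms this] have "bundle_velocity E \<gamma> (fst v, section_deriv \<sigma> x (fst v))"
    using eq \<gamma>(2) by simp
  from bundle_velocity_unique [OF \<gamma>(3) this] show "v \<in> {(X, section_deriv \<sigma> x X) |X. True}" by blast
next
  fix v assume "v \<in> {(X, section_deriv \<sigma> x X) |X. True}"
  then obtain X where v: "v = (X, section_deriv \<sigma> x X)" by blast
  obtain \<gamma> where \<gamma>: "\<gamma> 0 = x" "mfd_velocity A \<gamma> X" by (rule dom.velocity_exists)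
  from section_velocity [OF assms \<gamma>(2,1)]
  show "v \<in> tangent_space (bundle_velocity E) (section_image \<sigma>) (x, \<sigma> x)"
    unfolding tangent_space_def v mem_Collect_eq
    by (intro exI [of _ "\<lambda>t. (\<gamma> t, \<sigma> (\<gamma> t))"]) (simp add: \<gamma> section_image_def)
qed

lemma section_deriv_in_tangent:
  assumes "smooth_section E \<sigma>"
  shows "(X, section_deriv \<sigma> x X) \<in> bundle_tangent E (x, \<sigma> x)"
proof -
  obtain \<gamma> where \<gamma>: "\<gamma> 0 = x" "mfd_velocity A \<gamma> X" by (rule dom.velocity_exists)
  have "(z, \<sigma> z) \<in> isotropic_bundle E" for z using assms by (simp add: smooth_section_def)
  with section_velocity [OF assms \<gamma>(2,1)] show ?thesis
    unfolding tangent_space_def mem_Collect_eq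
    by (intro exI [of _ "\<lambda>t. (\<gamma> t, \<sigma> (\<gamma> t))"]) (simp add: \<gamma>)
qed

text \<open>The horizontal terms over \<open>j *v X\<close> agree on both sides; comparing the
  vertical ones leaves the covariant derivative.\<close>

lemma bundle_acs_section:
  "bundle_acs x (acs_of \<sigma> x) j (X, section_deriv \<sigma> x X) = (j *v X, section_deriv \<sigma> x (j *v X)) \<longleftrightarrow>
    section_cov \<sigma> x (j *v X) = - (acs_of \<sigma> x ** section_cov \<sigma> x X)"
  by (auto simp: bundle_acs_def section_cov_def algebra_simps)

text \<open>\<open>JE\<close> is prescribed on tangent vectors only, its other values being due to
  an arbitrary choice; this suffices because the derivative of a section is tangent to the
  bundle.\<close>

lemma holomorphic_section_iff:
  assumes \<sigma>: "smooth_section E \<sigma>" and Jb: "\<And>x v. Jb x v = j x *v v" "\<And>x. j x ** j x = - mat 1"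
    and JE: "\<And>x v. v \<in> bundle_tangent E (x, \<sigma> x) \<Longrightarrow> JE (x, \<sigma> x) v = bundle_acs x (acs_of \<sigma> x) (j x) v"
  shows "holomorphic_map (mfd_velocity A) UNIV Jb (bundle_velocity E) (isotropic_bundle E) JE (\<lambda>x. (x, \<sigma> x)) \<longleftrightarrow>
    (\<forall>x X. section_cov \<sigma> x (j x *v X) = - (acs_of \<sigma> x ** section_cov \<sigma> x X))"
proof -
  have mem: "(x, \<sigma> x) \<in> isotropic_bundle E" for x using \<sigma> by (simp add: smooth_section_def)
  have jj: "j x *v (j x *v v) = - v" for x v
    by (simp add: matrix_vector_mul_assoc Jb(2) matrix_neg_vmult)
  have e1: "eig_minus_i UNIV (Jb x) = {(v, j x *v v) |v. True}" for x
    using eig_minus_i_complex_structure [of "Jb x" UNIV] by (simp add: Jb(1) jj)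
  have cs: "complex_structure (bundle_tangent E (x, \<sigma> x)) (bundle_acs x (acs_of \<sigma> x) (j x))" for x
    using bundle_acs_complex_structure [OF acs_of(1) [where \<sigma> = \<sigma>, OF mem] Jb(2)]
      acs_of(2) [where \<sigma> = \<sigma>, OF mem] by simp
  have "(cmap (differential (mfd_velocity A) UNIV (bundle_velocity E) (\<lambda>x. (x, \<sigma> x)) x) ` {(v, j x *v v) |v. True}
        \<subseteq> eig_minus_i (bundle_tangent E (x, \<sigma> x)) (JE (x, \<sigma> x))) \<longleftrightarrow>
      (\<forall>X. section_cov \<sigma> x (j x *v X) = - (acs_of \<sigma> x ** section_cov \<sigma> x X))" for x
  proof -
    have "(cmap (differential (mfd_velocity A) UNIV (bundle_velocity E) (\<lambda>x. (x, \<sigma> x)) x) ` {(v, j x *v v) |v. True}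
        \<subseteq> eig_minus_i (bundle_tangent E (x, \<sigma> x)) (JE (x, \<sigma> x))) \<longleftrightarrow>
      (\<forall>X. ((X, section_deriv \<sigma> x X), (j x *v X, section_deriv \<sigma> x (j x *v X)))
         \<in> eig_minus_i (bundle_tangent E (x, \<sigma> x)) (JE (x, \<sigma> x)))"
      unfolding image_subset_iff by (auto simp: cmap_def differential_section [OF \<sigma>])
    also have "\<dots> \<longleftrightarrow> (\<forall>X. bundle_acs x (acs_of \<sigma> x) (j x) (X, section_deriv \<sigma> x X) = (j x *v X, section_deriv \<sigma> x (j x *v X)))"
      using eig_minus_i_mem [OF cs JE] section_deriv_in_tangent [OF \<sigma>] by (simp add: eq_commute)
    finally show ?thesis by (simp only: bundle_acs_section)
  qed
  then show ?thesis
    unfolding holomorphic_map_def dom.tangent_space_UNIV e1 by (simp add: mem)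
qed

end

section \<open>The tangent bundle of a Weyl space\<close>

lemma card_less_CARD: "card {k :: 'n::{finite,linorder}. k < j} < CARD('n)"
  by (rule psubset_card_mono) auto

lemma positive_basis_map:
  fixes ws :: "(real^'n::{finite,linorder}) list"
  assumes "positive_basis ws" "det F > 0"
  shows "positive_basis (map ((*v) F) ws)"
proof -
  let ?W = "\<chi> i (j :: 'n). (ws ! card {k. k < j}) $ i"
  have "card {k. k < j} < length ws" for j :: 'n
    using assms(1) card_less_CARD by (simp add: positive_basis_def)
  then have "(\<chi> i (j :: 'n). (map ((*v) F) ws ! card {k. k < j}) $ i) = F ** ?W"
    by (simp add: vec_eq_iff matrix_matrix_mult_def matrix_vector_mult_def)
  then show ?thesis
    using assms by (simp add: positive_basis_def det_mul)
qed

locale tangent_bundle = oriented_weyl_space A c D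
  for A :: "('x::{t2_space,second_countable_topology}, 'm::{finite,linorder}) atlas"
    and c :: "('x, 'm) metric set" and D :: "('x, 'm) covd"
begin

abbreviation "TM \<equiv> tangent_obundle A c D"

lemma tangent_fibre: "fibre TM x = UNIV"
proof -
  have "g x v 0 = 0" if g: "g \<in> c" for g v
  proof -
    obtain l where "\<forall>v w. g x v w = l * metric x v w" using conformal_factor [OF g] by blast
    then show ?thesis by (simp add: metric_eq)
  qed
  then show ?thesis by (auto simp: fibre_def tangent_obundle_def)
qed

lemma tangent_proj: "proj TM x v = v"
  unfolding proj_def tangent_fibre by (simp add: tangent_obundle_def)

lemma tangent_weyl_subbundle: "weyl_subbundle A A id c D TM"
  by (intro weyl_subbundle.intro smooth_mfd_map_id oriented_weyl_space_axioms weyl_subbundle_axioms.intro)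
    (simp_all add: tangent_obundle_def)

end

text \<open>In two stages, since the axioms of \<open>weyl_bundle\<close> are stated with
  \<open>pr\<close>, which is available only after the first.\<close>

sublocale tangent_bundle \<subseteq> weyl_subbundle A A id c D "tangent_obundle A c D"
  by (rule tangent_weyl_subbundle)

context tangent_bundle
begin

lemma tangent_pr: "pr x = mat 1"
  by (simp add: matrix_eq pr_apply tangent_proj)

lemma tangent_weyl_bundle: "weyl_bundle A A id c D TM"
proof (intro weyl_bundle.intro weyl_subbundle_axioms weyl_bundle_axioms.intro)
  fix x :: 'x
  show "\<exists>D'. has_mderiv A (\<lambda>z. to_at A (id x) (id z) ** pr z ** from_at A (id x) (id z)) D' x"
  proof (rule exI [of _ "\<lambda>h. 0"], rule has_mderiv_cong [OF _ has_mderiv_const [of _ "mat 1"]])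
    show "\<forall>\<^sub>F z in nhds x. mat 1 = to_at A (id x) (id z) ** pr z ** from_at A (id x) (id z)"
      using eventually_chart_at by eventually_elim (simp add: tangent_pr to_at_from_at)
  qed
next
  fix ws :: "(real, 'm) vec list" and x :: 'x and \<gamma> :: "real \<Rightarrow> 'x" and M :: "real \<Rightarrow> ((real, 'm) vec, 'm) vec"
  assume ws: "ws \<in> borient TM x" and \<gamma>: "(\<gamma> \<longlongrightarrow> x) (at 0)" and M: "(M \<longlongrightarrow> mat 1) (at 0)"
  have "((\<lambda>t. det (M t)) \<longlongrightarrow> 1) (at 0)" using tendsto_det [OF M] by simp
  then have "\<forall>\<^sub>F t in at 0. det (M t) > 0" by (rule order_tendstoD) simp
  moreover have "\<forall>\<^sub>F t in at 0. \<gamma> t \<in> fst (chart_at A x)"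
    by (rule eventually_compose_filterlim [OF eventually_chart_at \<gamma>])
  ultimately show "\<forall>\<^sub>F t in at 0. map (\<lambda>w. (from_at A (id x) (id (\<gamma> t)) ** M t) *v w) ws \<in> borient TM (\<gamma> t)"
  proof eventually_elim
    case (elim t)
    then have "det (from_at A x (\<gamma> t) ** M t) > 0"
      using to_at_from_at(4) [OF elim(2)] by (simp add: det_mul)
    then show ?case
      using ws positive_basis_map by (simp add: tangent_obundle_def)
  qed
qed

end

sublocale tangent_bundle \<subseteq> weyl_bundle A A id c D "tangent_obundle A c D"
  by (rule tangent_weyl_bundle)

context tangent_bundle
begin

lemma tangent_dpr: "dpr x X = 0"
proof -
  have "has_mderiv A (pr_at x) (\<lambda>h. 0) x"
  proof (rule has_mderiv_cong [OF _ has_mderiv_const])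
    show "\<forall>\<^sub>F z in nhds x. mat 1 = pr_at x z"
      using eventually_chart_at by eventually_elim (simp add: pr_at_def tangent_pr to_at_from_at)
  qed
  then show ?thesis using has_mderiv_unique [OF pr_at_mderiv] by metis
qed

lemma tangent_hor: "hor x K X = K ** conn_matrix x X - conn_matrix x X ** K"
  by (simp add: hor_def hor_part_def tangent_pr tangent_dpr conn_def)

lemma tangent_graph: "graph x K = {(v, K *v v) |v. True}"
  by (simp add: graph_def tangent_fibre)

lemma tangent_orth_acs: "orth_acs (fmetric x) (pr x) K \<longleftrightarrow> K ** K = - mat 1 \<and> skew_adjoint (metric_matrix x) K"
  by (simp add: orth_acs_def tangent_pr fmetric_def)

lemma J_nonint_graph:
  assumes K: "positive_acs x K" and v: "v \<in> bundle_tangent TM (x, graph x K)"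
  shows "J_nonint A c D (x, graph x K) v = bundle_acs x K K v"
proof -
  have "K ** K = - mat 1" using K by (simp add: positive_acs_def tangent_orth_acs)
  from acs_minus_bundle_acs [OF K this v, folded tangent_graph [of x K]] show ?thesis
    unfolding J_nonint_def Let_def snd_conv .
qed

lemma J_base_graph:
  assumes K: "K ** K = - mat 1" and p: "p x = {(v, K *v v) |v. True}"
  shows "J_base p x v = K *v v"
  unfolding J_base_def
proof (rule acs_minus_eq)
  have KK: "K *v (K *v v) = - v" for v by (simp add: matrix_vector_mul_assoc K matrix_neg_vmult)
  show "complex_structure UNIV ((*v) K)" by (simp add: complex_structure_def KK)
  show "eig_minus_i UNIV ((*v) K) = p x"
    unfolding p using KK by (subst eig_minus_i_complex_structure) auto
qed simp

end

section \<open>Orientations\<close>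

text \<open>The rows placed at \<open>range \<iota>\<close> depend on the rows of \<open>W\<close>
  in an alternating multilinear way, hence through \<open>det W\<close>; the proof reduces
  \<open>W\<close> by elementary operations. The formula compares two bases of a subspace completed
  in the same way.\<close>

lemma det_partial_linear_image:
  fixes \<iota> :: "'m::finite \<Rightarrow> 'n::finite" and b :: "'n \<Rightarrow> real^'n" and W :: "real^'m^'m"
  assumes \<iota>: "inj \<iota>" and L: "linear L"
  shows "det (\<chi> i. if i \<in> range \<iota> then L (row (inv \<iota> i) W) else b i)
    = det W * det (\<chi> i. if i \<in> range \<iota> then L (axis (inv \<iota> i) 1) else b i)"
proof -
  define X where "X L W = (\<chi> i. if i \<in> range \<iota> then L (row (inv \<iota> i) W) else b i)"
    for L :: "real^'m \<Rightarrow> real^'n" and W :: "real^'m^'m"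
  define X1 where "X1 L = (\<chi> i. if i \<in> range \<iota> then L (axis (inv \<iota> i) 1) else b i)"
    for L :: "real^'m \<Rightarrow> real^'n"
  have rX: "row (\<iota> j) (X L W) = L (row j W)" for j L W
    by (simp add: X_def row_def vec_lambda_eta \<iota>)
  have Xj: "X L W $ \<iota> j = L (row j W)" and X1j: "X1 L $ \<iota> j = L (axis j 1)" for j L W
    by (simp_all add: X_def X1_def \<iota>)
  have Xo: "X L W $ i = b i" and X1o: "X1 L $ i = b i" if "i \<notin> range \<iota>" for i L W
    using that by (simp_all add: X_def X1_def)
  \<comment> \<open>\<open>L\<close> stays general because the exchange case permutes the columns of
    \<open>W\<close>, which is absorbed by composing \<open>L\<close> with a permutation of
    coordinates.\<close>
  have "\<forall>L. linear L \<longrightarrow> det (X L W) = det W * det (X1 L)"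
  proof (induction W rule: induct_matrix_row_operations)
    case (1 W i)
    have "det (X L W) = 0" if "linear L" for L
      by (rule det_zero_row(2) [of "\<iota> i"]) (simp add: rX 1 linear_0 [OF that])
    moreover have "det W = 0" by (rule det_zero_row(2) [OF 1])
    ultimately show ?case by simp
  next
    case (2 W)
    show ?case
    proof (intro allI impI)
      fix L :: "real^'m \<Rightarrow> real^'n" assume L: "linear L"
      have rW: "row j W = (W $ j $ j) *\<^sub>R axis j 1" for j
        using 2 by (auto simp: row_def vec_eq_iff axis_def)
      define k where "k i = (if i \<in> range \<iota> then W $ inv \<iota> i $ inv \<iota> i else 1)" for i
      have "X L W = (\<chi> i. k i *s X1 L $ i)"
        by (auto simp: vec_eq_iff X_def X1_def k_def rW linear_scale [OF L])
      then have "det (X L W) = prod k UNIV * det (X1 L)"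
        by (simp add: det_rows_mul vec_lambda_eta)
      also have "prod k UNIV = prod k (range \<iota>)"
        by (rule prod.mono_neutral_right) (auto simp: k_def)
      also have "\<dots> = (\<Prod>j\<in>UNIV. W $ j $ j)"
        by (simp add: prod.reindex \<iota> k_def)
      also have "\<dots> = det W"
        using 2 by (simp add: det_diagonal)
      finally show "det (X L W) = det W * det (X1 L)" .
    qed
  next
    case (3 W m n)
    let ?\<sigma> = "Transposition.transpose m n" and ?\<tau> = "Transposition.transpose (\<iota> m) (\<iota> n)"
    let ?S = "\<lambda>r :: real^'m. \<chi> j. r $ ?\<sigma> j"
    show ?case
    proof (intro allI impI)
      fix L :: "real^'m \<Rightarrow> real^'n" assume L: "linear L"
      have "linear ?S" by (rule linearI) (simp_all add: vec_eq_iff)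
      then have LS: "linear (L \<circ> ?S)" using L by (rule linear_compose)
      have rS: "row j (\<chi> i j. W $ i $ ?\<sigma> j) = ?S (row j W)" for j
        by (simp add: row_def vec_eq_iff)
      have "X L (\<chi> i j. W $ i $ ?\<sigma> j) = X (L \<circ> ?S) W"
        unfolding X_def rS o_def ..
      then have "det (X L (\<chi> i j. W $ i $ ?\<sigma> j)) = det W * det (X1 (L \<circ> ?S))"
        using 3(1) [rule_format, OF LS] by (simp only:)
      also have "X1 (L \<circ> ?S) = (\<chi> i. X1 L $ ?\<tau> i)"
      proof -
        have S: "?S (axis j 1) = axis (?\<sigma> j) 1" for j
          by (auto simp: vec_eq_iff axis_def transpose_eq_iff)
        have "X1 (L \<circ> ?S) $ i = X1 L $ ?\<tau> i" for i
        proof (cases "i \<in> range \<iota>")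
          case True
          then obtain j where j: "i = \<iota> j" by blast
          have "?\<tau> (\<iota> j) = \<iota> (?\<sigma> j)"
            using \<iota> by (auto simp: Transposition.transpose_def inj_eq)
          then show ?thesis by (simp add: j X1j S)
        next
          case False
          then have "?\<tau> i = i" by (auto simp: Transposition.transpose_def)
          then show ?thesis by (simp add: X1o [OF False])
        qed
        then show ?thesis by (simp add: vec_eq_iff)
      qed
      also have "det (\<chi> i. X1 L $ ?\<tau> i) = - det (X1 L)"
        using \<iota> 3 by (subst det_permute_rows) (simp_all add: permutes_swap_id sign_swap_id inj_eq)
      also have "det W * - det (X1 L) = det (\<chi> i j. W $ i $ ?\<sigma> j) * det (X1 L)"
        using 3 by (subst det_permute_columns) (simp_all add: permutes_swap_id sign_swap_id)
      finally show "det (X L (\<chi> i j. W $ i $ ?\<sigma> j)) = det (\<chi> i j. W $ i $ ?\<sigma> j) * det (X1 L)" .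
    qed
  next
    case (4 W m n c)
    let ?W = "\<chi> i. if i = m then row m W + c *\<^sub>R row n W else row i W"
    show ?case
    proof (intro allI impI)
      fix L :: "real^'m \<Rightarrow> real^'n" assume L: "linear L"
      have rW: "row j ?W = (if j = m then row m W + c *\<^sub>R row n W else row j W)" for j
        by (simp add: row_def vec_eq_iff)
      have "X L ?W $ i = (if i = \<iota> m then row (\<iota> m) (X L W) + c *s row (\<iota> n) (X L W) else row i (X L W))" for i
      proof (cases "i \<in> range \<iota>")
        case True
        then obtain j where j: "i = \<iota> j" by blast
        show ?thesis
          unfolding j Xj rX using \<iota>
          by (simp add: rW linear_add [OF L] linear_scale [OF L] inj_eq scalar_mult_eq_scaleR)
      next
        case False
        then show ?thesis by (auto simp: Xo row_def vec_eq_iff)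
      qed
      then have eq: "X L ?W = (\<chi> i. if i = \<iota> m then row (\<iota> m) (X L W) + c *s row (\<iota> n) (X L W) else row i (X L W))"
        by (simp add: vec_eq_iff)
      have "\<iota> m \<noteq> \<iota> n" using \<iota> 4 by (simp add: inj_eq)
      then have "det (X L ?W) = det (X L W)"
        unfolding eq by (rule det_row_operation)
      also have "\<dots> = det W * det (X1 L)" using 4 L by simp
      also have "det W = det ?W"
        by (rule det_row_operation [OF 4(2), where A = W and c = c, unfolded scalar_mult_eq_scaleR, symmetric])
      finally show "det (X L ?W) = det ?W * det (X1 L)" .
    qed
  qed
  then show ?thesis using L by (simp add: X_def X1_def)
qed

section \<open>Positive bases as concatenated lists\<close>

definition idx :: "'n::{finite,linorder} \<Rightarrow> nat" where
  "idx j = card {k. k < j}"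

lemma idx_less: "idx (j :: 'n::{finite,linorder}) < CARD('n)"
  unfolding idx_def by (rule card_less_CARD)

lemma inj_idx: "inj (idx :: 'n::{finite,linorder} \<Rightarrow> nat)"
proof (rule injI, rule ccontr)
  fix i j :: 'n assume eq: "idx i = idx j" and "i \<noteq> j"
  have "idx a < idx b" if "a < b" for a b :: 'n
    unfolding idx_def using that by (intro psubset_card_mono) auto
  with eq \<open>i \<noteq> j\<close> show False by (metis less_irrefl linorder_neqE)
qed

lemma range_idx: "range (idx :: 'n::{finite,linorder} \<Rightarrow> nat) = {..<CARD('n)}"
  using idx_less by (intro card_subset_eq) (auto simp: card_image inj_idx)

definition list_det :: "(real^'n::{finite,linorder}) list \<Rightarrow> real" where
  "list_det vs = det (\<chi> i j. (vs ! idx j) $ i)"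

lemma positive_basis_list_det:
  "positive_basis (vs :: (real^'n::{finite,linorder}) list) \<longleftrightarrow> length vs = CARD('n) \<and> list_det vs > 0"
  by (simp add: positive_basis_def list_det_def idx_def)

text \<open>The index embedding \<open>\<iota>\<close> matches positions in the lists: it sends the
  indices of the small space to the first ones of the large space. After transposition, as
  \<open>det_partial_linear_image\<close> works with rows, the factor \<open>det W\<close> is the
  determinant of \<open>vs\<close> and the other one does not involve \<open>vs\<close>.\<close>

lemma list_det_append:
  fixes L :: "(real, 'm::{finite,linorder}) vec \<Rightarrow> (real, 'n::{finite,linorder}) vec"
  assumes L: "linear L" and vs: "length vs = CARD('m)" and le: "CARD('m) \<le> CARD('n)"
  shows "list_det (map L vs @ ws) = list_det vs * list_det (map L (map (\<lambda>k. axis (inv idx k) 1) [0..<CARD('m)]) @ ws)"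
proof -
  define \<iota> :: "'m \<Rightarrow> 'n" where "\<iota> j = inv idx (idx j)" for j
  have idx_\<iota>: "idx (\<iota> j) = idx j" for j
  proof -
    have "idx j \<in> range (idx :: 'n \<Rightarrow> nat)" using idx_less [of j] le by (simp add: range_idx)
    then show ?thesis unfolding \<iota>_def by (rule f_inv_into_f)
  qed
  have \<iota>: "inj \<iota>"
    using idx_\<iota> inj_idx by (metis injD injI)
  have out: "idx i \<ge> CARD('m)" if "i \<notin> range \<iota>" for i
  proof (rule ccontr)
    assume "\<not> idx i \<ge> CARD('m)"
    then have "idx i \<in> range (idx :: 'm \<Rightarrow> nat)" by (simp add: range_idx)
    then obtain j :: 'm where "idx j = idx i" by (auto elim: sym)
    then have "\<iota> j = i" using idx_\<iota> [of j] inj_idx by (metis injD)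
    then show False using that by blast
  qed
  have key: "list_det (map L us @ ws) = det (\<chi> i. if i \<in> range \<iota> then L (us ! idx (inv \<iota> i)) else ws ! (idx i - CARD('m)))"
    if us: "length us = CARD('m)" for us
  proof -
    have "(map L us @ ws) ! idx i = (if i \<in> range \<iota> then L (us ! idx (inv \<iota> i)) else ws ! (idx i - CARD('m)))" for i
    proof (cases "i \<in> range \<iota>")
      case True
      then obtain j where "i = \<iota> j" by blast
      then show ?thesis using us \<iota> idx_less [of j] by (simp add: idx_\<iota> nth_append)
    next
      case False
      then show ?thesis using out us by (simp add: nth_append not_less [symmetric])
    qed
    then have eq: "transpose (\<chi> i j. (map L us @ ws) ! idx j $ i) = (\<chi> i. if i \<in> range \<iota> then L (us ! idx (inv \<iota> i)) else ws ! (idx i - CARD('m)))"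
      by (simp add: vec_eq_iff transpose_def)
    show ?thesis
      unfolding list_det_def eq [symmetric] by (rule det_transpose [symmetric])
  qed
  define W :: "((real, 'm) vec, 'm) vec" where "W = (\<chi> i j. (vs ! idx i) $ j)"
  have rW: "row j W = vs ! idx j" for j by (simp add: W_def row_def vec_lambda_eta)
  have dW: "det W = list_det vs"
  proof -
    have "W = transpose (\<chi> i j. (vs ! idx j) $ i)" by (simp add: W_def transpose_def)
    then show ?thesis by (simp add: list_det_def)
  qed
  have ax: "map (\<lambda>k. axis (inv idx k) 1) [0..<CARD('m)] ! idx j = (axis j 1 :: (real, 'm) vec)" for j :: 'm
    using idx_less [of j] by (simp add: inj_idx)
  show ?thesis
    unfolding key [OF vs]
    using det_partial_linear_image [OF \<iota> L, of W "\<lambda>i. ws ! (idx i - CARD('m))"] key [of "map (\<lambda>k. axis (inv idx k) 1) [0..<CARD('m)]"]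
    by (simp only: rW dW ax length_map length_upt diff_zero)
qed

text \<open>The normal orientation asks for some positive basis of the tangent space; by the product
  formula any other one serves, in particular one adapted to \<open>p\<close>.\<close>

lemma positive_basis_append_exchange:
  fixes L :: "(real, 'm::{finite,linorder}) vec \<Rightarrow> (real, 'n::{finite,linorder}) vec"
  assumes L: "linear L" and vs: "positive_basis vs" and us: "positive_basis us"
    and pos: "positive_basis (map L vs @ ws)"
  shows "positive_basis (map L us @ ws)"
proof -
  have len: "length vs = CARD('m)" "length us = CARD('m)" "CARD('m) + length ws = CARD('n)"
    using vs us pos by (simp_all add: positive_basis_list_det)
  then have le: "CARD('m) \<le> CARD('n)" by simp
  show ?thesis
    using vs us pos list_det_append [OF L len(1) le, of ws] list_det_append [OF L len(2) le, of ws] len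
    by (simp add: positive_basis_list_det zero_less_mult_iff)
qed

lemma tendsto_list_det:
  fixes vs :: "'z \<Rightarrow> (real^'n::{finite,linorder}) list"
  assumes "\<And>k. k < CARD('n) \<Longrightarrow> ((\<lambda>t. vs t ! k) \<longlongrightarrow> us ! k) F"
  shows "((\<lambda>t. list_det (vs t)) \<longlongrightarrow> list_det us) F"
  unfolding list_det_def
proof (intro tendsto_det vec_tendstoI)
  fix i j :: 'n
  show "((\<lambda>t. (\<chi> i j. vs t ! idx j $ i) $ i $ j) \<longlongrightarrow> (\<chi> i j. us ! idx j $ i) $ i $ j) F"
    using tendsto_vec_nth [OF assms [OF idx_less [of j]], of i] by simp
qed

section \<open>The normal bundle of an immersion\<close>

lemma has_mderiv_tendsto:
  assumes "oriented_manifold A" "has_mderiv A F D x"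
  shows "(F \<longlongrightarrow> F x) (nhds x)"
proof -
  interpret oriented_manifold A by (rule assms)
  let ?C = "chart_at A x"
  have "isCont (F \<circ> chart_inv ?C) (snd ?C x)"
    using assms(2) has_derivative_continuous unfolding has_mderiv_def by blast
  then have "((F \<circ> chart_inv ?C) \<longlongrightarrow> F x) (nhds (snd ?C x))"
    by (simp add: continuous_at tendsto_nhds_iff chart_at)
  from filterlim_compose [OF this tendsto_chart [OF chart_at]]
  have "((\<lambda>z. F (chart_inv ?C (snd ?C z))) \<longlongrightarrow> F x) (nhds x)" by simp
  moreover have "\<forall>\<^sub>F z in nhds x. F (chart_inv ?C (snd ?C z)) = F z"
    using eventually_chart_at by eventually_elim (simp add: chart_at)
  ultimately show ?thesis by (simp add: tendsto_cong)
qed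

text \<open>\<open>q\<close> belongs to the data because the normal bundle is shown to be a
  \<open>weyl_bundle\<close> with its help, see \<open>normal_proj_mderiv\<close>.\<close>

locale weyl_immersion = M: tangent_bundle AM cM DM + N: tangent_bundle AN cN DN
  for AM :: "('x::{t2_space,second_countable_topology}, 'm::{finite,linorder}) atlas"
    and cM :: "('x, 'm) metric set" and DM :: "('x, 'm) covd"
    and AN :: "('y::{t2_space,second_countable_topology}, 'n::{finite,linorder}) atlas"
    and cN :: "('y, 'n) metric set" and DN :: "('y, 'n) covd" +
  fixes \<phi> :: "'x \<Rightarrow> 'y" and p :: "'x \<Rightarrow> 'm csubspace" and q :: "'x \<Rightarrow> 'n csubspace"
  assumes immersion: "injective_immersion AM AN \<phi>"
    and p: "smooth_section (tangent_obundle AM cM DM) p"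
    and p_isotropic: "isotropic_along AM AN cN \<phi> p"
    and q: "smooth_section (normal_obundle AM AN \<phi> cN DN) q"
begin

abbreviation "NM \<equiv> normal_obundle AM AN \<phi> cN DN"

lemma smooth_mfd_map_phi: "smooth_mfd_map AM AN \<phi>"
  using immersion M.oriented_manifold_axioms N.oriented_manifold_axioms
  by (simp add: smooth_mfd_map_def smooth_mfd_map_axioms_def injective_immersion_def)

lemma normal_weyl_subbundle: "weyl_subbundle AM AN \<phi> cN DN NM"
proof (intro weyl_subbundle.intro smooth_mfd_map_phi N.oriented_weyl_space_axioms weyl_subbundle_axioms.intro)
  interpret smooth_mfd_map AM AN \<phi> by (rule smooth_mfd_map_phi)
  show "subspace (bcompl NM x)" for x
    using linear_subspace_image [OF mfd_deriv_linear subspace_UNIV] by (simp add: normal_obundle_def)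
qed (simp_all add: normal_obundle_def)

end

sublocale weyl_immersion \<subseteq> Q: weyl_subbundle AM AN \<phi> cN DN "normal_obundle AM AN \<phi> cN DN"
  by (rule normal_weyl_subbundle)

context weyl_immersion
begin

abbreviation "d\<phi> \<equiv> mfd_deriv AM AN \<phi>"

lemma bcompl_normal: "bcompl NM x = range (d\<phi> x)"
  by (simp add: normal_obundle_def)

lemma q_in: "(x, q x) \<in> isotropic_bundle NM"
  using q by (simp add: smooth_section_def)

definition Kq :: "'x \<Rightarrow> ((real, 'n) vec, 'n) vec" where
  "Kq x = acs_matrix NM (x, q x)"

lemma Kq: "Q.positive_acs x (Kq x)" "q x = Q.graph x (Kq x)" "orth_acs (Q.fmetric x) (Q.pr x) (Kq x)"
proof -
  obtain K where K: "Q.positive_acs x K" "q x = Q.graph x K"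
    using q_in unfolding Q.isotropic_bundle_iff by blast
  then have "Kq x = K"
    by (simp add: Kq_def Q.acs_matrix_graph Q.positive_acs_def)
  with K show "Q.positive_acs x (Kq x)" "q x = Q.graph x (Kq x)" "orth_acs (Q.fmetric x) (Q.pr x) (Kq x)"
    by (simp_all add: Q.positive_acs_def)
qed

lemma Kq_coord: "acs_coord NM x (z, q z) = to_at AN (\<phi> x) (\<phi> z) ** Kq z ** from_at AN (\<phi> x) (\<phi> z)"
  using Q.acs_coord_graph [OF Kq(3), of x z] by (simp add: Kq(2) [symmetric])

lemma chart_inv_M: "chart_inv (chart_at AM x) (snd (chart_at AM x) x) = x"
  by (simp add: M.chart_at)

text \<open>The normal projection is smooth because it equals \<open>- K\<^sup>2\<close> for the complex structure of \<open>q\<close>.\<close>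

lemma normal_proj_mderiv:
  "\<exists>D'. has_mderiv AM (\<lambda>z. to_at AN (\<phi> x) (\<phi> z) ** Q.pr z ** from_at AN (\<phi> x) (\<phi> z)) D' x"
proof -
  let ?k = "\<lambda>z. acs_coord NM x (z, q z)"
  have "smooth_fn AM (\<phi> -` fst (chart_at AN (\<phi> x))) ?k"
    using q by (simp add: smooth_section_def normal_obundle_def)
  from M.smooth_fn_has_mderiv [OF Q.open_map_chart _ this, of x]
  have "has_mderiv AM ?k (fn_deriv AM ?k x) x" using N.chart_at(2) by simp
  from has_mderiv_minus [OF has_mderiv_matrix_mult [OF this this refl refl chart_inv_M]]
  obtain D' where d: "has_mderiv AM (\<lambda>z. - (?k z ** ?k z)) D' x" by blast
  have ev: "\<forall>\<^sub>F z in nhds x. - (?k z ** ?k z) = to_at AN (\<phi> x) (\<phi> z) ** Q.pr z ** from_at AN (\<phi> x) (\<phi> z)"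
    using Q.eventually_map_chart
  proof eventually_elim
    case (elim z)
    let ?T = "to_at AN (\<phi> x) (\<phi> z)" and ?F = "from_at AN (\<phi> x) (\<phi> z)"
    have "?k z ** ?k z = ?T ** Kq z ** (?F ** ?T) ** Kq z ** ?F"
      by (simp only: Kq_coord matrix_mul_assoc)
    also have "\<dots> = ?T ** (Kq z ** Kq z) ** ?F"
      by (simp add: N.to_at_from_at [OF elim] matrix_mul_assoc)
    also have "Kq z ** Kq z = - Q.pr z" using Kq(3) by (simp add: orth_acs_def)
    finally show ?case by (simp add: matrix_neg_lmult matrix_neg_rmult)
  qed
  show ?thesis by (rule exI, rule M.has_mderiv_cong [OF ev d])
qed

text \<open>Positivity of a determinant is an open condition. It is tested on the list
  \<open>?l\<close>, written in the charts at \<open>x\<close> and \<open>\<phi> x\<close>, where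
  convergence makes sense, and then moved to the charts at \<open>\<gamma> t\<close> and its image
  by Jacobians of positive determinant.\<close>

lemma normal_orient_open:
  assumes ws: "ws \<in> borient NM x" and \<gamma>: "(\<gamma> \<longlongrightarrow> x) (at (0::real))" and R: "(R \<longlongrightarrow> mat 1) (at 0)"
  shows "\<forall>\<^sub>F t in at 0. map (\<lambda>w. (from_at AN (\<phi> x) (\<phi> (\<gamma> t)) ** R t) *v w) ws \<in> borient NM (\<gamma> t)"
proof -
  obtain vs where vs: "positive_basis vs" "positive_basis (map (d\<phi> x) vs @ ws)"
    using ws by (auto simp: normal_obundle_def)
  have len: "length (map (d\<phi> x) vs @ ws) = CARD('n)" and pos: "list_det (map (d\<phi> x) vs @ ws) > 0"
    using vs(2) by (simp_all add: positive_basis_list_det)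
  let ?l = "\<lambda>t. map ((*v) (Q.deriv_matrix x (\<gamma> t))) vs @ map ((*v) (R t)) ws"
  have L: "((\<lambda>t. Q.deriv_matrix x (\<gamma> t)) \<longlongrightarrow> Q.deriv_matrix x x) (at 0)"
    by (rule filterlim_compose [OF has_mderiv_tendsto [OF M.oriented_manifold_axioms Q.deriv_matrix_has_mderiv] \<gamma>])
  have "((\<lambda>t. list_det (?l t)) \<longlongrightarrow> list_det (map (d\<phi> x) vs @ ws)) (at 0)"
  proof (rule tendsto_list_det)
    fix k assume "k < CARD('n)"
    show "((\<lambda>t. ?l t ! k) \<longlongrightarrow> (map (d\<phi> x) vs @ ws) ! k) (at 0)"
    proof (cases "k < length vs")
      case True
      have "((\<lambda>t. Q.deriv_matrix x (\<gamma> t) *v (vs ! k)) \<longlongrightarrow> Q.deriv_matrix x x *v (vs ! k)) (at 0)"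
        by (intro tendsto_intros L)
      then show ?thesis using True by (simp add: nth_append Q.deriv_matrix_self_apply)
    next
      case False
      have "((\<lambda>t. R t *v (ws ! (k - length vs))) \<longlongrightarrow> mat 1 *v (ws ! (k - length vs))) (at 0)"
        by (intro tendsto_intros R)
      then show ?thesis using False \<open>k < CARD('n)\<close> len by (simp add: nth_append)
    qed
  qed
  then have "\<forall>\<^sub>F t in at 0. list_det (?l t) > 0" using pos by (rule order_tendstoD)
  moreover have "\<forall>\<^sub>F t in at 0. \<gamma> t \<in> fst (chart_at AM x)"
    by (rule eventually_compose_filterlim [OF M.eventually_chart_at \<gamma>])
  moreover have "\<forall>\<^sub>F t in at 0. \<phi> (\<gamma> t) \<in> fst (chart_at AN (\<phi> x))"
    by (rule eventually_compose_filterlim [OF Q.eventually_map_chart \<gamma>])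
  ultimately show ?thesis
  proof eventually_elim
    case (elim t)
    let ?F = "from_at AN (\<phi> x) (\<phi> (\<gamma> t))" and ?G = "from_at AM x (\<gamma> t)"
    have "positive_basis (?l t)"
      using len elim(1) by (simp add: positive_basis_list_det)
    then have pb: "positive_basis (map ((*v) ?F) (?l t))"
      by (rule positive_basis_map) (rule N.to_at_from_at(4) [OF elim(3)])
    have "?F *v (Q.deriv_matrix x (\<gamma> t) *v v) = d\<phi> (\<gamma> t) (?G *v v)" for v
      by (simp add: Q.deriv_matrix_apply matrix_vector_mul_assoc N.to_at_from_at [OF elim(3)])
    then have eq: "map ((*v) ?F) (?l t) = map (d\<phi> (\<gamma> t)) (map ((*v) ?G) vs) @ map (\<lambda>w. (?F ** R t) *v w) ws"
      by (simp add: matrix_vector_mul_assoc [symmetric])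
    have "positive_basis (map ((*v) ?G) vs)"
      by (rule positive_basis_map [OF vs(1) M.to_at_from_at(4) [OF elim(2)]])
    with pb [unfolded eq] have "\<exists>us. positive_basis us \<and>
        positive_basis (map (d\<phi> (\<gamma> t)) us @ map (\<lambda>w. (?F ** R t) *v w) ws)"
      by blast
    then show ?case
      by (simp add: normal_obundle_def)
  qed
qed

lemma normal_weyl_bundle: "weyl_bundle AM AN \<phi> cN DN NM"
  by (intro weyl_bundle.intro Q.weyl_subbundle_axioms weyl_bundle_axioms.intro normal_proj_mderiv normal_orient_open)

end

sublocale weyl_immersion \<subseteq> Q: weyl_bundle AM AN \<phi> cN DN "normal_obundle AM AN \<phi> cN DN"
  by (rule normal_weyl_bundle)

section \<open>The sum of the two sections\<close>

context weyl_immersion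
begin

definition Jp where "Jp x = M.acs_of p x"

definition L where "L x = matrix (d\<phi> x)"

text \<open>The left inverse of \<open>L x\<close> that kills the normal space: an arbitrary left
  inverse after the tangential projection. This makes \<open>L x ** Li x\<close> equal to that
  projection.\<close>

definition Li where "Li x = (SOME B. B ** L x = mat 1) ** (mat 1 - Q.pr x)"

text \<open>The complex structure of \<open>p \<oplus> q\<close>.\<close>

definition KN where "KN x = L x ** Jp x ** Li x + Kq x"

definition pq where "pq x = ssum (cmap (d\<phi> x) ` p x) (q x)"

lemma p_in: "(x, p x) \<in> isotropic_bundle (tangent_obundle AM cM DM)"
  using p by (simp add: smooth_section_def)

lemma Jp: "M.positive_acs x (Jp x)" "p x = {(v, Jp x *v v) |v. True}" "Jp x ** Jp x = - mat 1"
    "p x = M.graph x (Jp x)" "orth_acs (M.fmetric x) (M.pr x) (Jp x)"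
  using M.acs_of [where \<sigma> = p, OF p_in, of x]
  by (simp_all add: Jp_def M.tangent_orth_acs M.tangent_graph)

lemma JJ: "Jp x *v (Jp x *v v) = - v"
  by (simp add: matrix_vector_mul_assoc Jp(3) matrix_neg_vmult)

lemma L_apply: "L x *v v = d\<phi> x v"
  by (simp add: L_def matrix_linear_works Q.mfd_deriv_linear)

lemma L_bcompl: "L x *v v \<in> bcompl NM x"
  by (simp add: L_apply bcompl_normal)

lemma bcompl_L: "w \<in> bcompl NM x \<Longrightarrow> \<exists>v. w = L x *v v"
  by (auto simp: L_apply bcompl_normal)

lemma pr_L: "Q.pr x ** L x = 0"
  by (simp add: matrix_eq matrix_vector_mul_assoc [symmetric] Q.pr_kills L_bcompl)

lemma Li: "Li x ** L x = mat 1" "Li x ** Q.pr x = 0" "L x ** Li x = mat 1 - Q.pr x"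
proof -
  have "(*v) (L x) = d\<phi> x" by (rule ext) (rule L_apply)
  then have "inj ((*v) (L x))"
    using immersion by (simp add: injective_immersion_def)
  then have "\<exists>B. B ** L x = mat 1" by (simp add: matrix_left_invertible_injective)
  then have B: "(SOME B. B ** L x = mat 1) ** L x = mat 1" by (rule someI_ex)
  then show 1: "Li x ** L x = mat 1"
    by (simp add: Li_def matrix_mul_assoc [symmetric] matrix_diff_lmult pr_L)
  show 2: "Li x ** Q.pr x = 0"
    by (simp add: Li_def matrix_mul_assoc [symmetric] matrix_diff_lmult Q.pr_idem)
  have "(L x ** Li x) *v v = (mat 1 - Q.pr x) *v v" for v
  proof -
    obtain y where y: "v - Q.pr x *v v = L x *v y" using bcompl_L Q.pr_diff_in by blast
    then have v: "v = Q.pr x *v v + L x *v y" by (simp add: algebra_simps)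
    have "Li x *v v = Li x *v (Q.pr x *v v + L x *v y)" using v by (rule arg_cong)
    also have "\<dots> = y"
      by (simp add: matrix_vector_right_distrib matrix_vector_mul_assoc 1 2)
    finally have "Li x *v v = y" .
    then show ?thesis
      using y by (simp add: matrix_vector_mul_assoc [symmetric] matrix_vector_mult_diff_rdistrib)
  qed
  then show "L x ** Li x = mat 1 - Q.pr x" by (simp add: matrix_eq)
qed

lemma Kq_alg: "Kq x ** Q.pr x = Kq x" "Q.pr x ** Kq x = Kq x" "Kq x ** Kq x = - Q.pr x"
    "skew_adjoint (Q.fmetric x) (Kq x)"
  using Kq(3) by (auto simp: orth_acs_def)

lemma Kq_L: "Kq x ** L x = 0"
proof -
  have "Kq x ** L x = Kq x ** (Q.pr x ** L x)" by (simp add: matrix_mul_assoc Kq_alg)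
  then show ?thesis by (simp add: pr_L)
qed

lemma KN_L: "KN x ** L x = L x ** Jp x"
proof -
  have "KN x ** L x = L x ** Jp x ** (Li x ** L x) + Kq x ** L x"
    by (simp only: KN_def matrix_add_rdistrib matrix_mul_assoc)
  then show ?thesis by (simp add: Li Kq_L)
qed

lemma KN_L_apply: "KN x *v (L x *v v) = L x *v (Jp x *v v)"
  by (simp add: matrix_vector_mul_assoc KN_L)

lemma KN_pr: "KN x ** Q.pr x = Kq x" "Q.pr x ** KN x = Kq x"
proof -
  have "KN x ** Q.pr x = L x ** Jp x ** (Li x ** Q.pr x) + Kq x ** Q.pr x"
    by (simp only: KN_def matrix_add_rdistrib matrix_mul_assoc)
  then show "KN x ** Q.pr x = Kq x" by (simp add: Li Kq_alg)
  have "Q.pr x ** KN x = (Q.pr x ** L x) ** Jp x ** Li x + Q.pr x ** Kq x"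
    by (simp only: KN_def matrix_add_ldistrib matrix_mul_assoc)
  then show "Q.pr x ** KN x = Kq x" by (simp add: pr_L Kq_alg)
qed

lemma KN_sq: "KN x ** KN x = - mat 1"
proof -
  have "KN x ** KN x = KN x ** L x ** Jp x ** Li x + KN x ** Kq x"
    by (simp only: KN_def [of x] matrix_add_ldistrib matrix_mul_assoc)
  also have "KN x ** L x ** Jp x ** Li x = L x ** (Jp x ** Jp x) ** Li x"
    by (simp only: KN_L matrix_mul_assoc)
  also have "\<dots> = - (L x ** Li x)"
    by (simp add: Jp matrix_neg_rmult matrix_neg_lmult)
  also have "KN x ** Kq x = (KN x ** Q.pr x) ** Kq x"
    by (simp only: matrix_mul_assoc [symmetric] Kq_alg)
  also have "\<dots> = - Q.pr x"
    by (simp only: KN_pr Kq_alg)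
  finally show ?thesis by (simp add: Li)
qed

text \<open>\<open>cM\<close> need not be induced by \<open>cN\<close>, so skewness of
  \<open>Jp x\<close> for the induced Gram matrix \<open>H\<close> comes from the isotropy of
  \<open>p\<close> for \<open>cN\<close>. The identity \<open>LG\<close> and its transpose
  \<open>GL\<close> carry it over to the tangential summand of \<open>KN x\<close>.\<close>

lemma KN_skew: "skew_adjoint (Q.fmetric x) (KN x)"
proof -
  let ?G = "Q.fmetric x"
  define H where "H = transpose (L x) ** ?G ** L x"
  have Hsym: "transpose H = H"
    by (simp add: H_def matrix_transpose_mul Q.fmetric_sym matrix_mul_assoc)
  have iso: "(Jp x *v a) \<bullet> (H *v (Jp x *v b)) = a \<bullet> (H *v b)" for a b
  proof -
    have "(a, Jp x *v a) \<in> p x" "(b, Jp x *v b) \<in> p x" by (auto simp: Jp(2))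
    \<comment> \<open>The real part of this equation is the invariance of the induced metric under
      \<open>Jp x\<close>.\<close>
    then have "cbil (N.metric (\<phi> x)) (cmap (d\<phi> x) (a, Jp x *v a)) (cmap (d\<phi> x) (b, Jp x *v b)) = 0"
      using p_isotropic N.metric_in unfolding isotropic_along_def by blast
    then have "N.metric (\<phi> x) (L x *v (Jp x *v a)) (L x *v (Jp x *v b)) = N.metric (\<phi> x) (L x *v a) (L x *v b)"
      by (simp add: cbil_def cmap_def L_apply prod_eq_iff)
    then show ?thesis
      by (simp only: N.metric_eq H_def Q.fmetric_def inner_matrix_vector_left matrix_vector_mul_assoc
          matrix_mul_assoc matrix_transpose_mul)
  qed
  have "transpose (Jp x) ** H = - (H ** Jp x)"
  proof (rule matrix_eq_inner)
    fix a b
    have "(Jp x *v a) \<bullet> (H *v b) = - ((Jp x *v a) \<bullet> (H *v (Jp x *v (Jp x *v b))))"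
      by (simp add: JJ matrix_vector_mult_minus)
    also have "\<dots> = - (a \<bullet> (H *v (Jp x *v b)))" by (simp only: iso)
    finally show "a \<bullet> ((transpose (Jp x) ** H) *v b) = a \<bullet> (- (H ** Jp x) *v b)"
      by (simp add: inner_matrix_vector_left matrix_vector_mul_assoc matrix_neg_vmult)
  qed
  moreover have LG: "transpose (L x) ** ?G = H ** Li x"
  proof -
    have "transpose (L x) ** ?G ** Q.pr x = transpose (L x) ** (transpose (Q.pr x) ** ?G)"
      using Q.pr_self_adjoint by (simp add: self_adjoint_def matrix_mul_assoc)
    also have "\<dots> = transpose (Q.pr x ** L x) ** ?G"
      by (simp only: matrix_transpose_mul matrix_mul_assoc)
    also have "\<dots> = 0" by (simp only: pr_L) (simp add: transpose_def vec_eq_iff matrix_matrix_mult_def)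
    finally have "transpose (L x) ** ?G ** (mat 1 - Q.pr x) = transpose (L x) ** ?G"
      by (simp add: matrix_diff_rmult)
    then show ?thesis
      by (simp only: Li(3) [symmetric] H_def matrix_mul_assoc)
  qed
  moreover have GL: "?G ** L x = transpose (Li x) ** H"
  proof -
    have "transpose (transpose (L x) ** ?G) = transpose (H ** Li x)" by (simp only: LG)
    then show ?thesis by (simp add: matrix_transpose_mul Q.fmetric_sym Hsym)
  qed
  ultimately have "transpose (L x ** Jp x ** Li x) ** ?G = - (?G ** (L x ** Jp x ** Li x))"
  proof -
    assume a: "transpose (Jp x) ** H = - (H ** Jp x)"
    have "transpose (L x ** Jp x ** Li x) ** ?G = transpose (Li x) ** (transpose (Jp x) ** (transpose (L x) ** ?G))"
      by (simp only: matrix_transpose_mul matrix_mul_assoc)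
    also have "\<dots> = transpose (Li x) ** ((transpose (Jp x) ** H) ** Li x)"
      by (simp only: LG matrix_mul_assoc)
    also have "\<dots> = - ((transpose (Li x) ** H) ** Jp x ** Li x)"
      by (simp only: a matrix_neg_lmult matrix_neg_rmult matrix_mul_assoc)
    also have "\<dots> = - (?G ** (L x ** Jp x ** Li x))"
      by (simp only: GL [symmetric] matrix_mul_assoc)
    finally show ?thesis .
  qed
  then have "skew_adjoint ?G (L x ** Jp x ** Li x)" by (simp add: skew_adjoint_def)
  then show ?thesis unfolding KN_def using Kq_alg by (intro skew_adjoint_add)
qed

lemma KN_fibre: "w \<in> fibre NM x \<Longrightarrow> KN x *v w = Kq x *v w"
  using Q.pr_fixes [of w x] KN_pr(1) [of x] by (metis matrix_vector_mul_assoc)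

text \<open>Pairs \<open>e, J e\<close> in the tangent space followed by pairs
  \<open>e, Kq e\<close> in the normal space are again pairs \<open>e, KN e\<close>. This list is
  positive because its tangential half may be exchanged for the basis in the definition of the
  normal orientation.\<close>

lemma KN_positive: "N.positive_acs (\<phi> x) (KN x)"
proof -
  have "orth_acs (N.fmetric (\<phi> x)) (N.pr (\<phi> x)) (KN x)"
    using KN_sq KN_skew by (simp add: N.tangent_orth_acs Q.fmetric_def)
  moreover
  have "\<exists>es. concat (map (\<lambda>e. [e, Jp x *v e]) es) \<in> borient (tangent_obundle AM cM DM) x"
    using Jp(1) [of x] unfolding M.positive_acs_def by blast
  then obtain es where es: "positive_basis (concat (map (\<lambda>e. [e, Jp x *v e]) es))"
    by (auto simp: tangent_obundle_def)
  obtain fs where fs: "set fs \<subseteq> fibre NM x" "concat (map (\<lambda>e. [e, Kq x *v e]) fs) \<in> borient NM x"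
    using Kq(1) [of x] unfolding Q.positive_acs_def by blast
  then obtain vs where vs: "positive_basis vs"
    "positive_basis (map (d\<phi> x) vs @ concat (map (\<lambda>e. [e, Kq x *v e]) fs))"
    by (auto simp: normal_obundle_def)
  have "positive_basis (map (d\<phi> x) (concat (map (\<lambda>e. [e, Jp x *v e]) es)) @ concat (map (\<lambda>e. [e, Kq x *v e]) fs))"
    by (rule positive_basis_append_exchange [OF Q.mfd_deriv_linear vs(1) es vs(2)])
  moreover have "map (d\<phi> x) (concat (map (\<lambda>e. [e, Jp x *v e]) es)) = concat (map (\<lambda>e. [e, KN x *v e]) (map (d\<phi> x) es))"
    by (induction es) (simp_all add: L_apply [symmetric] KN_L_apply)
  moreover have "concat (map (\<lambda>e. [e, Kq x *v e]) fs) = concat (map (\<lambda>e. [e, KN x *v e]) fs)"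
    using fs(1) by (induction fs) (simp_all add: KN_fibre)
  ultimately have "positive_basis (concat (map (\<lambda>e. [e, KN x *v e]) (map (d\<phi> x) es @ fs)))"
    by simp
  then have "\<exists>es. set es \<subseteq> fibre (tangent_obundle AN cN DN) (\<phi> x) \<and>
      concat (map (\<lambda>e. [e, KN x *v e]) es) \<in> borient (tangent_obundle AN cN DN) (\<phi> x)"
    by (intro exI [of _ "map (d\<phi> x) es @ fs"]) (simp add: N.tangent_fibre, simp add: tangent_obundle_def)
  with \<open>orth_acs _ _ (KN x)\<close> show ?thesis
    by (simp add: N.positive_acs_def)
qed

lemma pq_graph: "pq x = N.graph (\<phi> x) (KN x)"
proof (intro equalityI subsetI)
  fix z assume "z \<in> pq x"
  then obtain a b where z: "z = a + b" "a \<in> cmap (d\<phi> x) ` p x" "b \<in> q x"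
    by (auto simp: pq_def ssum_def)
  then obtain v w where "a = (L x *v v, L x *v (Jp x *v v))" and w: "b = (w, Kq x *v w)" "w \<in> fibre NM x"
    by (auto simp: Jp(2) Kq(2) Q.graph_def cmap_def L_apply)
  then have "z = (L x *v v + w, KN x *v (L x *v v + w))"
    by (simp add: z matrix_vector_right_distrib KN_L_apply KN_fibre)
  then show "z \<in> N.graph (\<phi> x) (KN x)"
    by (auto simp: N.tangent_graph)
next
  fix z assume "z \<in> N.graph (\<phi> x) (KN x)"
  then obtain v where z: "z = (v, KN x *v v)" by (auto simp: N.tangent_graph)
  obtain y where "v - Q.pr x *v v = L x *v y" using bcompl_L Q.pr_diff_in by blast
  then have v: "v = L x *v y + Q.pr x *v v" by (simp add: algebra_simps)
  have "KN x *v v = KN x *v (L x *v y + Q.pr x *v v)" using v by (rule arg_cong)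
  also have "\<dots> = L x *v (Jp x *v y) + Kq x *v (Q.pr x *v v)"
    by (simp add: matrix_vector_right_distrib KN_L_apply KN_fibre Q.pr_in)
  finally have "z = cmap (d\<phi> x) (y, Jp x *v y) + (Q.pr x *v v, Kq x *v (Q.pr x *v v))"
    using v by (simp add: z cmap_def L_apply)
  moreover have "(y, Jp x *v y) \<in> p x" by (auto simp: Jp(2))
  moreover have "(Q.pr x *v v, Kq x *v (Q.pr x *v v)) \<in> q x"
    using Q.pr_in by (auto simp: Kq(2) Q.graph_def)
  ultimately show "z \<in> pq x"
    unfolding pq_def ssum_def by blast
qed

lemma pq_in: "(\<phi> x, pq x) \<in> isotropic_bundle (tangent_obundle AN cN DN)"
  unfolding N.isotropic_bundle_iff using KN_positive pq_graph by blast

lemma KN_orth: "orth_acs (N.fmetric (\<phi> x)) (N.pr (\<phi> x)) (KN x)"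
  using KN_positive by (simp add: N.positive_acs_def)

section \<open>The derivative of the complex structure of the sum\<close>

definition kN where "kN x z = acs_coord (tangent_obundle AN cN DN) (\<phi> x) (\<phi> z, pq z)"

definition dKN where "dKN x = fn_deriv AM (kN x) x"

lemma kN_eq: "kN x z = to_at AN (\<phi> x) (\<phi> z) ** KN z ** from_at AN (\<phi> x) (\<phi> z)"
  using N.acs_coord_graph [OF KN_orth, of "\<phi> x" z] by (simp add: kN_def pq_graph)

lemma kN_self: "kN x x = KN x"
  by (simp add: kN_eq)

lemma p_coord: "acs_coord (tangent_obundle AM cM DM) x (z, p z) = to_at AM x z ** Jp z ** from_at AM x z"
  using M.acs_coord_graph [OF Jp(5), of x z] by (simp add: Jp(4) [symmetric])

text \<open>Together the two relations determine \<open>KN\<close>, and apart from it they involve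
  only functions already known to be differentiable. They avoid \<open>Li\<close>, which contains an
  arbitrary choice at each point.\<close>

lemma kN_relations:
  assumes z: "z \<in> fst (chart_at AM x)" "\<phi> z \<in> fst (chart_at AN (\<phi> x))"
  shows "kN x z ** Q.deriv_matrix x z = Q.deriv_matrix x z ** acs_coord (tangent_obundle AM cM DM) x (z, p z)"
    "kN x z ** Q.pr_at x z = acs_coord NM x (z, q z)"
proof -
  let ?T = "to_at AN (\<phi> x) (\<phi> z)" and ?F = "from_at AN (\<phi> x) (\<phi> z)"
  let ?t = "to_at AM x z" and ?f = "from_at AM x z"
  have dm: "Q.deriv_matrix x z = ?T ** L z ** ?f" by (simp add: Q.deriv_matrix_def L_def)
  have "kN x z ** Q.deriv_matrix x z = ?T ** KN z ** (?F ** ?T) ** L z ** ?f"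
    by (simp only: kN_eq dm matrix_mul_assoc)
  also have "\<dots> = ?T ** (KN z ** L z) ** ?f"
    by (simp add: N.to_at_from_at [OF z(2)] matrix_mul_assoc)
  also have "\<dots> = ?T ** L z ** (?f ** ?t) ** Jp z ** ?f"
    by (simp add: M.to_at_from_at [OF z(1)] KN_L matrix_mul_assoc)
  also have "\<dots> = Q.deriv_matrix x z ** acs_coord (tangent_obundle AM cM DM) x (z, p z)"
    by (simp only: p_coord dm matrix_mul_assoc)
  finally show "kN x z ** Q.deriv_matrix x z = Q.deriv_matrix x z ** acs_coord (tangent_obundle AM cM DM) x (z, p z)" .
  have "kN x z ** Q.pr_at x z = ?T ** KN z ** (?F ** ?T) ** Q.pr z ** ?F"
    by (simp only: kN_eq Q.pr_at_def matrix_mul_assoc)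
  also have "\<dots> = ?T ** (KN z ** Q.pr z) ** ?F"
    by (simp add: N.to_at_from_at [OF z(2)] matrix_mul_assoc)
  finally show "kN x z ** Q.pr_at x z = acs_coord NM x (z, q z)"
    by (simp only: KN_pr Kq_coord)
qed

lemma eventually_charts:
  "\<forall>\<^sub>F z in nhds x. z \<in> fst (chart_at AM x) \<and> \<phi> z \<in> fst (chart_at AN (\<phi> x))"
  using M.eventually_chart_at Q.eventually_map_chart by (rule eventually_conj)

abbreviation "dL x X \<equiv> matrix (Q.second_deriv x X)"

lemma p_coord_self: "acs_coord (tangent_obundle AM cM DM) x (x, p x) = Jp x"
  and deriv_matrix_self_L: "Q.deriv_matrix x x = L x"
  by (simp_all add: p_coord Q.deriv_matrix_self L_def)

text \<open>Multiplying the two relations on the right by the fixed matrices \<open>Li x\<close> and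
  \<open>Q.pr x\<close> and adding gives \<open>kN x z ** ?R z = ?S z\<close> with
  \<open>?R x = L x ** Li x + Q.pr x = mat 1\<close>, to which the quotient rule applies.\<close>

lemma kN_mderiv: "has_mderiv AM (kN x) (dKN x) x"
proof -
  note mm = has_mderiv_matrix_mult [OF _ _ _ _ chart_inv_M]
  let ?p = "\<lambda>z. acs_coord (tangent_obundle AM cM DM) x (z, p z)" and ?q = "\<lambda>z. acs_coord NM x (z, q z)"
  let ?R = "\<lambda>z. Q.deriv_matrix x z ** Li x + Q.pr_at x z ** Q.pr x"
  let ?S = "\<lambda>z. (Q.deriv_matrix x z ** ?p z) ** Li x + ?q z ** Q.pr x"
  obtain R' where R': "has_mderiv AM ?R R' x"
    using has_mderiv_add [OF mm [OF Q.deriv_matrix_has_mderiv has_mderiv_const refl refl]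
        mm [OF Q.pr_at_mderiv has_mderiv_const refl refl]] by blast
  obtain S' where S': "has_mderiv AM ?S S' x"
    using has_mderiv_add [OF mm [OF mm [OF Q.deriv_matrix_has_mderiv M.smooth_section_mderiv [OF p] refl refl]
          has_mderiv_const refl refl]
        mm [OF Q.smooth_section_mderiv [OF q] has_mderiv_const refl refl]] by blast
  have R1: "?R x = mat 1"
    by (simp add: deriv_matrix_self_L Li Q.pr_idem)
  have "\<forall>\<^sub>F z in nhds x. kN x z ** ?R z = ?S z"
    using eventually_charts by eventually_elim (simp add: matrix_add_ldistrib matrix_mul_assoc kN_relations)
  from M.eventually_chart_inv [OF M.chart_at this]
  have ev: "\<forall>\<^sub>F u in nhds (snd (chart_at AM x) x). (kN x \<circ> chart_inv (chart_at AM x)) u **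
      (?R \<circ> chart_inv (chart_at AM x)) u = (?S \<circ> chart_inv (chart_at AM x)) u"
    by (simp add: o_def)
  have "\<exists>D'. has_mderiv AM (kN x) D' x"
    unfolding has_mderiv_def
    by (rule exI, rule has_derivative_right_divide_mat_1 [OF R' [unfolded has_mderiv_def] _ S' [unfolded has_mderiv_def] ev])
      (simp only: o_apply chart_inv_M R1)
  then show ?thesis
    unfolding dKN_def by (auto simp: has_mderiv_fn_deriv)
qed

lemma dKN_relations:
  "KN x ** dL x X + dKN x X ** L x = L x ** M.section_deriv p x X + dL x X ** Jp x"
  "KN x ** Q.dpr x X + dKN x X ** Q.pr x = Q.section_deriv q x X"
proof -
  note mm = has_mderiv_matrix_mult [OF _ _ _ _ chart_inv_M]
  let ?p = "\<lambda>z. acs_coord (tangent_obundle AM cM DM) x (z, p z)" and ?q = "\<lambda>z. acs_coord NM x (z, q z)"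
  have "has_mderiv AM (\<lambda>z. kN x z ** Q.deriv_matrix x z) (\<lambda>X. KN x ** dL x X + dKN x X ** L x) x"
    by (intro mm kN_mderiv Q.deriv_matrix_has_mderiv kN_self deriv_matrix_self_L)
  then have "has_mderiv AM (\<lambda>z. Q.deriv_matrix x z ** ?p z) (\<lambda>X. KN x ** dL x X + dKN x X ** L x) x"
    by (rule M.has_mderiv_cong [rotated])
      (rule eventually_mono [OF eventually_charts], simp add: kN_relations)
  moreover have "has_mderiv AM (\<lambda>z. Q.deriv_matrix x z ** ?p z)
      (\<lambda>X. L x ** M.section_deriv p x X + dL x X ** Jp x) x"
    by (intro mm M.smooth_section_mderiv [OF p] Q.deriv_matrix_has_mderiv p_coord_self deriv_matrix_self_L)
  ultimately have "(\<lambda>X. KN x ** dL x X + dKN x X ** L x) = (\<lambda>X. L x ** M.section_deriv p x X + dL x X ** Jp x)"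
    by (rule has_mderiv_unique)
  then show "KN x ** dL x X + dKN x X ** L x = L x ** M.section_deriv p x X + dL x X ** Jp x"
    by (rule fun_cong)
  have "has_mderiv AM (\<lambda>z. kN x z ** Q.pr_at x z) (\<lambda>X. KN x ** Q.dpr x X + dKN x X ** Q.pr x) x"
    by (intro mm kN_mderiv Q.pr_at_mderiv kN_self Q.pr_at_self)
  then have "has_mderiv AM ?q (\<lambda>X. KN x ** Q.dpr x X + dKN x X ** Q.pr x) x"
    by (rule M.has_mderiv_cong [rotated])
      (rule eventually_mono [OF eventually_charts], simp add: kN_relations)
  then have "(\<lambda>X. KN x ** Q.dpr x X + dKN x X ** Q.pr x) = Q.section_deriv q x"
    using Q.smooth_section_mderiv [OF q] by (rule has_mderiv_unique)
  then show "KN x ** Q.dpr x X + dKN x X ** Q.pr x = Q.section_deriv q x X"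
    by (rule fun_cong)
qed

end

section \<open>The equivalence\<close>

context weyl_immersion
begin

abbreviation "TM \<equiv> tangent_obundle AM cM DM"
abbreviation "TN \<equiv> tangent_obundle AN cN DN"

text \<open>The covariant derivative along the immersion of the complex structure of \<open>p \<oplus> q\<close>.\<close>

definition V where "V x X = dKN x X - N.hor (\<phi> x) (KN x) (d\<phi> x X)"

lemma V_eq: "V x X = dKN x X - (KN x ** Q.conn x X - Q.conn x X ** KN x)"
  by (simp add: V_def N.tangent_hor Q.conn_def)

lemma pq_velocity:
  assumes \<gamma>: "mfd_velocity AM \<gamma> X" "\<gamma> 0 = x"
  shows "bundle_velocity TN (\<lambda>t. (\<phi> (\<gamma> t), pq (\<gamma> t))) (d\<phi> x X, dKN x X)"
  using Q.velocity_map [OF \<gamma>] M.velocity_compose [OF \<gamma> kN_mderiv] \<gamma>(2)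
  by (simp add: bundle_velocity_def N.bundle_simps o_def kN_def)

lemma pq_deriv_in_tangent: "(d\<phi> x X, dKN x X) \<in> bundle_tangent TN (\<phi> x, pq x)"
proof -
  obtain \<gamma> where \<gamma>: "\<gamma> 0 = x" "mfd_velocity AM \<gamma> X" by (rule M.velocity_exists)
  with pq_velocity [OF \<gamma>(2,1)] show ?thesis
    unfolding tangent_space_def mem_Collect_eq
    by (intro exI [of _ "\<lambda>t. (\<phi> (\<gamma> t), pq (\<gamma> t))"]) (simp add: pq_in)
qed

lemma V_vert: "V x X \<in> vert_space (N.fmetric (\<phi> x)) (N.pr (\<phi> x)) (KN x)"
  using pq_deriv_in_tangent [of x X]
  unfolding pq_graph N.bundle_tangent_graph [OF KN_positive] V_def by simp

lemma V_skew: "skew_adjoint (Q.fmetric x) (V x X)" and V_anticommute: "KN x ** V x X = - (V x X ** KN x)"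
  using V_vert [of x X] by (simp_all add: vert_space_def N.fmetric_def Q.fmetric_def)

abbreviation "sff \<equiv> second_fundamental_form AM DM AN DN \<phi>"

lemma sff_eq: "sff x X Y = (dL x X + Q.conn x X ** L x - L x ** M.conn_matrix x X) *v Y"
proof -
  have "(\<lambda>z. to_at AN (\<phi> x) (\<phi> z) *v d\<phi> z (const_field AM x Y z)) = (\<lambda>z. Q.deriv_matrix x z *v Y)"
    by (simp add: Q.deriv_matrix_apply const_field_def)
  then have "fn_deriv AM (\<lambda>z. to_at AN (\<phi> x) (\<phi> z) *v d\<phi> z (const_field AM x Y z)) x X = Q.second_deriv x X Y"
    using has_mderiv_fn_deriv [OF Q.deriv_matrix_apply_has_mderiv] by simp
  then show ?thesis
    by (simp add: second_fundamental_form_def Let_def cov_along_def matrix_vector_mult_add_rdistrib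
        matrix_vector_mult_diff_rdistrib matrix_vector_mul_assoc [symmetric] L_apply Q.conn_def
        N.conn_matrix_apply M.conn_matrix_apply matrix_linear_works Q.second_deriv_linear_right
        christoffel_def [of AM, symmetric])
qed

text \<open>The Hessian and both Christoffel terms are symmetric, the latter by
  torsion-freeness.\<close>

lemma sff_sym: "sff x X Y = sff x Y X"
proof -
  have "sff x X Y = Q.second_deriv x X Y + christoffel AN DN (\<phi> x) (d\<phi> x X) (d\<phi> x Y) - d\<phi> x (christoffel AM DM x X Y)"
    for X Y
    by (simp add: sff_eq matrix_vector_mult_add_rdistrib matrix_vector_mult_diff_rdistrib
        matrix_vector_mul_assoc [symmetric] L_apply Q.conn_def N.conn_matrix_apply M.conn_matrix_apply
        matrix_linear_works Q.second_deriv_linear_right)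
  then show ?thesis
    using Q.second_deriv_symmetric [of x X Y] N.christoffel_symmetric [of "\<phi> x" "d\<phi> x X" "d\<phi> x Y"]
      M.christoffel_symmetric [of x X Y] by simp
qed

lemma sff_add: "sff x X (Y + Z) = sff x X Y + sff x X Z"
  by (simp add: sff_eq matrix_vector_right_distrib)

text \<open>The derivative of \<open>KN ** L = L ** Jp\<close> with the connection terms inserted;
  those in \<open>M.conn_matrix\<close> cancel between the second fundamental forms and the
  covariant derivative of \<open>Jp\<close>.\<close>

lemma V_L: "V x X *v (L x *v Y) = sff x X (Jp x *v Y) - KN x *v sff x X Y + L x *v (M.section_cov p x X *v Y)"
proof -
  let ?\<Gamma> = "Q.conn x X" and ?\<Gamma>M = "M.conn_matrix x X"
  have A: "M.section_cov p x X = M.section_deriv p x X - (Jp x ** ?\<Gamma>M - ?\<Gamma>M ** Jp x)"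
    by (simp add: M.section_cov_def M.tangent_hor Jp_def)
  have r: "dKN x X ** L x = L x ** M.section_deriv p x X + dL x X ** Jp x - KN x ** dL x X"
    using dKN_relations(1) [of x X] by (simp add: algebra_simps)
  have KL: "Z ** KN x ** L x = Z ** L x ** Jp x" for Z
    by (simp add: matrix_mul_assoc [symmetric] KN_L)
  have "V x X ** L x = (dL x X + ?\<Gamma> ** L x - L x ** ?\<Gamma>M) ** Jp x
      - KN x ** (dL x X + ?\<Gamma> ** L x - L x ** ?\<Gamma>M) + L x ** M.section_cov p x X"
    unfolding V_eq A by (simp add: matrix_ring_simps matrix_mul_assoc r KL KN_L)
  then have "V x X *v (L x *v Y) = ((dL x X + ?\<Gamma> ** L x - L x ** ?\<Gamma>M) ** Jp x
      - KN x ** (dL x X + ?\<Gamma> ** L x - L x ** ?\<Gamma>M) + L x ** M.section_cov p x X) *v Y"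
    by (simp add: matrix_vector_mul_assoc)
  then show ?thesis
    unfolding sff_eq by (simp only: matrix_vector_mult_add_rdistrib matrix_vector_mult_diff_rdistrib
        matrix_vector_mul_assoc [symmetric])
qed

lemma Kq_acs_of: "Q.acs_of q x = Kq x"
  by (simp add: Kq_def Q.acs_of_def)

text \<open>Being vertical, the covariant derivative of \<open>q\<close> equals its compression by
  \<open>Q.pr x\<close>, which is free of the horizontal correction by
  \<open>orth_acs_deriv_hor\<close>. Then the derivative of \<open>KN ** Q.pr = Kq\<close> is
  substituted.\<close>

lemma section_cov_q: "Q.section_cov q x X = Q.pr x ** V x X ** Q.pr x"
proof -
  let ?\<pi> = "Q.pr x" and ?\<Gamma> = "Q.conn x X"
  have pp: "?\<pi> ** ?\<pi> = ?\<pi>" by (rule Q.pr_idem)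
  obtain \<theta> where G: "has_mderiv AM (Q.gram_at x)
    (\<lambda>X. transpose (Q.conn x X) ** Q.fmetric x + Q.fmetric x ** Q.conn x X + \<theta> X *\<^sub>R Q.fmetric x) x"
    by (rule Q.gram_at_mderiv)
  have "(X, Q.section_deriv q x X) \<in> bundle_tangent NM (x, q x)"
    by (rule Q.section_deriv_in_tangent [OF q])
  then have "Q.section_cov q x X \<in> vert_space (Q.fmetric x) ?\<pi> (Kq x)"
    using Kq(1,2) [of x] by (simp add: Q.bundle_tangent_graph Q.section_cov_def Kq_acs_of)
  then have "Q.section_cov q x X = ?\<pi> ** Q.section_cov q x X ** ?\<pi>"
    by (simp add: vert_space_def)
  also have "\<dots> = ?\<pi> ** (Q.section_deriv q x X + ?\<Gamma> ** Kq x - Kq x ** ?\<Gamma>) ** ?\<pi>"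
    unfolding Q.section_cov_def Kq_acs_of
    by (rule Q.orth_acs_deriv_hor(2) [OF Kq(3) _ G, where \<theta> = "\<theta> X", symmetric]) simp_all
  also have "\<dots> = ?\<pi> ** KN x ** Q.dpr x X ** ?\<pi> + ?\<pi> ** dKN x X ** (?\<pi> ** ?\<pi>)
      + ?\<pi> ** ?\<Gamma> ** (Kq x ** ?\<pi>) - (?\<pi> ** Kq x) ** ?\<Gamma> ** ?\<pi>"
    unfolding dKN_relations(2) [symmetric] by (simp add: matrix_ring_simps matrix_mul_assoc)
  \<comment> \<open>Differentiated idempotence shows that \<open>Q.dpr x X\<close> has no component
    from the normal space into itself.\<close>
  also have "?\<pi> ** KN x ** Q.dpr x X ** ?\<pi> = 0"
  proof -
    have "?\<pi> ** (?\<pi> ** Q.dpr x X + Q.dpr x X ** ?\<pi>) = ?\<pi> ** Q.dpr x X"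
      by (simp only: Q.dpr_idem)
    then have z: "?\<pi> ** Q.dpr x X ** ?\<pi> = 0"
      by (simp add: matrix_add_ldistrib matrix_mul_assoc pp)
    have "?\<pi> ** KN x ** Q.dpr x X ** ?\<pi> = KN x ** (?\<pi> ** Q.dpr x X ** ?\<pi>)"
      by (simp only: KN_pr matrix_mul_assoc)
    then show ?thesis by (simp add: z)
  qed
  also have "Kq x ** ?\<pi> = KN x ** ?\<pi>"
    by (simp only: KN_pr Kq_alg)
  also have "?\<pi> ** Kq x = ?\<pi> ** KN x"
    by (simp only: KN_pr Kq_alg)
  also have "0 + ?\<pi> ** dKN x X ** (?\<pi> ** ?\<pi>) + ?\<pi> ** ?\<Gamma> ** (KN x ** ?\<pi>) - ?\<pi> ** KN x ** ?\<Gamma> ** ?\<pi>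
      = ?\<pi> ** V x X ** ?\<pi>"
    unfolding V_eq pp by (simp add: matrix_ring_simps matrix_mul_assoc)
  finally show ?thesis .
qed

lemma twistorial_pointwise:
  assumes "\<And>X. M.section_cov p x (Jp x *v X) = - (Jp x ** M.section_cov p x X)"
  shows "(\<forall>X. V x (Jp x *v X) = - (KN x ** V x X)) \<longleftrightarrow>
    (\<forall>X Y. sff x X Y + sff x (Jp x *v X) (Jp x *v Y) = 0) \<and>
    (\<forall>X. Q.section_cov q x (Jp x *v X) = - (Kq x ** Q.section_cov q x X))"
proof -
  have "Q.pr x *v v = v" if "\<And>Y. v \<bullet> (Q.fmetric x *v (L x *v Y)) = 0" for v
  proof -
    have "v \<in> fibre NM x"
      unfolding Q.fibre_iff using that bcompl_L by blast
    then show ?thesis by (rule Q.pr_fixes)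
  qed
  moreover have "\<exists>Y. v - Q.pr x *v v = L x *v Y" for v
    using bcompl_L Q.pr_diff_in by blast
  moreover have "KN x ** Q.pr x = Q.pr x ** KN x" by (simp add: KN_pr)
  ultimately show ?thesis
    using holomorphic_iff_pluriharmonic_part [where K = "KN x" and J = "Jp x" and L = "L x" and b = "sff x" and
        V = "V x" and A = "M.section_cov p x" and G = "Q.fmetric x" and \<pi> = "Q.pr x",
        OF KN_sq Jp(3) KN_L sff_add sff_sym V_L V_skew V_anticommute KN_skew _ _ _ Q.pr_idem assms]
    unfolding section_cov_q KN_pr(1) by blast
qed

lemma one_one_geodesic_iff:
  "one_one_geodesic AM DM AN DN \<phi> p \<longleftrightarrow> (\<forall>x X Y. sff x X Y + sff x (Jp x *v X) (Jp x *v Y) = 0)"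
proof -
  have minus: "sff x (- X) Y = - sff x X Y" "sff x X (- Y) = - sff x X Y" for x X Y
  proof -
    show m: "sff x X (- Y) = - sff x X Y" for X Y by (simp add: sff_eq matrix_vector_mult_minus)
    show "sff x (- X) Y = - sff x X Y" by (simp only: sff_sym [of x _ Y] m)
  qed
  have "cbil (sff x) (cconj (X, Jp x *v X)) (Y, Jp x *v Y) =
      (sff x X Y + sff x (Jp x *v X) (Jp x *v Y), sff x X (Jp x *v Y) - sff x (Jp x *v X) Y)" for x X Y
    by (simp add: cbil_def cconj_def minus)
  note cb = this
  have ball: "(\<forall>z\<in>p x. P z) \<longleftrightarrow> (\<forall>v. P (v, Jp x *v v))" for x P
    by (subst Jp(2)) blast
  have "one_one_geodesic AM DM AN DN \<phi> p \<longleftrightarrow>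
      (\<forall>x X Y. sff x X Y + sff x (Jp x *v X) (Jp x *v Y) = 0 \<and> sff x X (Jp x *v Y) - sff x (Jp x *v X) Y = 0)"
    unfolding one_one_geodesic_def ball cb zero_prod_def prod.inject ..
  \<comment> \<open>The imaginary part at \<open>X\<close> and \<open>Y\<close> is the real part at
    \<open>X\<close> and \<open>Jp x *v Y\<close>, because \<open>Jp x\<close> squares to
    \<open>-1\<close>.\<close>
  moreover have "sff x X (Jp x *v Y) - sff x (Jp x *v X) Y = 0"
    if "\<forall>X Y. sff x X Y + sff x (Jp x *v X) (Jp x *v Y) = 0" for x X Y
    using that [rule_format, of X "Jp x *v Y"] by (simp add: JJ minus)
  ultimately show ?thesis by blast
qed

section \<open>Holomorphy of the sections and of the lift\<close>

lemma Jp_acs_of: "M.acs_of p x = Jp x"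
  by (simp add: Jp_def)

lemma J_base_p: "J_base p x v = Jp x *v v"
  by (rule M.J_base_graph [where p = p and x = x and K = "Jp x", OF Jp(3,2)])

lemma J_nonint_p:
  assumes "v \<in> bundle_tangent TM (x, p x)"
  shows "J_nonint AM cM DM (x, p x) v = M.bundle_acs x (Jp x) (Jp x) v"
  using M.J_nonint_graph [OF Jp(1) [of x], of v, folded Jp(4) [of x]] assms .

lemma p_holomorphic_iff:
  "holomorphic_map (mfd_velocity AM) UNIV (J_base p) (bundle_velocity TM) (isotropic_bundle TM)
      (J_nonint AM cM DM) (\<lambda>x. (x, p x)) \<longleftrightarrow>
    (\<forall>x X. M.section_cov p x (Jp x *v X) = - (Jp x ** M.section_cov p x X))"
  unfolding Jp_acs_of [symmetric]
proof (rule M.holomorphic_section_iff [OF p, where j = "M.acs_of p"])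
  fix x
  show "J_base p x v = M.acs_of p x *v v" for v
    unfolding Jp_acs_of by (rule J_base_p)
  show "M.acs_of p x ** M.acs_of p x = - mat 1"
    unfolding Jp_acs_of by (rule Jp(3))
  show "J_nonint AM cM DM (x, p x) v = M.bundle_acs x (M.acs_of p x) (M.acs_of p x) v"
    if "v \<in> bundle_tangent TM (x, p x)" for v
    unfolding Jp_acs_of by (rule J_nonint_p [OF that])
qed

lemma q_holomorphic_iff:
  "holomorphic_map (mfd_velocity AM) UNIV (J_base p) (bundle_velocity NM) (isotropic_bundle NM)
      (J_section NM p) (\<lambda>x. (x, q x)) \<longleftrightarrow>
    (\<forall>x X. Q.section_cov q x (Jp x *v X) = - (Kq x ** Q.section_cov q x X))"
  unfolding Kq_acs_of [symmetric]
proof (rule Q.holomorphic_section_iff [OF q, where j = Jp])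
  fix x
  show "J_base p x v = Jp x *v v" for v
    by (rule J_base_p)
  show "Jp x ** Jp x = - mat 1" by (rule Jp(3))
  have pc: "cconj ` p x = {(X, - (Jp x *v X)) |X. True}"
    unfolding Jp(2) [of x] by (force simp: cconj_def)
  show "J_section NM p (x, q x) v = Q.bundle_acs x (Q.acs_of q x) (Jp x) v"
    if "v \<in> bundle_tangent NM (x, q x)" for v
    unfolding J_section_def fst_conv pc Kq_acs_of
    by (rule Q.acs_plus_bundle_acs [OF Kq(1) [of x] Jp(3) [of x], folded Kq(2) [of x], OF that])
qed

lemma differential_pq:
  assumes \<Phi>: "\<And>x. \<Phi> (x, p x) = (\<phi> x, pq x)"
  shows "differential (bundle_velocity TM) (section_image p) (bundle_velocity TN) \<Phi> (x, p x) (X, M.section_deriv p x X)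
    = (d\<phi> x X, dKN x X)"
  unfolding differential_def
proof (rule the_equality)
  obtain \<gamma> where \<gamma>: "\<gamma> 0 = x" "mfd_velocity AM \<gamma> X" by (rule M.velocity_exists)
  show "\<exists>\<gamma>. (\<forall>t. \<gamma> t \<in> section_image p) \<and> \<gamma> 0 = (x, p x) \<and> bundle_velocity TM \<gamma> (X, M.section_deriv p x X) \<and>
      bundle_velocity TN (\<Phi> \<circ> \<gamma>) (d\<phi> x X, dKN x X)"
    using M.section_velocity [OF p \<gamma>(2,1)] pq_velocity [OF \<gamma>(2,1)] \<gamma>(1)
    by (intro exI [of _ "\<lambda>t. (\<gamma> t, p (\<gamma> t))"]) (simp add: o_def \<Phi> section_image_def)
next
  fix w assume "\<exists>\<gamma>. (\<forall>t. \<gamma> t \<in> section_image p) \<and> \<gamma> 0 = (x, p x) \<and>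
      bundle_velocity TM \<gamma> (X, M.section_deriv p x X) \<and> bundle_velocity TN (\<Phi> \<circ> \<gamma>) w"
  then obtain \<gamma> where \<gamma>: "\<And>t. \<gamma> t \<in> section_image p" "\<gamma> 0 = (x, p x)"
      "bundle_velocity TM \<gamma> (X, M.section_deriv p x X)" "bundle_velocity TN (\<Phi> \<circ> \<gamma>) w"
    by blast
  \<comment> \<open>A curve in the image of a section is determined by its base curve, so every
    admissible curve gives the same velocity.\<close>
  have \<gamma>t: "\<gamma> t = (fst (\<gamma> t), p (fst (\<gamma> t)))" for t
    using \<gamma>(1) [of t] by (auto simp: section_image_def)
  have "(\<Phi> \<circ> \<gamma>) t = (\<phi> (fst (\<gamma> t)), pq (fst (\<gamma> t)))" for t
    using \<Phi> [of "fst (\<gamma> t)"] \<gamma>t [of t] by simp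
  then have eq: "\<Phi> \<circ> \<gamma> = (\<lambda>t. (\<phi> (fst (\<gamma> t)), pq (fst (\<gamma> t))))" by (rule ext)
  have v: "mfd_velocity AM (\<lambda>t. fst (\<gamma> t)) X"
    using \<gamma>(3) by (simp add: bundle_velocity_def M.bundle_simps o_def)
  have x: "fst (\<gamma> 0) = x" by (simp add: \<gamma>(2))
  from pq_velocity [OF v x] have "bundle_velocity TN (\<Phi> \<circ> \<gamma>) (d\<phi> x X, dKN x X)"
    by (simp only: eq)
  from bundle_velocity_unique [OF \<gamma>(4) this] show "w = (d\<phi> x X, dKN x X)" .
qed

text \<open>Invariance of the tangent spaces of the image of \<open>p\<close> under
  \<open>J_nonint\<close> is the holomorphy of \<open>p\<close>. Given it, the
  \<open>-i\<close>-eigenspace of the restricted structure is a graph over the whole tangent space,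
  and holomorphy of \<open>\<Phi>\<close> becomes a condition on every \<open>X\<close>.\<close>

lemma twistorial_iff:
  assumes \<Phi>: "\<And>x. \<Phi> (x, p x) = (\<phi> x, pq x)"
  shows "twistorial AM cM DM AN cN DN \<phi> p \<Phi> \<longleftrightarrow>
    (\<forall>x X. M.section_cov p x (Jp x *v X) = - (Jp x ** M.section_cov p x X)) \<and>
    (\<forall>x X. V x (Jp x *v X) = - (KN x ** V x X))"
proof -
  let ?S = "section_image p"
  let ?T = "\<lambda>x. {(X, M.section_deriv p x X) |X. True}"
  have ball_S: "(\<forall>s\<in>?S. P s) \<longleftrightarrow> (\<forall>x. P (x, p x))" for P
    by (auto simp: section_image_def)
  have JM: "J_nonint AM cM DM (x, p x) v = M.bundle_acs x (Jp x) (Jp x) v" if "v \<in> ?T x" for x v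
    using that M.section_deriv_in_tangent [OF p] by (intro J_nonint_p) auto
  have acs: "M.bundle_acs x (Jp x) (Jp x) (X, M.section_deriv p x X) = (Jp x *v X, M.section_deriv p x (Jp x *v X)) \<longleftrightarrow>
      M.section_cov p x (Jp x *v X) = - (Jp x ** M.section_cov p x X)" for x X
    using M.bundle_acs_section [of x p "Jp x" X] by (simp only: Jp_def)
  have pres: "J_nonint AM cM DM (x, p x) ` ?T x \<subseteq> ?T x \<longleftrightarrow>
      (\<forall>X. M.section_cov p x (Jp x *v X) = - (Jp x ** M.section_cov p x X))" for x
  proof -
    have "J_nonint AM cM DM (x, p x) ` ?T x \<subseteq> ?T x \<longleftrightarrow>
        (\<forall>X. M.bundle_acs x (Jp x) (Jp x) (X, M.section_deriv p x X) \<in> ?T x)"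
      using JM [of _ x] by (auto simp: image_subset_iff)
    \<comment> \<open>The first component of the image is \<open>Jp x *v X\<close>, which leaves a
      single candidate in \<open>?T x\<close>.\<close>
    also have "\<dots> \<longleftrightarrow> (\<forall>X. M.bundle_acs x (Jp x) (Jp x) (X, M.section_deriv p x X) = (Jp x *v X, M.section_deriv p x (Jp x *v X)))"
      by (auto simp: M.bundle_acs_def)
    finally show ?thesis by (simp only: acs)
  qed
  have hol: "holomorphic_map (bundle_velocity TM) ?S (J_nonint AM cM DM)
      (bundle_velocity TN) (isotropic_bundle TN) (J_nonint AN cN DN) \<Phi> \<longleftrightarrow>
      (\<forall>x X. V x (Jp x *v X) = - (KN x ** V x X))"
    if pp: "\<And>x X. M.section_cov p x (Jp x *v X) = - (Jp x ** M.section_cov p x X)"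
  proof -
    have "cmap (differential (bundle_velocity TM) ?S (bundle_velocity TN) \<Phi> (x, p x)) `
          eig_minus_i (?T x) (J_nonint AM cM DM (x, p x))
        \<subseteq> eig_minus_i (bundle_tangent TN (\<phi> x, pq x)) (J_nonint AN cN DN (\<phi> x, pq x)) \<longleftrightarrow>
        (\<forall>X. V x (Jp x *v X) = - (KN x ** V x X))" for x
    proof -
      have acs': "M.bundle_acs x (Jp x) (Jp x) (X, M.section_deriv p x X) = (Jp x *v X, M.section_deriv p x (Jp x *v X))" for X
        using pp by (simp add: acs)
      have neg: "M.section_deriv p x (- X) = - M.section_deriv p x X" for X
        by (rule linear_neg [OF has_mderiv_linear [OF M.smooth_section_mderiv [OF p]]])
      have Jv: "J_nonint AM cM DM (x, p x) (X, M.section_deriv p x X) = (Jp x *v X, M.section_deriv p x (Jp x *v X))" for X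
        using JM [of "(X, M.section_deriv p x X)" x] acs' by auto
      have eS: "eig_minus_i (?T x) (J_nonint AM cM DM (x, p x)) = {(v, J_nonint AM cM DM (x, p x) v) |v. v \<in> ?T x}"
        by (rule eig_minus_i_complex_structure) (auto simp: Jv JJ neg)
      have csN: "complex_structure (bundle_tangent TN (\<phi> x, pq x)) (N.bundle_acs (\<phi> x) (KN x) (KN x))"
        using N.bundle_acs_complex_structure [OF KN_positive KN_sq] by (simp add: pq_graph)
      have JN: "J_nonint AN cN DN (\<phi> x, pq x) v = N.bundle_acs (\<phi> x) (KN x) (KN x) v"
        if "v \<in> bundle_tangent TN (\<phi> x, pq x)" for v
        using N.J_nonint_graph [OF KN_positive] that by (simp add: pq_graph)
      have eS': "eig_minus_i (?T x) (J_nonint AM cM DM (x, p x))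
        = {((X, M.section_deriv p x X), (Jp x *v X, M.section_deriv p x (Jp x *v X))) |X. True}"
        unfolding eS by (auto simp: Jv)
      have d: "cmap (differential (bundle_velocity TM) ?S (bundle_velocity TN) \<Phi> (x, p x))
          ((X, M.section_deriv p x X), (Jp x *v X, M.section_deriv p x (Jp x *v X)))
        = ((d\<phi> x X, dKN x X), (d\<phi> x (Jp x *v X), dKN x (Jp x *v X)))" for X
        by (simp add: cmap_def differential_pq [OF \<Phi>])
      have "cmap (differential (bundle_velocity TM) ?S (bundle_velocity TN) \<Phi> (x, p x)) `
          eig_minus_i (?T x) (J_nonint AM cM DM (x, p x))
        \<subseteq> eig_minus_i (bundle_tangent TN (\<phi> x, pq x)) (J_nonint AN cN DN (\<phi> x, pq x)) \<longleftrightarrow>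
        (\<forall>X. ((d\<phi> x X, dKN x X), (d\<phi> x (Jp x *v X), dKN x (Jp x *v X)))
          \<in> eig_minus_i (bundle_tangent TN (\<phi> x, pq x)) (J_nonint AN cN DN (\<phi> x, pq x)))"
        unfolding eS' d [symmetric] by blast
      also have "\<dots> \<longleftrightarrow>
          (\<forall>X. (d\<phi> x (Jp x *v X), dKN x (Jp x *v X)) = N.bundle_acs (\<phi> x) (KN x) (KN x) (d\<phi> x X, dKN x X))"
        by (simp only: eig_minus_i_mem [OF csN JN] pq_deriv_in_tangent simp_thms)
      also have "\<dots> \<longleftrightarrow> (\<forall>X. V x (Jp x *v X) = - (KN x ** V x X))"
      proof -
        have kd: "KN x *v d\<phi> x X = d\<phi> x (Jp x *v X)" for X
          using KN_L_apply [of x X] by (simp add: L_apply)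
        have "N.bundle_acs (\<phi> x) (KN x) (KN x) (d\<phi> x X, dKN x X)
          = (d\<phi> x (Jp x *v X), N.hor (\<phi> x) (KN x) (d\<phi> x (Jp x *v X)) - KN x ** V x X)" for X
          by (simp only: N.bundle_acs_def V_def kd fst_conv snd_conv)
        moreover have "(a, k) = (a, h - m) \<longleftrightarrow> k - h = - m" for a :: "(real, 'n) vec" and k h m :: "((real, 'n) vec, 'n) vec"
          by (simp add: diff_eq_eq)
        ultimately show ?thesis
          by (simp only: V_def)
      qed
      finally show ?thesis .
    qed
    then show ?thesis
      unfolding holomorphic_map_def ball_S \<Phi> M.section_tangent [OF p] by (simp only: pq_in simp_thms)
  qed
  have tw: "twistorial AM cM DM AN cN DN \<phi> p \<Phi> \<longleftrightarrow>
      (\<forall>x. J_nonint AM cM DM (x, p x) ` ?T x \<subseteq> ?T x) \<and>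
      holomorphic_map (bundle_velocity TM) ?S (J_nonint AM cM DM)
      (bundle_velocity TN) (isotropic_bundle TN) (J_nonint AN cN DN) \<Phi>"
    unfolding twistorial_def Let_def ball_S \<Phi> fst_conv M.section_tangent [OF p] by (simp only: simp_thms)
  show ?thesis
    \<comment> \<open>\<open>hol\<close> is available only under the first conjunct, hence the
      congruence rule.\<close>
    unfolding tw pres by (rule conj_cong [OF refl hol]) blast
qed

end

theorem proposition3p4:
  fixes AM :: "('x::{t2_space,second_countable_topology}, 'm::{finite,linorder}) atlas"
    and cM :: "('x, 'm) metric set" and DM :: "('x, 'm) covd"
    and AN :: "('y::{t2_space,second_countable_topology}, 'n::{finite,linorder}) atlas"
    and cN :: "('y, 'n) metric set" and DN :: "('y, 'n) covd"
    and \<phi> :: "'x \<Rightarrow> 'y"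
    and p :: "'x \<Rightarrow> 'm csubspace" and q :: "'x \<Rightarrow> 'n csubspace"
    and \<Phi> :: "('x, 'm) bpoint \<Rightarrow> ('y, 'n) bpoint"
  defines "QM \<equiv> tangent_obundle AM cM DM"
    and "Q \<equiv> normal_obundle AM AN \<phi> cN DN"
  assumes "oriented_weyl_space AM cM DM" and "even CARD('m)"
    and "oriented_weyl_space AN cN DN" and "even CARD('n)"
    and "injective_immersion AM AN \<phi>"
    and "smooth_section QM p" and "isotropic_along AM AN cN \<phi> p"
    and "smooth_section Q q"
    and "\<And>x. \<Phi> (x, p x) = (\<phi> x, ssum (cmap (mfd_deriv AM AN \<phi> x) ` p x) (q x))"
  shows "twistorial AM cM DM AN cN DN \<phi> p \<Phi> \<longleftrightarrow>
    one_one_geodesic AM DM AN DN \<phi> p \<and>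
    holomorphic_map (mfd_velocity AM) UNIV (J_base p)
      (bundle_velocity QM) (isotropic_bundle QM) (J_nonint AM cM DM) (\<lambda>x. (x, p x)) \<and>
    holomorphic_map (mfd_velocity AM) UNIV (J_base p)
      (bundle_velocity Q) (isotropic_bundle Q) (J_section Q p) (\<lambda>x. (x, q x))"
proof -
  interpret weyl_immersion AM cM DM AN cN DN \<phi> p q
    using assms by (intro weyl_immersion.intro weyl_immersion_axioms.intro tangent_bundle.intro) simp_all
  have \<Phi>: "\<Phi> (x, p x) = (\<phi> x, pq x)" for x
    using assms(11) by (simp add: pq_def)
  show ?thesis
    unfolding QM_def Q_def twistorial_iff [OF \<Phi>] one_one_geodesic_iff p_holomorphic_iff q_holomorphic_iff
    using twistorial_pointwise by blast
qed

end
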